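(* Let $\gamma\in(0,1)$, let $n\ge2$ be an integer, and let $0\le\kappa<\Lambda_{n,\gamma}$. Let $\{\sigma_j\},\{\tau_j\},\{c_j\}_{j\ge0}$ be the constants specified in the context, and assume $\tau_j=0$ for all $j$. Let $w=w(t)\ge 0$, $w(t)\to0$ as $t\to\pm\infty$, be a (radially symmetric, decaying) solution of $$P_\gamma^{(0)}w-\kappa w=w^{\frac{n+2\gamma}{n-2\gamma}}\quad\text{on }\mathbb R,$$ and set $$w_j(t)=\int_{\mathbb R}e^{-\sigma_j|t-t'|}\,w(t')^{\frac{n+2\gamma}{n-2\gamma}}\,dt',\qquad j=0,1,\dots,$$ so that $w=\sum_{j\ge0}c_jw_j$. Then $$\frac{1}{2\gamma}\sum_{j}\frac{c_j}{\sigma_j}\int_{\mathbb R}(w_j')^2\,dt=\frac{1}{2(n-\gamma)}\sum_j\sigma_jc_j\int_{\mathbb R}w_j^2\,dt=\frac1n\int_{\mathbb R}w^{\frac{2n}{n-2\gamma}}\,dt.$$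
   Context: $\Lambda_{n,\gamma}=2^{2\gamma}\big(\Gamma(\tfrac{n+2\gamma}{4})/\Gamma(\tfrac{n-2\gamma}{4})\big)^2$ is the fractional Hardy constant. $P_\gamma^{(0)}$ is the conformal fractional Laplacian of the cylinder $\mathbb R\times\mathbb S^{n-1}$ acting on functions of $t$ only: with $r=e^{-t}$, $P_\gamma^{(0)}w=r^{\frac{n+2\gamma}{2}}(-\Delta_{\mathbb R^n})^\gamma\big(r^{-\frac{n-2\gamma}{2}}w(-\log r)\big)$. Equivalently it is the Fourier multiplier on $\mathbb R$ with symbol $$\Theta_0(\xi)=2^{2\gamma}\frac{\Gamma(\frac n4+\frac\gamma2+\frac{\xi i}2)\Gamma(\frac n4+\frac\gamma2-\frac{\xi i}2)}{\Gamma(\frac n4-\frac\gamma2+\frac{\xi i}2)\Gamma(\frac n4-\frac\gamma2-\frac{\xi i}2)},$$ extended meromorphically to $\mathbb C$. For $0\le\kappa<\Lambda_{n,\gamma}$ the poles of $1/(\Theta_0(z)-\kappa)$ are located at $\pm\tau_j\pm i\sigma_j$, $j=0,1,\dots$, with $\tau_0=0$, $\tau_j\ge0$, $\sigma_j>\sigma_0>0$ for $j\ge1$. It is known that the equation $P_\gamma^{(0)}w-\kappa w=h$, for $h$ with $h(t)=O(e^{-\delta t})$ as $t\to+\infty$ and $h(t)=O(e^{\delta_0t})$ as $t\to-\infty$, $\delta,\delta_0>-\sigma_0$, has the particular solution $w=\mathcal G_0*h$ with Green's function $$\mathcal G_0(t)=c_0e^{-\sigma_0|t|}+\sum_{j\ge1}e^{-\sigma_j|t|}[c_j\cos(\tau_j|t|)+c_j'\sin(\tau_j|t|)]$$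 for certain real constants $c_j,c_j'$ depending on $\kappa,n,\gamma$ (obtained from the residues of $1/(\Theta_0-\kappa)$). These are the constants $c_j$ in the statement; when all $\tau_j=0$, $\mathcal G_0(t)=\sum_{j}c_je^{-\sigma_j|t|}$. For the decaying solution $w$ of the statement, $w=\mathcal G_0*h$ with $h=w^{\frac{n+2\gamma}{n-2\gamma}}$, and each $w_j$ solves $w_j''-\sigma_j^2w_j=-2\sigma_jw^{\frac{n+2\gamma}{n-2\gamma}}$. *)

theory Defs
  imports "HOL-Complex_Analysis.Complex_Analysis"
begin

definition hardy_const :: "nat \<Rightarrow> real \<Rightarrow> real" where
  "hardy_const n \<gamma> = 2 powr (2 * \<gamma>) * (Gamma ((n + 2 * \<gamma>) / 4) / Gamma ((n - 2 * \<gamma>) / 4))\<^sup>2"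

(* The meromorphic symbol.  With the library conventions Gamma = 0 at its poles and x / 0 = 0,
   the formula has the correct value (zero) where a Gamma factor of the denominator has a pole;
   at the poles of the symbol itself it returns the junk value 0, which is irrelevant to
   is_pole and residue. *)
definition Theta0 :: "nat \<Rightarrow> real \<Rightarrow> complex \<Rightarrow> complex" where
  "Theta0 n \<gamma> z = of_real (2 powr (2 * \<gamma>)) *
     (Gamma (of_real (n / 4 + \<gamma> / 2) + z * \<i> / 2) * Gamma (of_real (n / 4 + \<gamma> / 2) - z * \<i> / 2)) /
     (Gamma (of_real (n / 4 - \<gamma> / 2) + z * \<i> / 2) * Gamma (of_real (n / 4 - \<gamma> / 2) - z * \<i> / 2))"

definition resolvent_symbol :: "nat \<Rightarrow> real \<Rightarrow> real \<Rightarrow> complex \<Rightarrow> complex" where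
  "resolvent_symbol n \<gamma> \<kappa> z = 1 / (Theta0 n \<gamma> z - of_real \<kappa>)"

(* The quadruples of poles are listed without repetition (injectivity), so that
   no pole is counted twice in a sum over j. *)
definition pole_data :: "nat \<Rightarrow> real \<Rightarrow> real \<Rightarrow> (nat \<Rightarrow> real) \<Rightarrow> (nat \<Rightarrow> real) \<Rightarrow> bool" where
  "pole_data n \<gamma> \<kappa> \<sigma> \<tau> \<longleftrightarrow>
     {z. is_pole (resolvent_symbol n \<gamma> \<kappa>) z} =
       (\<Union>j. {Complex (\<tau> j) (\<sigma> j), Complex (\<tau> j) (- \<sigma> j),
             Complex (- \<tau> j) (\<sigma> j), Complex (- \<tau> j) (- \<sigma> j)}) \<and>
     inj (\<lambda>j. (\<tau> j, \<sigma> j)) \<and>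
     \<tau> 0 = 0 \<and> (\<forall>j. \<tau> j \<ge> 0) \<and> \<sigma> 0 > 0 \<and> (\<forall>j\<ge>1. \<sigma> j > \<sigma> 0)"

(* Coefficient of exp (-\<sigma>|t|) cos (\<tau>|t|) in the Green's function
     G(t) = 1/(2 pi) * (integral of exp (i x t) / (Theta0 x - \<kappa>) over real x).
   Closing the contour in the upper half-plane for t > 0, a simple pole z contributes
   i exp (i z t) Res z; for \<tau> > 0 the poles \<tau> + i \<sigma> and -\<tau> + i \<sigma> give complex conjugate
   contributions, for \<tau> = 0 they coincide. *)
definition green_coeff :: "nat \<Rightarrow> real \<Rightarrow> real \<Rightarrow> real \<Rightarrow> real \<Rightarrow> real" where
  "green_coeff n \<gamma> \<kappa> \<sigma> \<tau> =
     (if \<tau> = 0 then 1 else 2) * Re (\<i> * residue (resolvent_symbol n \<gamma> \<kappa>) (Complex \<tau> \<sigma>))"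

definition schwartz :: "(real \<Rightarrow> complex) \<Rightarrow> bool" where
  "schwartz \<phi> \<longleftrightarrow> (\<exists>D :: nat \<Rightarrow> real \<Rightarrow> complex.
     D 0 = \<phi> \<and>
     (\<forall>k t. (D k has_vector_derivative D (Suc k) t) (at t)) \<and>
     (\<forall>k m. bounded (range (\<lambda>t. t ^ m *\<^sub>R D k t))))"

definition fourier :: "(real \<Rightarrow> complex) \<Rightarrow> real \<Rightarrow> complex" where
  "fourier \<phi> \<xi> = (LINT t|lborel. exp (- \<i> * of_real (\<xi> * t)) * \<phi> t)"

(* The operator P on Schwartz functions: the Fourier multiplier with symbol Theta0. *)
definition cyl_frac_lap :: "nat \<Rightarrow> real \<Rightarrow> (real \<Rightarrow> complex) \<Rightarrow> real \<Rightarrow> complex" where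
  "cyl_frac_lap n \<gamma> \<phi> t =
     (LINT \<xi>|lborel. exp (\<i> * of_real (\<xi> * t)) * (Theta0 n \<gamma> (of_real \<xi>) * fourier \<phi> \<xi>)) / of_real (2 * pi)"

(* P w = f for bounded continuous w and f, in the sense of tempered distributions.
   Theta0 is even, smooth and polynomially bounded (with all derivatives) on the real line, so P
   maps Schwartz functions to Schwartz functions and is symmetric for the bilinear pairing. *)
definition cyl_frac_lap_eq :: "nat \<Rightarrow> real \<Rightarrow> (real \<Rightarrow> real) \<Rightarrow> (real \<Rightarrow> real) \<Rightarrow> bool" where
  "cyl_frac_lap_eq n \<gamma> w f \<longleftrightarrow> (\<forall>\<phi>. schwartz \<phi> \<longrightarrow>
     (LINT t|lborel. of_real (w t) * cyl_frac_lap n \<gamma> \<phi> t) =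
     (LINT t|lborel. of_real (f t) * \<phi> t))"

definition crit_exp :: "nat \<Rightarrow> real \<Rightarrow> real" where
  "crit_exp n \<gamma> = (n + 2 * \<gamma>) / (n - 2 * \<gamma>)"

definition decaying_solution :: "nat \<Rightarrow> real \<Rightarrow> real \<Rightarrow> (real \<Rightarrow> real) \<Rightarrow> bool" where
  "decaying_solution n \<gamma> \<kappa> w \<longleftrightarrow>
     continuous_on UNIV w \<and> (\<forall>t. w t \<ge> 0) \<and>
     (w \<longlongrightarrow> 0) at_top \<and> (w \<longlongrightarrow> 0) at_bot \<and>
     cyl_frac_lap_eq n \<gamma> w (\<lambda>t. \<kappa> * w t + w t powr crit_exp n \<gamma>)"

definition component :: "nat \<Rightarrow> real \<Rightarrow> (real \<Rightarrow> real) \<Rightarrow> real \<Rightarrow> real \<Rightarrow> real" where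
  "component n \<gamma> w s t = (LINT t'|lborel. exp (- s * \<bar>t - t'\<bar>) * w t' powr crit_exp n \<gamma>)"

end

theory Submission
  imports Defs "HOL-Probability.Probability" "HOL-Real_Asymp.Real_Asymp"
begin

text \<open>In the variable \<open>x = - z\<^sup>2 / 4\<close> the symbol is, by Euler's product for the Gamma function, a limit of rational
  functions with positive interlacing zeros and poles.  Hence \<open>1 / (\<Theta>\<^sub>0 - \<kappa>)\<close> is a sum of simple fractions with
  positive coefficients: all poles are simple, \<open>c\<^sub>j > 0\<close> and \<open>\<Sum>\<^sub>j c\<^sub>j / \<sigma>\<^sub>j < \<infinity>\<close>.  Testing the equation against
  \<open>G * \<psi>\<close> with Gaussian \<open>\<psi>\<close> gives \<open>w = \<Sum>\<^sub>j c\<^sub>j W\<^sub>j\<close>.  By positivity of the \<open>c\<^sub>j\<close> the solution is integrable and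
  continuously differentiable with \<open>w' = \<Sum>\<^sub>j c\<^sub>j W\<^sub>j'\<close>, so that \<open>W\<^sub>j'' = \<sigma>\<^sub>j\<^sup>2 W\<^sub>j - 2 \<sigma>\<^sub>j w\<^sup>p\<close>, with \<open>p\<close> the critical
  exponent, multiplied by \<open>c\<^sub>j W\<^sub>j' / \<sigma>\<^sub>j\<close> and summed, yields the conserved quantity
  \<open>\<Sum>\<^sub>j (c\<^sub>j / \<sigma>\<^sub>j) W\<^sub>j'\<^sup>2 - \<Sum>\<^sub>j c\<^sub>j \<sigma>\<^sub>j W\<^sub>j\<^sup>2 + 4 / (p + 1) w\<^sup>p\<^sup>+\<^sup>1 = 0\<close>.  Multiplied by \<open>c\<^sub>j W\<^sub>j / \<sigma>\<^sub>j\<close>, integrated and summed, it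
  yields the energy identity.  These two linear relations between the three integrals give the claim.\<close>

section \<open>Partial fractions of interlacing quotients\<close>

text \<open>Only the sum of \<open>c j / \<sigma> j\<close> is under control: the symbol grows like
  \<open>\<bar>\<xi>\<bar> powr (2 * \<gamma>)\<close>, so the sum of the \<open>c j\<close>,
  formally the Green function at 0, may diverge. The immediate bound
  \<open>\<bar>W' j t\<bar> \<le> 2 * M\<close> therefore does not permit termwise differentiation.
  A Lipschitz bound for \<open>w\<close> has to come first; it improves the estimate to a multiple
  of 1 / \<open>\<sigma> j\<close>. The finite products are used because the partial fractions of a
  rational function are algebra with visible signs. Positivity makes the value at 0 a uniform bound
  for all coefficients, hence compactness. The price is a constant that might survive the limit; it
  is excluded because the prefactors of the products tend to infinity. The Hardy constant is the
  value of the symbol at 0, so \<open>\<kappa> < hardy_const n \<gamma>\<close> enters as the sign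
  of a numerator polynomial at 0 and keeps its smallest zero positive. The equation is known only
  through pairings with Schwartz functions. The resolvent is therefore applied to the test function,
  where every Fourier integral converges absolutely, and not to \<open>w\<close>.\<close>

text \<open>The intermediate value theorem gives the numerator on the right one zero
  \<open>X k\<close> in each gap below \<open>\<alpha> k\<close>. There are as many gaps as the
  degree, so these are all its zeros, and their interlacing with the \<open>\<beta> k\<close> fixes
  the sign of every coefficient. The identity is multiplied out so that it also covers the zeros of
  the left-hand side.\<close>

lemma interlacing_partial_fractions:
  fixes \<alpha> \<beta> :: "nat \<Rightarrow> real" and C \<kappa> :: real and m :: nat
  assumes pos: "0 < \<alpha> 0" and ab: "\<And>k. \<alpha> k < \<beta> k" and ba: "\<And>k. \<beta> k < \<alpha> (Suc k)"
    and \<kappa>: "0 \<le> \<kappa>" and C: "\<kappa> < C"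
    and pos0: "\<kappa> * (\<Prod>k\<le>m. \<beta> k) < C * (\<Prod>k\<le>m. \<alpha> k)"
  obtains X B where
    "\<And>k. k \<le> m \<Longrightarrow> (case k of 0 \<Rightarrow> 0 | Suc i \<Rightarrow> \<beta> i) < X k \<and> X k \<le> \<alpha> k"
    "\<And>k. k \<le> m \<Longrightarrow> 0 \<le> B k"
    "\<And>z::complex. z \<notin> of_real ` X ` {..m} \<Longrightarrow>
       (\<Prod>k\<le>m. of_real (\<beta> k) - z) =
       (1 / of_real (C - \<kappa>) + (\<Sum>k\<le>m. of_real (B k) / (of_real (X k) - z))) *
       (of_real C * (\<Prod>k\<le>m. of_real (\<alpha> k) - z) - of_real \<kappa> * (\<Prod>k\<le>m. of_real (\<beta> k) - z))"
proof -
  have mono_b: "\<beta> i \<le> \<beta> j" if "i \<le> j" for i j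
    using lift_Suc_mono_le[of \<beta>] ab ba that by (meson less_imp_le order_less_trans less_trans)
  have mono_a: "\<alpha> i \<le> \<alpha> j" if "i \<le> j" for i j
    using lift_Suc_mono_le[of \<alpha>] ab ba that by (meson less_imp_le order_less_trans less_trans)
  define l where "l k = (case k of 0 \<Rightarrow> 0 | Suc i \<Rightarrow> \<beta> i)" for k
  have l_less: "l k < \<alpha> k" for k
    using pos ba by (cases k) (auto simp: l_def)
  have b_le_l: "\<beta> i \<le> l k" if "i < k" for i k
    using that mono_b by (cases k) (auto simp: l_def)
  have a_le_l: "\<alpha> i < l k" if "i < k" for i k
    using ab[of i] b_le_l[OF that] by linarith
  define f where "f x = C * (\<Prod>k\<le>m. \<alpha> k - x) - \<kappa> * (\<Prod>k\<le>m. \<beta> k - x)" for x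
  have C0: "C > 0" using \<kappa> C by linarith
  have "\<exists>x. l k < x \<and> x \<le> \<alpha> k \<and> f x = 0" if k: "k \<le> m" for k
  proof -
    have fa: "f (\<alpha> k) = - \<kappa> * (\<Prod>i\<le>m. \<beta> i - \<alpha> k)"
      using k by (auto simp: f_def intro!: prod_zero)
    have fl0: "f (l k) \<noteq> 0 \<and> f (l k) * f (\<alpha> k) \<le> 0"
    proof (cases k)
      case 0
      have "f (l k) > 0" using pos0 by (simp add: f_def l_def 0)
      moreover have "\<alpha> 0 < \<beta> i" for i using mono_a[of 0 i] ab[of i] by linarith
      then have "f (\<alpha> k) \<le> 0"
        unfolding fa using \<kappa> 0 by (simp add: prod_nonneg less_imp_le)
      ultimately show ?thesis by (simp add: mult_le_0_iff)
    next
      case (Suc j)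
      have fl: "f (l k) = C * (\<Prod>i\<le>m. \<alpha> i - l k)"
        using k by (auto simp: f_def l_def Suc intro!: prod_zero)
      have nz: "\<alpha> i \<noteq> l k" for i
        using a_le_l[of i k] l_less[of k] mono_a[of k i] by (cases "i < k") auto
      \<comment> \<open>At \<open>l k\<close>, which is \<beta> of the previous index, only the
        first product in \<open>f\<close> survives, at \<open>\<alpha> k\<close> only the second.
        Factors of equal index are paired: both are nonpositive for i < k and nonnegative from k
        on.\<close>
      have "f (l k) * f (\<alpha> k) = - (C * \<kappa> * (\<Prod>i\<le>m. (\<alpha> i - l k) * (\<beta> i - \<alpha> k)))"
        by (simp add: fl fa prod.distrib)
      moreover have "(\<alpha> i - l k) * (\<beta> i - \<alpha> k) \<ge> 0" for i
      proof (cases "i < k")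
        case True
        then show ?thesis using a_le_l[of i k] b_le_l[of i k] l_less[of k]
          by (intro mult_nonpos_nonpos) auto
      next
        case False
        then show ?thesis using mono_a[of k i] l_less[of k] ab[of i] by (intro mult_nonneg_nonneg) auto
      qed
      ultimately show ?thesis
        using C0 \<kappa> nz by (simp add: prod_nonneg fl del: mult_less_0_iff zero_le_mult_iff)
    qed
    have cont: "continuous_on {l k..\<alpha> k} f" "continuous_on {l k..\<alpha> k} (\<lambda>x. - f x)"
      unfolding f_def by (intro continuous_intros)+
    have "\<exists>x. l k \<le> x \<and> x \<le> \<alpha> k \<and> f x = 0"
    proof (cases "f (l k) \<le> 0")
      case True
      then have "f (\<alpha> k) \<ge> 0" using fl0 by (auto simp: mult_le_0_iff)
      then show ?thesis using IVT'[of f "l k" 0 "\<alpha> k"] True cont l_less[of k] by auto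
    next
      case False
      then have "f (\<alpha> k) \<le> 0" using fl0 by (auto simp: mult_le_0_iff)
      then show ?thesis using IVT'[of "\<lambda>x. - f x" "l k" 0 "\<alpha> k"] False cont l_less[of k] by auto
    qed
    then show ?thesis using fl0 by (metis order_le_less)
  qed
  then obtain X where X: "\<And>k. k \<le> m \<Longrightarrow> l k < X k \<and> X k \<le> \<alpha> k \<and> f (X k) = 0"
    by metis
  have X_less: "X i < X k" if "i < k" "k \<le> m" for i k
    using X[of i] X[of k] a_le_l[of i k] that by auto
  have X_inj: "inj_on X {..m}"
    by (intro inj_onI) (metis X_less atMost_iff nat_neq_iff order_less_irrefl)
  \<comment> \<open>The coefficient of 1 / (X k - z) in the quotient of the two products over
    \<beta> - z and X - z. It is written as a product of quotients with equal index because each of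
    these is nonnegative by interlacing.\<close>
  define e where "e k = (\<beta> k - X k) * (\<Prod>i\<in>{..m}-{k}. (\<beta> i - X k) / (X i - X k))" for k
  have e_nonneg: "e k \<ge> 0" if k: "k \<le> m" for k
    unfolding e_def
  proof (intro mult_nonneg_nonneg prod_nonneg ballI)
    show "0 \<le> \<beta> k - X k" using X[OF k] ab[of k] by auto
    fix i assume i: "i \<in> {..m} - {k}"
    show "0 \<le> (\<beta> i - X k) / (X i - X k)"
    proof (cases "i < k")
      case True
      then have "\<beta> i \<le> X k" using b_le_l[of i k] X[OF k] by auto
      moreover have "X i < X k" using X_less True k by auto
      ultimately show ?thesis by (intro divide_nonpos_nonpos) auto
    next
      case False
      with i have "k < i" "i \<le> m" by auto
      moreover have "X k \<le> \<beta> i" using X[OF k] mono_a[of k i] ab[of i] \<open>k < i\<close> by auto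
      moreover have "X k < X i" using X_less \<open>k < i\<close> \<open>i \<le> m\<close> by auto
      ultimately show ?thesis by auto
    qed
  qed
  define L where "L u = [:complex_of_real u, -1:]" for u
  have [simp]: "poly (L u) z = of_real u - z" for u z by (simp add: L_def)
  have degL: "degree (\<Prod>k\<in>S. L (g k)) = card S" and lcL: "poly.coeff (\<Prod>k\<in>S. L (g k)) (card S) = (-1) ^ card S"
    if "finite S" for S :: "nat set" and g
  proof -
    have [simp]: "L (g k) \<noteq> 0" "degree (L (g k)) = 1" "lead_coeff (L (g k)) = -1" for k by (simp_all add: L_def)
    show d: "degree (\<Prod>k\<in>S. L (g k)) = card S"
      by (subst degree_prod_eq_sum_degree) auto
    have "lead_coeff (\<Prod>k\<in>S. L (g k)) = (-1) ^ card S"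
      by (subst lead_coeff_prod) (simp add: L_def)
    then show "poly.coeff (\<Prod>k\<in>S. L (g k)) (card S) = (-1) ^ card S" by (simp add: d)
  qed
  define P where "P = (\<Prod>k\<le>m. L (\<alpha> k))"
  define Q where "Q = (\<Prod>k\<le>m. L (\<beta> k))"
  define Y where "Y = (\<Prod>k\<le>m. L (X k))"
  define N where "N = smult (of_real C) P - smult (of_real \<kappa>) Q"
  define A where "A = complex_of_real ` X ` {..m}"
  have cardA: "card A = Suc m"
    unfolding A_def using X_inj by (subst card_image) (auto simp: card_image inj_on_def)
  have dP: "degree P = Suc m" "poly.coeff P (Suc m) = (-1)^Suc m"
    and dQ: "degree Q = Suc m" "poly.coeff Q (Suc m) = (-1)^Suc m"
    and dY: "degree Y = Suc m" "poly.coeff Y (Suc m) = (-1)^Suc m"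
    using degL[of "{..m}"] lcL[of "{..m}"] by (simp_all add: P_def Q_def Y_def)
  have dN: "degree N \<le> Suc m" unfolding N_def
    by (intro degree_diff_le order_trans[OF degree_smult_le]) (simp_all add: dP dQ)
  have Nf: "poly N (of_real x) = of_real (f x)" for x
    by (simp add: N_def f_def P_def Q_def poly_prod)
  have Y0: "poly Y (of_real (X k)) = 0" if "k \<le> m" for k
    using that by (auto simp: Y_def poly_prod intro!: prod_zero)
  \<comment> \<open>Two polynomials of degree at most \<open>Suc m\<close> with the same coefficient
    there and the same values at the \<open>Suc m\<close> points of \<open>A\<close>; the leading
    coefficient replaces one interpolation point.\<close>
  have NY: "N = smult (of_real (C - \<kappa>)) Y"
  proof (rule poly_eqI_degree_lead_coeff[where n = "Suc m" and A = A])
    show "poly.coeff N (Suc m) = poly.coeff (smult (complex_of_real (C - \<kappa>)) Y) (Suc m)"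
      by (simp add: N_def dP dQ dY algebra_simps)
    fix z assume "z \<in> A"
    then obtain k where "k \<le> m" "z = of_real (X k)" by (auto simp: A_def)
    then show "poly N z = poly (smult (complex_of_real (C - \<kappa>)) Y) z"
      using Nf X Y0 by simp
  qed (simp_all add: dN cardA dY)
  define Z where "Z k = (\<Prod>i\<in>{..m}-{k}. L (X i))" for k
  have dZ: "degree (Z k) = m" if "k \<le> m" for k
    unfolding Z_def using that by (subst degL) (auto simp: card_Diff_singleton)
  have dS: "degree (\<Sum>k\<le>m. smult (of_real (e k)) (Z k)) \<le> m"
    by (intro degree_sum_le order_trans[OF degree_smult_le]) (auto simp: dZ)
  \<comment> \<open>Lagrange interpolation: at the point \<open>X k\<close> all summands but the one
    with \<open>Z k\<close> vanish.\<close>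
  have QY: "Q = Y + (\<Sum>k\<le>m. smult (of_real (e k)) (Z k))"
  proof (rule poly_eqI_degree_lead_coeff[where n = "Suc m" and A = A])
    show "poly.coeff Q (Suc m) = poly.coeff (Y + (\<Sum>k\<le>m. smult (of_real (e k)) (Z k))) (Suc m)"
      using dS by (simp add: dQ dY coeff_eq_0)
    show "degree (Y + (\<Sum>k\<le>m. smult (complex_of_real (e k)) (Z k))) \<le> Suc m"
      using dS by (intro degree_add_le) (auto simp: dY)
    fix z assume "z \<in> A"
    then obtain k where k: "k \<le> m" "z = of_real (X k)" by (auto simp: A_def)
    have "poly (Z i) z = 0" if "i \<noteq> k" "i \<le> m" for i
      using k that by (auto simp: Z_def poly_prod intro!: prod_zero)
    then have "(\<Sum>i\<le>m. of_real (e i) * poly (Z i) z) = (\<Sum>i\<le>m. if i = k then of_real (e k) * poly (Z k) z else 0)"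
      by (intro sum.cong) auto
    also have "\<dots> = of_real (e k) * poly (Z k) z" using k by simp
    also have "poly (Z k) z = of_real (\<Prod>i\<in>{..m}-{k}. X i - X k)"
      by (simp add: Z_def poly_prod k)
    also have "of_real (e k) * \<dots> = complex_of_real (e k * (\<Prod>i\<in>{..m}-{k}. X i - X k))" by simp
    also have "e k * (\<Prod>i\<in>{..m}-{k}. X i - X k) = (\<beta> k - X k) * (\<Prod>i\<in>{..m}-{k}. (\<beta> i - X k) / (X i - X k) * (X i - X k))"
      by (simp only: e_def prod.distrib mult_ac)
    also have "(\<Prod>i\<in>{..m}-{k}. (\<beta> i - X k) / (X i - X k) * (X i - X k)) = (\<Prod>i\<in>{..m}-{k}. \<beta> i - X k)"
      using X_inj k by (intro prod.cong) (auto simp: inj_on_def)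
    also have "(\<beta> k - X k) * \<dots> = (\<Prod>i\<le>m. \<beta> i - X k)"
      using k by (subst (2) prod.remove[of _ k]) auto
    also have "complex_of_real \<dots> = poly Q z" by (simp add: Q_def poly_prod k)
    finally show "poly Q z = poly (Y + (\<Sum>k\<le>m. smult (complex_of_real (e k)) (Z k))) z"
      using Y0 k by (simp add: poly_sum)
  qed (simp_all add: cardA dQ)
  show thesis
  proof (rule that[of X "\<lambda>k. e k / (C - \<kappa>)"])
    show "(case k of 0 \<Rightarrow> 0 | Suc i \<Rightarrow> \<beta> i) < X k \<and> X k \<le> \<alpha> k" if "k \<le> m" for k
      using X[OF that] by (simp add: l_def)
    show "0 \<le> e k / (C - \<kappa>)" if "k \<le> m" for k using e_nonneg[OF that] C by simp
    fix z :: complex assume z: "z \<notin> of_real ` X ` {..m}"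
    have YZ: "poly Y z / (of_real (X k) - z) = poly (Z k) z" if "k \<le> m" for k
    proof -
      have "poly Y z = (of_real (X k) - z) * poly (Z k) z"
        unfolding Y_def Z_def poly_prod using that by (subst prod.remove[of _ k]) auto
      moreover have "of_real (X k) - z \<noteq> 0" using z that by auto
      ultimately show ?thesis by simp
    qed
    have c0: "complex_of_real (C - \<kappa>) \<noteq> 0" using C by simp
    have eq: "(1 / c + (\<Sum>k\<le>m. g k / c / h k)) * (c * y) = y + (\<Sum>k\<le>m. g k * (y / h k))"
      if "c \<noteq> 0" for c y :: complex and g h :: "nat \<Rightarrow> complex"
    proof -
      have "(\<Sum>k\<le>m. g k / c / h k) * (c * y) = (\<Sum>k\<le>m. g k * (y / h k))"
        unfolding sum_distrib_right using that by (intro sum.cong) auto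
      then show ?thesis using that by (simp add: distrib_right)
    qed
    have "(1 / of_real (C - \<kappa>) + (\<Sum>k\<le>m. of_real (e k / (C - \<kappa>)) / (of_real (X k) - z))) * poly N z =
       poly Y z + (\<Sum>k\<le>m. of_real (e k) * (poly Y z / (of_real (X k) - z)))"
      unfolding NY poly_smult of_real_divide by (rule eq[OF c0])
    also have "\<dots> = poly Q z"
      unfolding QY by (simp add: poly_sum YZ)
    finally show "(\<Prod>k\<le>m. of_real (\<beta> k) - z) =
       (1 / of_real (C - \<kappa>) + (\<Sum>k\<le>m. of_real (e k / (C - \<kappa>)) / (of_real (X k) - z))) *
       (of_real C * (\<Prod>k\<le>m. of_real (\<alpha> k) - z) - of_real \<kappa> * (\<Prod>k\<le>m. of_real (\<beta> k) - z))"
      by (simp add: Q_def N_def P_def poly_prod)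
  qed
qed

text \<open>Compactness. The zeros stay in fixed intervals; the coefficients divided by the zeros
  are nonnegative, and their sum is bounded through the value at 0. A diagonal subsequence
  converges, but mass may escape to infinity and leave an additive constant \<open>c\<close>. A
  positive \<open>c\<close> would keep \<open>r\<close> bounded on the negative axis, which is
  impossible because \<open>C\<close> tends to infinity.\<close>

lemma interlacing_quotient_limit:
  fixes \<alpha> \<beta> C :: "nat \<Rightarrow> real" and \<kappa> :: real and r :: "complex \<Rightarrow> complex"
  assumes pos: "0 < \<alpha> 0" and ab: "\<And>k. \<alpha> k < \<beta> k" and ba: "\<And>k. \<beta> k < \<alpha> (Suc k)"
    and sum\<alpha>: "summable (\<lambda>k. 1 / \<alpha> k)"
    and \<kappa>: "0 \<le> \<kappa>" "\<kappa> < Re (r 0)" and C: "filterlim C at_top sequentially"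
    and conv: "\<And>z. (\<lambda>m. of_real (C m) * (\<Prod>k\<le>m. (of_real (\<alpha> k) - z) / (of_real (\<beta> k) - z))) \<longlonglongrightarrow> r z"
  obtains y d :: "nat \<Rightarrow> real" where
    "\<And>k. (case k of 0 \<Rightarrow> 0 | Suc i \<Rightarrow> \<beta> i) \<le> y k" "\<And>k. y k \<le> \<alpha> k"
    "\<And>k. 0 \<le> d k" "summable d"
    "\<And>z. z \<notin> range (\<lambda>k. of_real (y k)) \<Longrightarrow> z \<notin> range (\<lambda>k. of_real (\<beta> k)) \<Longrightarrow>
       (r z - of_real \<kappa>) * (\<Sum>k. of_real (d k * y k) / (of_real (y k) - z)) = 1"
proof -
  define l where "l k = (case k of 0 \<Rightarrow> 0 | Suc i \<Rightarrow> \<beta> i)" for k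
  have mono_a: "\<alpha> i \<le> \<alpha> j" if "i \<le> j" for i j
    using lift_Suc_mono_le[of \<alpha>] ab ba that by (meson less_imp_le order_less_trans less_trans)
  have apos: "\<alpha> k > 0" for k using mono_a[of 0 k] pos by simp
  have bpos: "\<beta> k > 0" for k using apos[of k] ab[of k] by simp
  have l_ge: "\<alpha> (k - 1) \<le> l k" if "k > 0" for k
    using that ab by (cases k) (auto simp: l_def intro: less_imp_le)
  have l0: "l k \<ge> 0" for k using bpos by (cases k) (auto simp: l_def intro: less_imp_le)
  define R where "R m x = C m * (\<Prod>k\<le>m. (\<alpha> k - x) / (\<beta> k - x))" for m x
  define \<rho> where "\<rho> x = Re (r (of_real x))" for x
  have Rlim: "(\<lambda>m. R m x) \<longlonglongrightarrow> \<rho> x" for x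
    using tendsto_Re[OF conv[of "of_real x"]]
    by (simp add: R_def \<rho>_def flip: of_real_diff of_real_divide of_real_prod of_real_mult)
  have r_real: "r (of_real x) = of_real (\<rho> x)" for x
    by (rule LIMSEQ_unique[OF conv])
      (use tendsto_of_real[OF Rlim[of x], where 'a = complex] in
        \<open>simp add: R_def flip: of_real_diff of_real_divide of_real_prod of_real_mult\<close>)
  have \<rho>0: "\<kappa> < \<rho> 0" using \<kappa> by (simp add: \<rho>_def)
  have "eventually (\<lambda>m. \<kappa> < C m \<and> \<kappa> < R m 0) sequentially"
    using C Rlim[of 0] \<rho>0 by (auto intro: eventually_conj order_tendstoD simp: filterlim_at_top_dense)
  then obtain m0 where m0: "\<And>m. m \<ge> m0 \<Longrightarrow> \<kappa> < C m \<and> \<kappa> < R m 0"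
    by (auto simp: eventually_sequentially)
  define good where "good m X B \<longleftrightarrow> (\<forall>k\<le>m. l k < X k \<and> X k \<le> \<alpha> k \<and> 0 \<le> B k) \<and>
      (\<forall>z. z \<notin> of_real ` X ` {..m} \<longrightarrow> z \<notin> range (\<lambda>k. of_real (\<beta> k)) \<longrightarrow>
        (1 / of_real (C m - \<kappa>) + (\<Sum>k\<le>m. of_real (B k) / (of_real (X k) - z))) *
        (of_real (C m) * (\<Prod>k\<le>m. (of_real (\<alpha> k) - z) / (of_real (\<beta> k) - z)) - of_real \<kappa>) = (1::complex))"
    for m and X B :: "nat \<Rightarrow> real"
  have "\<exists>X B. good m X B" if m: "m \<ge> m0" for m
  proof -
    have "\<kappa> * (\<Prod>k\<le>m. \<beta> k) < C m * (\<Prod>k\<le>m. \<alpha> k)"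
    proof -
      have "\<kappa> * (\<Prod>k\<le>m. \<beta> k) < R m 0 * (\<Prod>k\<le>m. \<beta> k)"
        using m0[OF m] bpos by (intro mult_strict_right_mono prod_pos) auto
      also have "\<dots> = C m * (\<Prod>k\<le>m. \<alpha> k / \<beta> k * \<beta> k)" by (simp only: R_def prod.distrib mult_ac diff_zero)
      also have "\<dots> = C m * (\<Prod>k\<le>m. \<alpha> k)" using bpos by (simp add: less_imp_neq[symmetric])
      finally show ?thesis .
    qed
    note cond = this
    show ?thesis
    proof (rule interlacing_partial_fractions[where \<alpha> = \<alpha> and \<beta> = \<beta> and C = "C m" and \<kappa> = \<kappa> and m = m,
          OF pos ab ba \<kappa>(1) conjunct1[OF m0[OF m]] cond])
      fix X B :: "nat \<Rightarrow> real"
      assume XB: "\<And>k. k \<le> m \<Longrightarrow> (case k of 0 \<Rightarrow> 0 | Suc i \<Rightarrow> \<beta> i) < X k \<and> X k \<le> \<alpha> k"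
        "\<And>k. k \<le> m \<Longrightarrow> 0 \<le> B k"
        "\<And>z::complex. z \<notin> of_real ` X ` {..m} \<Longrightarrow>
       (\<Prod>k\<le>m. of_real (\<beta> k) - z) =
       (1 / of_real (C m - \<kappa>) + (\<Sum>k\<le>m. of_real (B k) / (of_real (X k) - z))) *
       (of_real (C m) * (\<Prod>k\<le>m. of_real (\<alpha> k) - z) - of_real \<kappa> * (\<Prod>k\<le>m. of_real (\<beta> k) - z))"
    show ?thesis
      unfolding good_def
    proof (rule exI[of _ X], rule exI[of _ B], intro conjI allI impI)
      fix k assume "k \<le> m"
      then show "l k < X k" "X k \<le> \<alpha> k" "0 \<le> B k" using XB(1,2) by (auto simp: l_def)
    next
      fix z :: complex assume z: "z \<notin> of_real ` X ` {..m}" and zb: "z \<notin> range (\<lambda>k. of_real (\<beta> k))"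
      have nz: "(\<Prod>k\<le>m. of_real (\<beta> k) - z) \<noteq> 0" using zb by (auto simp: prod_zero_iff)
      show "(1 / of_real (C m - \<kappa>) + (\<Sum>k\<le>m. of_real (B k) / (of_real (X k) - z))) *
        (of_real (C m) * (\<Prod>k\<le>m. (of_real (\<alpha> k) - z) / (of_real (\<beta> k) - z)) - of_real \<kappa>) = 1"
      proof -
        have "a * (c * (p / q) - k) = 1" if "q = a * (c * p - k * q)" "q \<noteq> 0" for a c p q k :: complex
        proof -
          have "a * (c * (p / q) - k) * q = a * (c * p - k * q)" using that(2) by (simp add: algebra_simps)
          also have "\<dots> = 1 * q" using that(1) by simp
          finally show ?thesis using that(2) by (metis mult_cancel_right)
        qed
        from this[OF XB(3)[OF z] nz] show ?thesis by (simp add: prod_dividef)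
      qed
    qed
    qed
  qed
  then obtain X B where "\<And>m. m \<ge> m0 \<Longrightarrow> good m (X m) (B m)" by metis
  then have
    X: "\<And>m k. m \<ge> m0 \<Longrightarrow> k \<le> m \<Longrightarrow> l k < X m k \<and> X m k \<le> \<alpha> k" and
    B: "\<And>m k. m \<ge> m0 \<Longrightarrow> k \<le> m \<Longrightarrow> 0 \<le> B m k" and
    XBeq: "\<And>m z. m \<ge> m0 \<Longrightarrow> z \<notin> of_real ` X m ` {..m} \<Longrightarrow> z \<notin> range (\<lambda>k. of_real (\<beta> k)) \<Longrightarrow>
        (1 / of_real (C m - \<kappa>) + (\<Sum>k\<le>m. of_real (B m k) / (of_real (X m k) - z))) *
        (of_real (C m) * (\<Prod>k\<le>m. (of_real (\<alpha> k) - z) / (of_real (\<beta> k) - z)) - of_real \<kappa>) = (1::complex)"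
    unfolding good_def by blast+
  have Xpos: "X m k > 0" if "m \<ge> m0" "k \<le> m" for m k
    using X[OF that] l0[of k] by linarith
  \<comment> \<open>Division by the zero makes the sum accessible: together with 1 / (C - \<kappa>)
    the \<open>D j k\<close> add up to the expansion at z = 0, which is 1 / (R - \<kappa>) there and
    converges. Beyond the finite stage \<open>D\<close> is padded with 0 and \<open>Y\<close> with
    the admissible value \<open>\<alpha> k\<close>.\<close>
  define D where "D j k = (if k \<le> m0 + j then B (m0 + j) k / X (m0 + j) k else 0)" for j k
  define Y where "Y j k = (if k \<le> m0 + j then X (m0 + j) k else \<alpha> k)" for j k
  have D0: "0 \<le> D j k" for j k
    using B[of "m0 + j" k] Xpos[of "m0 + j" k] by (auto simp: D_def intro!: divide_nonneg_pos)
  have Y: "l k \<le> Y j k" "Y j k \<le> \<alpha> k" "0 < Y j k" for j k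
  proof -
    have "l k < \<alpha> k" using pos ba by (cases k) (auto simp: l_def)
    then show "l k \<le> Y j k" "Y j k \<le> \<alpha> k" "0 < Y j k"
      using X Xpos apos by (auto simp: Y_def intro: less_imp_le)
  qed
  define S where "S j z = 1 / of_real (C (m0+j) - \<kappa>) + (\<Sum>k\<le>m0+j. of_real (B (m0+j) k) / (of_real (X (m0+j) k) - z))"
    for j and z :: complex
  define s where "s j = 1 / (C (m0+j) - \<kappa>) + (\<Sum>k\<le>m0+j. D j k)" for j
  have S0: "S j 0 = of_real (s j)" for j by (simp add: S_def s_def D_def)
  have s_eq: "s j = 1 / (R (m0+j) 0 - \<kappa>)" for j
  proof -
    have "0 \<notin> complex_of_real ` X (m0+j) ` {..m0+j}" "0 \<notin> range (\<lambda>k. complex_of_real (\<beta> k))"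
      using Xpos[of "m0+j"] bpos by (auto simp: less_le)
    from XBeq[OF _ this] have "complex_of_real (s j) * of_real (R (m0+j) 0 - \<kappa>) = 1"
      using S0[of j] by (simp add: S_def R_def)
    then have "s j * (R (m0+j) 0 - \<kappa>) = 1"
      by (metis of_real_eq_1_iff of_real_mult)
    then show ?thesis using m0[of "m0+j"] by (simp add: field_simps)
  qed
  define R0 where "R0 = 1 / (\<rho> 0 - \<kappa>)"
  have slim: "s \<longlonglongrightarrow> R0"
    unfolding s_eq R0_def using \<rho>0
    by (intro tendsto_intros LIMSEQ_ignore_initial_segment[OF Rlim, of m0 0, unfolded add.commute[of _ m0]]) auto
  obtain Mb where Mb: "\<And>j. \<bar>s j\<bar> \<le> Mb" "Mb > 0"
    using convergent_imp_Bseq[of s] slim by (auto simp: convergent_def Bseq_def)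
  have Dsum: "(\<Sum>k<K. D j k) \<le> s j" for j K
  proof -
    have "(\<Sum>k<K. D j k) = (\<Sum>k\<in>{..<K} \<inter> {..m0+j}. D j k)"
      by (intro sum.mono_neutral_right) (auto simp: D_def)
    also have "\<dots> \<le> (\<Sum>k\<le>m0+j. D j k)" by (intro sum_mono2) (auto simp: D0)
    also have "\<dots> \<le> s j" using m0[of "m0+j"] by (simp add: s_def)
    finally show ?thesis .
  qed
  have DM: "D j k \<le> Mb" for j k
  proof -
    have "D j k \<le> (\<Sum>i<Suc k. D j i)" using D0 by (intro member_le_sum) auto
    then show ?thesis using Dsum[of j "Suc k"] Mb(1)[of j] by linarith
  qed
  \<comment> \<open>A single family over \<open>nat \<times> bool\<close> carries \<open>D\<close>
    and \<open>Y\<close>, so that one diagonal argument yields a common subsequence. Dividing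
    \<open>Y\<close> by \<open>\<alpha> k\<close> gives a bound independent of k.\<close>
  obtain \<phi> where \<phi>: "strict_mono (\<phi>::nat\<Rightarrow>nat)"
    and lim: "\<And>p. \<exists>L. (\<lambda>n. (\<lambda>j (k,b). if b then D j k else Y j k / \<alpha> k) (\<phi> n) (p :: nat \<times> bool)) \<longlonglongrightarrow> L"
  proof (rule function_convergent_subsequence[of "UNIV :: (nat \<times> bool) set"
        "\<lambda>j (k,b). if b then D j k else Y j k / \<alpha> k" "max Mb 1"])
    fix j and p :: "nat \<times> bool"
    show "norm (case p of (k, b) \<Rightarrow> if b then D j k else Y j k / \<alpha> k) \<le> max Mb 1"
    proof (cases p)
      case (Pair k b)
      have "Y j k / \<alpha> k \<le> 1" "0 \<le> Y j k / \<alpha> k" using Y[where j=j and k=k] apos[of k] by (auto simp: field_simps)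
      then show ?thesis using D0[of j k] DM[of j k] by (auto simp: Pair)
    qed
  qed auto
  have "\<exists>L. (\<lambda>n. D (\<phi> n) k) \<longlonglongrightarrow> L" for k using lim[of "(k,True)"] by simp
  then obtain d where d: "\<And>k. (\<lambda>n. D (\<phi> n) k) \<longlonglongrightarrow> d k" by metis
  have "\<exists>L. (\<lambda>n. Y (\<phi> n) k) \<longlonglongrightarrow> L" for k
  proof -
    obtain L where "(\<lambda>n. Y (\<phi> n) k / \<alpha> k) \<longlonglongrightarrow> L" using lim[of "(k,False)"] by auto
    from tendsto_mult_right[OF this, of "\<alpha> k"] apos[of k] show ?thesis by auto
  qed
  then obtain y where y: "\<And>k. (\<lambda>n. Y (\<phi> n) k) \<longlonglongrightarrow> y k" by metis
  have yl: "l k \<le> y k" and ya: "y k \<le> \<alpha> k" for k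
    using Y by (auto intro: LIMSEQ_le_const[OF y] LIMSEQ_le_const2[OF y])
  have d0: "0 \<le> d k" for k using D0 by (auto intro: LIMSEQ_le_const[OF d])
  have slim': "(\<lambda>n. s (\<phi> n)) \<longlonglongrightarrow> R0"
    using LIMSEQ_subseq_LIMSEQ[OF slim \<phi>] by (simp add: o_def)
  have dsum: "(\<Sum>k<K. d k) \<le> R0" for K
    by (rule LIMSEQ_le[OF tendsto_sum[OF d] slim']) (use Dsum in auto)
  have sumd: "summable d"
    by (rule summableI_nonneg_bounded[OF d0 dsum])
  \<comment> \<open>The mass lost in the limit; the bound on the partial sums of \<open>d\<close>
    makes it nonnegative.\<close>
  define c where "c = R0 - suminf d"
  have c0: "c \<ge> 0" using suminf_le_const[OF sumd, of R0] dsum by (simp add: c_def)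
  have \<alpha>_top: "filterlim \<alpha> at_top sequentially"
  proof -
    have "(\<lambda>k. 1 / \<alpha> k) \<longlonglongrightarrow> 0" by (rule summable_LIMSEQ_zero[OF sum\<alpha>])
    then have "(\<lambda>k. inverse (\<alpha> k)) \<longlonglongrightarrow> 0" by (simp add: divide_inverse)
    then have "filterlim (\<lambda>k. inverse (inverse (\<alpha> k))) at_top sequentially"
      by (intro filterlim_inverse_at_top) (auto simp: apos)
    then show ?thesis by simp
  qed
  have main: "(r z - of_real \<kappa>) * (of_real c + (\<Sum>k. of_real (d k * y k) / (of_real (y k) - z))) = 1
      \<and> summable (\<lambda>k. of_real (d k * y k) / (of_real (y k) - z))"
    if zy: "z \<notin> range (\<lambda>k. of_real (y k))" and zb: "z \<notin> range (\<lambda>k. of_real (\<beta> k))" for z :: complex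
  proof -
    from \<alpha>_top obtain K where K: "\<And>k. k \<ge> K \<Longrightarrow> \<alpha> k \<ge> 2 * norm z + 1"
      by (auto simp: filterlim_at_top eventually_sequentially)
    \<comment> \<open>The left end of the k-th interval is \<beta> of the previous index, which
      exceeds \<open>\<alpha> (k - 1)\<close>; hence the shift of the index here and in the majorant
      below.\<close>
    have far: "norm (of_real (Y j k) - z) \<ge> \<alpha> (k - 1) / 2 \<and> norm (of_real (Y j k) - z) > 0" if "k \<ge> Suc K" for j k
    proof -
      have "\<alpha> (k-1) \<le> Y j k" using l_ge[of k] Y(1)[of k j] that by linarith
      moreover have "2 * norm z + 1 \<le> \<alpha> (k - 1)" using K[of "k-1"] that by simp
      moreover have "norm (of_real (Y j k) - z) \<ge> norm (complex_of_real (Y j k)) - norm z"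
        by (rule norm_triangle_ineq2)
      moreover have "norm (complex_of_real (Y j k)) = Y j k" using Y(3)[of j k] by simp
      moreover have "norm z \<ge> 0" by simp
      ultimately show ?thesis by linarith
    qed
    have yz: "of_real (y k) - z \<noteq> 0" for k using zy by auto
    have Yz: "eventually (\<lambda>n. \<forall>k\<in>{..K}. of_real (Y (\<phi> n) k) - z \<noteq> 0) sequentially"
    proof (intro eventually_ball_finite ballI)
      fix k
      have "(\<lambda>n. of_real (Y (\<phi> n) k) - z) \<longlonglongrightarrow> of_real (y k) - z"
        by (intro tendsto_intros y)
      from tendsto_imp_eventually_ne[OF this yz] show "eventually (\<lambda>n. of_real (Y (\<phi> n) k) - z \<noteq> 0) sequentially" .
    qed auto
    then have Yz: "eventually (\<lambda>n. \<forall>k. of_real (Y (\<phi> n) k) - z \<noteq> 0) sequentially"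
      by eventually_elim (metis far atMost_iff not_less_eq_eq norm_zero order_less_irrefl)
    \<comment> \<open>These terms are B / (X - z) minus their value B / X at 0. The extra decay 1 /
      (Y - z) supplies a summable majorant for Tannery's theorem, whereas the terms themselves need
      not have one.\<close>
    let ?a = "\<lambda>k n. of_real (D (\<phi> n) k) * z / (of_real (Y (\<phi> n) k) - z)"
    let ?b = "\<lambda>k. of_real (d k) * z / (of_real (y k) - z)"
    have "eventually (\<lambda>n. summable (\<lambda>k. norm (?a k n))) sequentially \<and> summable (\<lambda>k. norm (?b k)) \<and>
        (\<lambda>n. suminf (\<lambda>k. ?a k n)) \<longlonglongrightarrow> suminf ?b"
    proof (rule tannerys_theorem)
      show "(\<lambda>n. ?a k n) \<longlonglongrightarrow> ?b k" for k
        by (intro tendsto_intros d y yz)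
      have "norm (?a k n) \<le> 2 * Mb * norm z * (1 / \<alpha> (k - 1))" if "k \<ge> Suc K" for k n
      proof -
        have "norm (?a k n) = D (\<phi> n) k * norm z / norm (of_real (Y (\<phi> n) k) - z)"
          using D0 by (simp add: norm_mult norm_divide)
        also have "\<dots> \<le> Mb * norm z / (\<alpha> (k - 1) / 2)"
          using far[OF that, of "\<phi> n"] DM D0 Mb apos[of "k-1"] by (intro frac_le mult_right_mono mult_nonneg_nonneg) auto
        finally show ?thesis by (simp add: field_simps)
      qed
      then show "eventually (\<lambda>(k,n). norm (?a k n) \<le> 2 * Mb * norm z * (1 / \<alpha> (k - 1))) (at_top \<times>\<^sub>F sequentially)"
        unfolding eventually_prod_filter
        by (intro exI[of _ "\<lambda>k. k \<ge> Suc K"] exI[of _ "\<lambda>_. True"] conjI eventually_ge_at_top allI impI)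
           (simp_all only: split_conv eventually_True)
      have "summable (\<lambda>k. 1 / \<alpha> (Suc k - 1))" using sum\<alpha> by simp
      then have "summable (\<lambda>k. 1 / \<alpha> (k - 1))" by (rule summable_Suc_iff[THEN iffD1])
      then show "summable (\<lambda>k. 2 * Mb * norm z * (1 / \<alpha> (k - 1)))" by (rule summable_mult)
    qed auto
    then have sumb: "summable (\<lambda>k. norm (?b k))" and lima: "(\<lambda>n. suminf (\<lambda>k. ?a k n)) \<longlonglongrightarrow> suminf ?b" by auto
    have S_eq: "S (\<phi> n) z = of_real (s (\<phi> n)) + suminf (\<lambda>k. ?a k n)" if nz: "\<forall>k. of_real (Y (\<phi> n) k) - z \<noteq> 0" for n
    proof -
      let ?m = "m0 + \<phi> n"
      have "suminf (\<lambda>k. ?a k n) = (\<Sum>k\<le>?m. ?a k n)"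
        by (rule suminf_finite) (auto simp: D_def)
      also have "\<dots> = (\<Sum>k\<le>?m. of_real (B ?m k) / (of_real (X ?m k) - z) - of_real (D (\<phi> n) k))"
      proof (rule sum.cong)
        fix k assume k: "k \<in> {..?m}"
        then have e: "Y (\<phi> n) k = X ?m k" "D (\<phi> n) k = B ?m k / X ?m k" by (auto simp: Y_def D_def)
        have "of_real (X ?m k) - z \<noteq> 0" using nz e(1) by metis
        moreover have "X ?m k \<noteq> 0" using Xpos[of ?m k] k by auto
        ultimately show "?a k n = of_real (B ?m k) / (of_real (X ?m k) - z) - of_real (D (\<phi> n) k)"
          unfolding e by (simp add: field_simps)
      qed simp
      finally show ?thesis unfolding S_def s_def by (simp add: sum_subtractf)
    qed
    have "(\<lambda>n. of_real (s (\<phi> n)) + suminf (\<lambda>k. ?a k n)) \<longlonglongrightarrow> of_real R0 + suminf ?b"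
      by (intro tendsto_intros slim' lima)
    then have Slim: "(\<lambda>n. S (\<phi> n) z) \<longlonglongrightarrow> of_real R0 + suminf ?b"
      by (rule Lim_transform_eventually) (use Yz in eventually_elim, simp add: S_eq)
    have "(\<lambda>n. of_real (C (m0 + \<phi> n)) * (\<Prod>k\<le>m0 + \<phi> n. (of_real (\<alpha> k) - z) / (of_real (\<beta> k) - z))) \<longlonglongrightarrow> r z"
      using LIMSEQ_subseq_LIMSEQ[OF LIMSEQ_ignore_initial_segment[OF conv[of z], of m0] \<phi>]
      by (simp add: o_def add.commute)
    from tendsto_mult[OF Slim tendsto_diff[OF this tendsto_const[of "of_real \<kappa>"]]]
    have "(\<lambda>n. 1) \<longlonglongrightarrow> (of_real R0 + suminf ?b) * (r z - of_real \<kappa>)"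
    proof (rule Lim_transform_eventually)
      show "eventually (\<lambda>n. S (\<phi> n) z * (of_real (C (m0 + \<phi> n)) * (\<Prod>k\<le>m0 + \<phi> n. (of_real (\<alpha> k) - z) / (of_real (\<beta> k) - z)) - of_real \<kappa>) = 1) sequentially"
        using Yz
      proof eventually_elim
        case (elim n)
        have "z \<notin> of_real ` X (m0 + \<phi> n) ` {..m0 + \<phi> n}"
        proof
          assume "z \<in> of_real ` X (m0 + \<phi> n) ` {..m0 + \<phi> n}"
          then obtain k where "k \<le> m0 + \<phi> n" "z = of_real (X (m0 + \<phi> n) k)" by auto
          then have "of_real (Y (\<phi> n) k) - z = 0" by (simp add: Y_def)
          with elim show False by blast
        qed
        from XBeq[OF _ this zb] show ?case by (simp add: S_def)
      qed
    qed
    then have one: "(of_real R0 + suminf ?b) * (r z - of_real \<kappa>) = 1"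
      using LIMSEQ_unique tendsto_const by blast
    have "?b k = of_real (d k * y k) / (of_real (y k) - z) - of_real (d k)" for k
      using yz[of k] by (simp add: field_simps)
    then have beq: "of_real (d k * y k) / (of_real (y k) - z) = ?b k + of_real (d k)" for k by simp
    have sb: "summable ?b" using sumb by (rule summable_norm_cancel)
    have sd: "summable (\<lambda>k. complex_of_real (d k))" using sumd by (rule summable_of_real)
    have "suminf ?b + (\<Sum>k. complex_of_real (d k)) = (\<Sum>k. of_real (d k * y k) / (of_real (y k) - z))"
      unfolding beq by (rule suminf_add[OF sb sd])
    moreover have "(\<Sum>k. complex_of_real (d k)) = of_real (suminf d)" using sumd by (rule suminf_of_real[symmetric])
    ultimately have "of_real R0 + suminf ?b = of_real c + (\<Sum>k. of_real (d k * y k) / (of_real (y k) - z))"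
      by (simp add: c_def algebra_simps)
    then show ?thesis using one summable_add[OF sb sd] unfolding beq by (simp add: mult.commute)
  qed
  have y0: "y k \<ge> 0" for k using yl[of k] l0[of k] by linarith
  have R0pos: "R m 0 > 0" if "m \<ge> m0" for m using m0[OF that] \<kappa>(1) by linarith
  \<comment> \<open>For x < 0 all terms of the series are nonnegative, so c > 0 bounds \<rho> by
    \<kappa> + 1 / c (\<open>up\<close>). All factors (1 - x / \<alpha>) / (1 - x / \<beta>) are at
    least 1 there, so every finite subproduct bounds \<rho> from below (\<open>low\<close>). With x
    to minus infinity the subproduct up to K becomes \<open>C K / R K 0\<close>, and K to infinity
    gives the contradiction.\<close>
  have "c = 0"
  proof (rule ccontr)
    assume "c \<noteq> 0"
    with c0 have cpos: "c > 0" by simp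
    have up: "\<rho> x \<le> \<kappa> + 1 / c" if x: "x < 0" for x
    proof -
      have "of_real x \<notin> range (\<lambda>k. complex_of_real (y k))" "of_real x \<notin> range (\<lambda>k. complex_of_real (\<beta> k))"
        using x y0 bpos by (auto, metis not_less, metis less_asym)
      from main[OF this] have m1: "(of_real (\<rho> x) - of_real \<kappa>) * (of_real c + (\<Sum>k. of_real (d k * y k) / (of_real (y k) - of_real x))) = (1::complex)"
        and sm: "summable (\<lambda>k. of_real (d k * y k) / (of_real (y k) - complex_of_real x))"
        by (auto simp: r_real)
      have eq: "(\<lambda>k. of_real (d k * y k) / (of_real (y k) - complex_of_real x)) = (\<lambda>k. of_real (d k * y k / (y k - x)))"
        by simp
      have sm': "summable (\<lambda>k. d k * y k / (y k - x))" using sm unfolding eq summable_of_real_iff .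
      define T where "T = (\<Sum>k. d k * y k / (y k - x))"
      have T0: "T \<ge> 0" unfolding T_def using d0 y0 x
        by (intro suminf_nonneg[OF sm'] divide_nonneg_nonneg mult_nonneg_nonneg) (auto simp: add_increasing less_imp_le intro: order_trans[of _ 0])
      have "(\<Sum>k. of_real (d k * y k) / (of_real (y k) - complex_of_real x)) = of_real T"
        unfolding eq T_def by (rule suminf_of_real[OF sm', symmetric])
      with m1 have "complex_of_real ((\<rho> x - \<kappa>) * (c + T)) = 1" by simp
      then have "(\<rho> x - \<kappa>) * (c + T) = 1" by (simp only: of_real_eq_1_iff)
      then have "\<rho> x - \<kappa> = 1 / (c + T)" using cpos T0 by (simp add: field_simps)
      also have "\<dots> \<le> 1 / c" using cpos T0 by (intro divide_left_mono) auto
      finally show ?thesis by simp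
    qed
    have low: "\<rho> 0 * (\<Prod>k\<le>K. (1 - x / \<alpha> k) / (1 - x / \<beta> k)) \<le> \<rho> x" if x: "x < 0" for x K
    proof (rule LIMSEQ_le[OF tendsto_mult[OF Rlim tendsto_const] Rlim])
      have fac1: "1 \<le> (1 - x / \<alpha> k) / (1 - x / \<beta> k)" for k
      proof -
        have "x / \<alpha> k \<le> x / \<beta> k" using x ab[of k] apos[of k] by (intro divide_left_mono_neg) auto
        moreover have "x / \<beta> k < 0" using x bpos[of k] by (simp add: divide_neg_pos)
        ultimately show ?thesis by (subst le_divide_eq_1_pos) auto
      qed
      have "R m 0 * (\<Prod>k\<le>K. (1 - x / \<alpha> k) / (1 - x / \<beta> k)) \<le> R m x" if m: "m \<ge> max m0 K" for m
      proof -
        have "R m x = C m * (\<Prod>k\<le>m. \<alpha> k / \<beta> k * ((1 - x / \<alpha> k) / (1 - x / \<beta> k)))"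
          unfolding R_def
        proof (intro arg_cong2[of _ _ _ _ "(*)"] prod.cong refl)
          fix k
          show "(\<alpha> k - x) / (\<beta> k - x) = \<alpha> k / \<beta> k * ((1 - x / \<alpha> k) / (1 - x / \<beta> k))"
            using apos[of k] bpos[of k] x by (simp add: divide_simps) (simp add: algebra_simps)?
        qed
        also have "\<dots> = R m 0 * (\<Prod>k\<le>m. (1 - x / \<alpha> k) / (1 - x / \<beta> k))"
          by (simp only: R_def prod.distrib diff_zero mult_ac)
        also have "\<dots> \<ge> R m 0 * (\<Prod>k\<le>K. (1 - x / \<alpha> k) / (1 - x / \<beta> k))"
        proof (intro mult_left_mono prod_mono2)
          show "0 \<le> R m 0" using R0pos[of m] m by simp
        qed (use m fac1 order_trans[OF zero_le_one fac1] in auto)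
        finally show ?thesis .
      qed
      then show "\<exists>N. \<forall>n\<ge>N. R n 0 * (\<Prod>k\<le>K. (1 - x / \<alpha> k) / (1 - x / \<beta> k)) \<le> R n x" by blast
    qed
    have "\<rho> 0 * (\<Prod>k\<le>K. \<beta> k / \<alpha> k) \<le> \<kappa> + 1 / c" for K
    proof (rule tendsto_upperbound)
      have "((\<lambda>x. (1 - x / \<alpha> k) / (1 - x / \<beta> k)) \<longlongrightarrow> \<beta> k / \<alpha> k) at_bot" for k
        using apos[of k] bpos[of k] by (real_asymp simp add: field_simps)
      then show "((\<lambda>x. \<rho> 0 * (\<Prod>k\<le>K. (1 - x / \<alpha> k) / (1 - x / \<beta> k))) \<longlongrightarrow> \<rho> 0 * (\<Prod>k\<le>K. \<beta> k / \<alpha> k)) at_bot"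
        by (intro tendsto_mult tendsto_const tendsto_prod)
      show "eventually (\<lambda>x. \<rho> 0 * (\<Prod>k\<le>K. (1 - x / \<alpha> k) / (1 - x / \<beta> k)) \<le> \<kappa> + 1 / c) at_bot"
        by (rule eventually_mono[OF eventually_gt_at_bot[of 0]]) (use low up in \<open>meson order_trans\<close>)
    qed auto
    moreover have "(\<Prod>k\<le>K. \<beta> k / \<alpha> k) = C K / R K 0" if "K \<ge> m0" for K
    proof -
      have "(\<Prod>k\<le>K. \<beta> k / \<alpha> k) = inverse (\<Prod>k\<le>K. \<alpha> k / \<beta> k)" by (simp add: prod_dividef)
      moreover have "C K \<noteq> 0" using R0pos[OF that] by (auto simp: R_def)
      ultimately show ?thesis by (simp add: R_def divide_inverse)
    qed
    ultimately have "C K \<le> (\<kappa> + 1 / c) / \<rho> 0 * R K 0" if "K \<ge> m0" for K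
    proof -
      have "\<rho> 0 * (C K / R K 0) \<le> \<kappa> + 1 / c"
        using \<open>\<And>K. \<rho> 0 * (\<Prod>k\<le>K. \<beta> k / \<alpha> k) \<le> \<kappa> + 1 / c\<close>[of K]
          \<open>\<And>K. K \<ge> m0 \<Longrightarrow> (\<Prod>k\<le>K. \<beta> k / \<alpha> k) = C K / R K 0\<close>[OF that] by simp
      then have "C K / R K 0 \<le> (\<kappa> + 1 / c) / \<rho> 0"
        using \<rho>0 \<kappa>(1) by (subst pos_le_divide_eq) (auto simp: mult.commute)
      then show ?thesis using R0pos[OF that] by (simp only: pos_divide_le_eq)
    qed
    then have "eventually (\<lambda>K. C K \<le> (\<kappa> + 1 / c) / \<rho> 0 * R K 0) sequentially"
      by (auto simp: eventually_sequentially)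
    from filterlim_at_top_mono[OF C this]
    have "filterlim (\<lambda>K. (\<kappa> + 1 / c) / \<rho> 0 * R K 0) at_top sequentially" .
    moreover have "(\<lambda>K. (\<kappa> + 1 / c) / \<rho> 0 * R K 0) \<longlonglongrightarrow> (\<kappa> + 1 / c) / \<rho> 0 * \<rho> 0"
      by (intro tendsto_intros Rlim)
    ultimately show False
      using not_tendsto_and_filterlim_at_infinity[OF sequentially_bot] filterlim_at_top_imp_at_infinity by blast
  qed
  show thesis
  proof (rule that[of y d])
    show "(case k of 0 \<Rightarrow> 0 | Suc i \<Rightarrow> \<beta> i) \<le> y k" for k using yl[of k] by (simp add: l_def)
  qed (use ya d0 sumd main \<open>c = 0\<close> in auto)
qed

section \<open>Poles and residues of the resolvent symbol\<close>

text \<open>Euler's limit for Gamma, with the reciprocal series for the denominators. Pairing the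
  shifts by s and - s leaves only \<open>z\<^sup>2\<close>. No z is excluded: at a pole of the
  symbol both sides take the value 0 by the conventions for Gamma at its poles and for division by
  zero.\<close>

lemma Theta0_product:
  fixes n :: nat and \<gamma> :: real and z :: complex
  shows "(\<lambda>m. of_real (2 powr (2 * \<gamma>) * real m powr (2 * \<gamma>)) *
    (\<Prod>k\<le>m. (of_real ((n / 4 - \<gamma> / 2 + real k)\<^sup>2) + z\<^sup>2 / 4) / (of_real ((n / 4 + \<gamma> / 2 + real k)\<^sup>2) + z\<^sup>2 / 4)))
    \<longlonglongrightarrow> Theta0 n \<gamma> z"
proof -
  define a b s where "a = complex_of_real (n / 4 - \<gamma> / 2)" and "b = complex_of_real (n / 4 + \<gamma> / 2)" and "s = z * \<i> / 2"
  have s2: "s * s = - (z\<^sup>2 / 4)" by (simp add: s_def power2_eq_square field_simps)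
  have "Theta0 n \<gamma> z = of_real (2 powr (2 * \<gamma>)) * (Gamma (b + s) * Gamma (b - s) * (rGamma (a + s) * rGamma (a - s)))"
    unfolding Theta0_def a_def b_def s_def rGamma_inverse_Gamma
    by (simp only: divide_inverse inverse_mult_distrib mult.assoc)
  moreover have "(\<lambda>m. of_real (2 powr (2 * \<gamma>)) * (Gamma_series (b + s) m * Gamma_series (b - s) m *
      (rGamma_series (a + s) m * rGamma_series (a - s) m))) \<longlonglongrightarrow> \<dots>"
    by (intro tendsto_intros)
  ultimately have lim: "(\<lambda>m. of_real (2 powr (2 * \<gamma>)) * (Gamma_series (b + s) m * Gamma_series (b - s) m *
      (rGamma_series (a + s) m * rGamma_series (a - s) m))) \<longlonglongrightarrow> Theta0 n \<gamma> z" by simp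
  have eq: "of_real (2 powr (2 * \<gamma>)) * (Gamma_series (b + s) m * Gamma_series (b - s) m *
      (rGamma_series (a + s) m * rGamma_series (a - s) m)) =
      of_real (2 powr (2 * \<gamma>) * real m powr (2 * \<gamma>)) *
    (\<Prod>k\<le>m. (of_real ((n / 4 - \<gamma> / 2 + real k)\<^sup>2) + z\<^sup>2 / 4) / (of_real ((n / 4 + \<gamma> / 2 + real k)\<^sup>2) + z\<^sup>2 / 4))"
    if m: "m > 0" for m
  proof -
    have P: "pochhammer (c + s) (m + 1) * pochhammer (c - s) (m + 1) = (\<Prod>k\<le>m. (c + of_nat k)\<^sup>2 + z\<^sup>2 / 4)" for c
    proof -
      have "pochhammer (c + s) (m + 1) * pochhammer (c - s) (m + 1) = (\<Prod>k\<le>m. (c + s + of_nat k) * (c - s + of_nat k))"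
        by (simp add: pochhammer_Suc_prod prod.distrib atLeast0AtMost)
      also have "\<dots> = (\<Prod>k\<le>m. (c + of_nat k)\<^sup>2 + z\<^sup>2 / 4)"
      proof (intro prod.cong refl)
        fix k
        have "(c + s + of_nat k) * (c - s + of_nat k) = (c + of_nat k)\<^sup>2 - s * s"
          by (simp add: power2_eq_square algebra_simps)
        then show "(c + s + of_nat k) * (c - s + of_nat k) = (c + of_nat k)\<^sup>2 + z\<^sup>2 / 4" by (simp add: s2)
      qed
      finally show ?thesis .
    qed
    let ?e = "\<lambda>x. exp (x * complex_of_real (ln (of_nat m)))"
    \<comment> \<open>The shifts s cancel in the exponents, and 2 b - 2 a = 2 \<gamma> remains as
      the power of m.\<close>
    have e: "?e (b + s) * ?e (b - s) / (?e (a + s) * ?e (a - s)) = of_real (real m powr (2 * \<gamma>))"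
    proof -
      have "?e (b + s) * ?e (b - s) / (?e (a + s) * ?e (a - s)) =
          exp ((b + s) * complex_of_real (ln (of_nat m)) + (b - s) * complex_of_real (ln (of_nat m)) -
            ((a + s) * complex_of_real (ln (of_nat m)) + (a - s) * complex_of_real (ln (of_nat m))))"
        by (simp only: exp_add exp_diff)
      also have "\<dots> = exp (of_real (2 * \<gamma> * ln (real m)))"
        by (intro arg_cong[of _ _ exp]) (simp add: a_def b_def algebra_simps)
      also have "\<dots> = of_real (real m powr (2 * \<gamma>))"
        using m by (simp add: powr_def exp_of_real[symmetric] flip: of_real_mult)
      finally show ?thesis .
    qed
    have "Gamma_series (b + s) m * Gamma_series (b - s) m * (rGamma_series (a + s) m * rGamma_series (a - s) m)
       = (?e (b + s) * ?e (b - s) / (?e (a + s) * ?e (a - s))) *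
         ((pochhammer (a + s) (m + 1) * pochhammer (a - s) (m + 1)) / (pochhammer (b + s) (m + 1) * pochhammer (b - s) (m + 1)))"
    proof -
      have "(fact m :: complex) * (fact m * (inverse (fact m) * inverse (fact m))) = 1"
        using fact_nonzero[of m, where 'a = complex] by (simp add: field_simps)
      then show ?thesis
        unfolding Gamma_series_def rGamma_series_def by (simp add: divide_inverse)
    qed
    also have "\<dots> = of_real (real m powr (2 * \<gamma>)) * (\<Prod>k\<le>m. ((a + of_nat k)\<^sup>2 + z\<^sup>2 / 4) / ((b + of_nat k)\<^sup>2 + z\<^sup>2 / 4))"
      unfolding P e by (simp add: prod_dividef)
    finally show ?thesis by (simp add: a_def b_def mult.assoc)
  qed
  show ?thesis
    by (rule Lim_transform_eventually[OF lim eventually_mono[OF eventually_gt_at_top[of 0]]]) (rule eq)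
qed

lemma Theta0_zero:
  "Theta0 n \<gamma> 0 = of_real (hardy_const n \<gamma>)"
proof -
  have e: "(n + 2 * \<gamma>) / 4 = n / 4 + \<gamma> / 2" "(n - 2 * \<gamma>) / 4 = n / 4 - \<gamma> / 2" by (simp_all add: field_simps)
  show ?thesis
    unfolding Theta0_def hardy_const_def e
    by (simp add: Gamma_complex_of_real power2_eq_square
        del: of_real_add of_real_diff of_real_divide flip: of_real_mult of_real_divide)
qed

text \<open>The symbol is read as a function of x = - z^2 / 4, where its zeros and poles become the
  interlacing sequences \<alpha> and \<beta>. The two exclusions are the poles of the expansion and
  those of the symbol, at which \<open>Theta0\<close> has no meaningful value.\<close>

lemma resolvent_expansion:
  fixes n :: nat and \<gamma> \<kappa> :: real
  assumes \<gamma>: "0 < \<gamma>" "\<gamma> < 1" and n: "n \<ge> 2" and \<kappa>: "0 \<le> \<kappa>" "\<kappa> < hardy_const n \<gamma>"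
  obtains y d :: "nat \<Rightarrow> real" where "\<And>k. 0 \<le> y k" "strict_mono y" "filterlim y at_top sequentially"
    "\<And>k. 0 \<le> d k" "summable d"
    "\<forall>z. z\<^sup>2 / 4 \<notin> range (\<lambda>k. - of_real (y k)) \<longrightarrow>
      z\<^sup>2 / 4 \<notin> range (\<lambda>k. - of_real ((n / 4 + \<gamma> / 2 + real k)\<^sup>2)) \<longrightarrow>
       (Theta0 n \<gamma> z - of_real \<kappa>) * (\<Sum>k. of_real (d k * y k) / (of_real (y k) + z\<^sup>2 / 4)) = 1"
proof -
  define \<alpha> \<beta> where "\<alpha> k = (n / 4 - \<gamma> / 2 + real k)\<^sup>2" and "\<beta> k = (n / 4 + \<gamma> / 2 + real k)\<^sup>2" for k :: nat
  \<comment> \<open>\<open>csqrt\<close> selects one of two preimages of x; the product formula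
    depends only on \<open>z\<^sup>2\<close>, so the selection does not affect the value.\<close>
  define r where "r x = Theta0 n \<gamma> (2 * \<i> * csqrt x)" for x
  have r: "r (- (z\<^sup>2 / 4)) = Theta0 n \<gamma> z" for z
  proof -
    have "(2 * \<i> * csqrt (- (z\<^sup>2 / 4)))\<^sup>2 = z\<^sup>2" by (simp add: power_mult_distrib)
    then show ?thesis unfolding r_def
      using LIMSEQ_unique[OF Theta0_product[of \<gamma> n z]] Theta0_product[of \<gamma> n "2 * \<i> * csqrt (- (z\<^sup>2 / 4))"] by simp
  qed
  have a0: "n / 4 - \<gamma> / 2 > 0" using \<gamma> n by simp
  have 1: "0 < \<alpha> 0" using a0 by (simp add: \<alpha>_def)
  have 2: "\<alpha> k < \<beta> k" for k
    unfolding \<alpha>_def \<beta>_def using a0 \<gamma> by (intro power_strict_mono) auto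
  \<comment> \<open>The two squared numbers differ by 1 - \<gamma>: interlacing holds because
    \<gamma> < 1.\<close>
  have 3: "\<beta> k < \<alpha> (Suc k)" for k
    unfolding \<alpha>_def \<beta>_def using a0 \<gamma> n by (intro power_strict_mono) auto
  have \<alpha>_ge: "\<alpha> (Suc k) \<ge> (real (Suc k))\<^sup>2" for k
    unfolding \<alpha>_def using a0 by (intro power_mono) auto
  have sum: "summable (\<lambda>k. 1 / \<alpha> k)"
  proof (subst summable_Suc_iff[symmetric], rule summable_comparison_test')
    have "summable (\<lambda>k. inverse ((real k)\<^sup>2))" by (rule inverse_power_summable) simp
    then show "summable (\<lambda>k. inverse ((real (Suc k))\<^sup>2))" by (subst summable_Suc_iff)
    fix k :: nat assume "k \<ge> 0"
    show "norm (1 / \<alpha> (Suc k)) \<le> inverse ((real (Suc k))\<^sup>2)"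
    proof -
      have p: "0 < (real (Suc k))\<^sup>2" by simp
      then have "0 < \<alpha> (Suc k)" using \<alpha>_ge[of k] by linarith
      then show ?thesis using le_imp_inverse_le[OF \<alpha>_ge[of k] p] by (simp add: inverse_eq_divide)
    qed
  qed
  have C: "filterlim (\<lambda>m. 2 powr (2 * \<gamma>) * real m powr (2 * \<gamma>)) at_top sequentially"
    using \<gamma> by real_asymp
  have \<kappa>': "\<kappa> < Re (r 0)" using \<kappa> r[of 0] Theta0_zero[of n \<gamma>] by simp
  have conv: "(\<lambda>m. of_real (2 powr (2 * \<gamma>) * real m powr (2 * \<gamma>)) * (\<Prod>k\<le>m. (of_real (\<alpha> k) - x) / (of_real (\<beta> k) - x))) \<longlonglongrightarrow> r x" for x
    using Theta0_product[of \<gamma> n "2 * \<i> * csqrt x"] by (simp add: r_def \<alpha>_def \<beta>_def power_mult_distrib)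
  show thesis
  proof (rule interlacing_quotient_limit[OF 1 2 3 sum \<kappa>(1) \<kappa>' C conv])
    fix y d :: "nat \<Rightarrow> real"
    assume yl: "\<And>k. (case k of 0 \<Rightarrow> 0 | Suc i \<Rightarrow> \<beta> i) \<le> y k" and ya: "\<And>k. y k \<le> \<alpha> k"
      and d: "\<And>k. 0 \<le> d k" "summable d"
      and eq: "\<And>z. z \<notin> range (\<lambda>k. of_real (y k)) \<Longrightarrow> z \<notin> range (\<lambda>k. of_real (\<beta> k)) \<Longrightarrow>
       (r z - of_real \<kappa>) * (\<Sum>k. of_real (d k * y k) / (of_real (y k) - z)) = 1"
    have yS: "\<beta> k \<le> y (Suc k)" for k using yl[of "Suc k"] by simp
    show thesis
    proof (rule that[of y d])
      show "0 \<le> y k" for k using yl[of k] by (cases k) (auto simp: \<beta>_def intro: order_trans[OF zero_le_power2])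
      show "strict_mono y"
        unfolding strict_mono_Suc_iff using ya 2 yS by (meson less_le_trans le_less_trans)
      have "filterlim (\<lambda>k. y (Suc k)) at_top sequentially"
      proof (rule filterlim_at_top_mono)
        show "filterlim (\<lambda>k. real k) at_top sequentially" by (rule filterlim_real_sequentially)
        have "real k \<le> y (Suc k)" for k
        proof (cases k)
          case 0
          then show ?thesis using yS[of 0] by (simp add: \<beta>_def) (meson order_trans zero_le_power2)
        next
          case (Suc i)
          have "real (Suc i) \<le> (real (Suc i))\<^sup>2" by (rule self_le_power) auto
          then show ?thesis using \<alpha>_ge[of i] 2[of "Suc i"] yS[of "Suc i"]
            unfolding Suc by (meson order_trans less_imp_le)
        qed
        then show "eventually (\<lambda>k. real k \<le> y (Suc k)) sequentially" by simp
      qed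
      then show "filterlim y at_top sequentially" by (subst (asm) filterlim_sequentially_Suc)
      show "\<forall>z. z\<^sup>2 / 4 \<notin> range (\<lambda>k. - of_real (y k)) \<longrightarrow>
        z\<^sup>2 / 4 \<notin> range (\<lambda>k. - of_real ((n / 4 + \<gamma> / 2 + real k)\<^sup>2)) \<longrightarrow>
        (Theta0 n \<gamma> z - of_real \<kappa>) * (\<Sum>k. of_real (d k * y k) / (of_real (y k) + z\<^sup>2 / 4)) = 1"
      proof (intro allI impI)
      fix z :: complex
      assume z: "z\<^sup>2 / 4 \<notin> range (\<lambda>k. - of_real (y k))" "z\<^sup>2 / 4 \<notin> range (\<lambda>k. - of_real ((n / 4 + \<gamma> / 2 + real k)\<^sup>2))"
      have "- (z\<^sup>2 / 4) \<notin> range (\<lambda>k. of_real (f k))" if "z\<^sup>2 / 4 \<notin> range (\<lambda>k. - of_real (f k))" for f :: "nat \<Rightarrow> real"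
      proof
        assume "- (z\<^sup>2 / 4) \<in> range (\<lambda>k. complex_of_real (f k))"
        then obtain k where "- (z\<^sup>2 / 4) = of_real (f k)" by auto
        then have "z\<^sup>2 / 4 = - of_real (f k)" by (metis minus_minus)
        with that show False by blast
      qed
      from this[OF z(1)] this[OF z(2)[folded \<beta>_def]]
      have "- (z\<^sup>2 / 4) \<notin> range (\<lambda>k. of_real (y k))" "- (z\<^sup>2 / 4) \<notin> range (\<lambda>k. of_real (\<beta> k))" by auto
      from eq[OF this] show "(Theta0 n \<gamma> z - of_real \<kappa>) * (\<Sum>k. of_real (d k * y k) / (of_real (y k) + z\<^sup>2 / 4)) = 1"
        unfolding r by simp
      qed
    qed (use d in auto)
  qed
qed

text \<open>The numbers \<open>\<sigma> j\<close> list the poles in an arbitrary order and omit the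
  terms with zero coefficient. Absolute convergence permits this change of indices.\<close>

lemma suminf_reindex_support:
  fixes f :: "nat \<Rightarrow> 'a::banach"
  assumes g: "bij_betw g UNIV I" and f: "\<And>k. k \<notin> I \<Longrightarrow> f k = 0" and s: "summable (\<lambda>k. norm (f k))"
  shows "summable (\<lambda>j. norm (f (g j)))" and "(\<Sum>j. f (g j)) = (\<Sum>k. f k)"
proof -
  have 1: "((\<lambda>j. F (g j)) has_sum S) UNIV" if "F sums S" "summable (\<lambda>k. norm (F k))" "\<And>k. k \<notin> I \<Longrightarrow> F k = 0"
    for F :: "nat \<Rightarrow> 'c::banach" and S
  proof -
    have "(F has_sum S) UNIV" by (rule norm_summable_imp_has_sum[OF that(2,1)])
    then have "(F has_sum S) I"
      by (rule has_sum_cong_neutral[THEN iffD1, rotated -1]) (use that(3) in auto)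
    then show ?thesis using has_sum_reindex_bij_betw[OF g, of F S] by simp
  qed
  have "(\<lambda>j. norm (f (g j))) sums (\<Sum>k. norm (f k))"
    by (rule has_sum_imp_sums, rule 1[of "\<lambda>k. norm (f k)"]) (use s f in \<open>auto intro: summable_sums\<close>)
  then show "summable (\<lambda>j. norm (f (g j)))" by (rule sums_summable)
  have "(\<lambda>j. f (g j)) sums (\<Sum>k. f k)"
    by (rule has_sum_imp_sums, rule 1[of f]) (use s f in \<open>auto intro: summable_sums summable_norm_cancel\<close>)
  then show "(\<Sum>j. f (g j)) = (\<Sum>k. f k)" by (simp add: sums_iff)
qed

text \<open>All but finitely many terms have modulus at least 1, and finitely many nonzero ones have
  a positive minimum. This yields discs that contain no further pole.\<close>

lemma finitely_many_small:
  fixes f :: "nat \<Rightarrow> real" and w :: complex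
  assumes "filterlim f at_top sequentially"
  obtains \<delta> where "\<delta> > 0" "\<And>k. of_real (f k) + w \<noteq> 0 \<Longrightarrow> \<delta> \<le> norm (of_real (f k) + w)"
proof -
  from assms obtain K where K: "\<And>k. k \<ge> K \<Longrightarrow> f k \<ge> norm w + 1"
    by (auto simp: filterlim_at_top eventually_sequentially)
  define T where "T = insert 1 ((\<lambda>k. norm (of_real (f k) + w)) ` {k. k < K \<and> of_real (f k) + w \<noteq> 0})"
  have fin: "finite T" "T \<noteq> {}" by (auto simp: T_def)
  show thesis
  proof (rule that[of "Min T"])
    show "Min T > 0" using fin by (auto simp: T_def)
    fix k assume k: "of_real (f k) + w \<noteq> 0"
    show "Min T \<le> norm (of_real (f k) + w)"
    proof (cases "k < K")
      case True
      then show ?thesis using k by (intro Min_le fin) (auto simp: T_def)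
    next
      case False
      have "1 \<le> f k - norm w" using K[of k] False by simp
      also have "\<dots> \<le> norm (complex_of_real (f k)) - norm (- w)" by simp
      also have "\<dots> \<le> norm (of_real (f k) + w)" using norm_triangle_ineq2[of "complex_of_real (f k)" "- w"] by simp
      finally have "1 \<le> norm (of_real (f k) + w)" .
      moreover have "Min T \<le> 1" using fin by (intro Min_le) (auto simp: T_def)
      ultimately show ?thesis by linarith
    qed
  qed
qed

text \<open>Since y / (y + q) = 1 - q / (y + q), the nonsingular terms are bounded by a constant
  multiple of \<open>d k\<close>. Summability of \<open>d\<close> thus suffices for normal
  convergence although the sum of the \<open>d k * y k\<close> is not controlled. What remains after
  removal of the terms singular at \<open>z0\<close> is holomorphic.\<close>

lemma resolvent_local:
  fixes n :: nat and \<gamma> \<kappa> :: real and y d :: "nat \<Rightarrow> real" and z0 :: complex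
  assumes \<gamma>: "0 < \<gamma>" and y: "\<And>k. 0 \<le> y k" "strict_mono y" "filterlim y at_top sequentially"
    and d: "\<And>k. 0 \<le> d k" "summable d"
    and eq: "\<forall>z. z\<^sup>2 / 4 \<notin> range (\<lambda>k. - of_real (y k)) \<longrightarrow>
      z\<^sup>2 / 4 \<notin> range (\<lambda>k. - of_real ((n / 4 + \<gamma> / 2 + real k)\<^sup>2)) \<longrightarrow>
       (Theta0 n \<gamma> z - of_real \<kappa>) * (\<Sum>k. of_real (d k * y k) / (of_real (y k) + z\<^sup>2 / 4)) = 1"
  obtains e g where "e > 0" "g holomorphic_on ball z0 e"
    "\<And>z. z \<in> ball z0 e \<Longrightarrow> z \<noteq> z0 \<Longrightarrow> resolvent_symbol n \<gamma> \<kappa> z =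
       g z + (\<Sum>k | of_real (y k) + z0\<^sup>2 / 4 = 0. of_real (d k * y k) / (of_real (y k) + z\<^sup>2 / 4))"
proof -
  define w0 where "w0 = z0\<^sup>2 / 4"
  define b where "b k = (n / 4 + \<gamma> / 2 + real k)\<^sup>2" for k
  have b_top: "filterlim b at_top sequentially" unfolding b_def by real_asymp
  obtain \<delta>1 where \<delta>1: "\<delta>1 > 0" "\<And>k. of_real (y k) + w0 \<noteq> 0 \<Longrightarrow> \<delta>1 \<le> norm (of_real (y k) + w0)"
    using finitely_many_small[OF y(3)] by blast
  obtain \<delta>2 where \<delta>2: "\<delta>2 > 0" "\<And>k. of_real (b k) + w0 \<noteq> 0 \<Longrightarrow> \<delta>2 \<le> norm (of_real (b k) + w0)"
    using finitely_many_small[OF b_top] by blast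
  define \<delta> where "\<delta> = min 1 (min \<delta>1 \<delta>2)"
  have \<delta>: "\<delta> > 0" using \<delta>1 \<delta>2 by (simp add: \<delta>_def)
  have "((\<lambda>z. z\<^sup>2 / 4) \<longlongrightarrow> w0) (nhds z0)"
    unfolding w0_def by (intro tendsto_intros filterlim_ident) auto
  then have "eventually (\<lambda>z. dist (z\<^sup>2 / 4) w0 < \<delta> / 2) (nhds z0)"
    using \<delta> by (intro tendstoD) auto
  then obtain e1 where e1: "e1 > 0" "\<And>z. dist z z0 < e1 \<Longrightarrow> dist (z\<^sup>2 / 4) w0 < \<delta> / 2"
    unfolding eventually_nhds_metric by blast
  \<comment> \<open>The radius \<open>norm z0\<close> excludes the point - z0, which has the same
    square as \<open>z0\<close>.\<close>
  define e where "e = (if z0 = 0 then e1 else min e1 (norm z0))"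
  have e: "e > 0" using e1 by (simp add: e_def)
  have near: "norm (z\<^sup>2 / 4 - w0) < \<delta> / 2" if "z \<in> ball z0 e" for z
    using e1(2)[of z] that by (simp add: e_def dist_norm norm_minus_commute split: if_splits)
  have ne: "z\<^sup>2 / 4 \<noteq> w0" if "z \<in> ball z0 e" "z \<noteq> z0" for z
  proof
    assume "z\<^sup>2 / 4 = w0"
    then have "z = - z0" using that(2) by (auto simp: w0_def power2_eq_iff)
    then show False using that by (auto simp: e_def dist_norm split: if_splits)
  qed
  have far: "\<delta> / 2 \<le> norm (of_real x + z\<^sup>2 / 4)" if "z \<in> ball z0 e" "\<delta> \<le> norm (of_real x + w0)" for x z
  proof -
    have "norm (of_real x + w0) \<le> norm (of_real x + z\<^sup>2 / 4) + norm (z\<^sup>2 / 4 - w0)"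
      using norm_triangle_ineq4[of "of_real x + z\<^sup>2 / 4" "z\<^sup>2 / 4 - w0"] by simp
    then show ?thesis using near[OF that(1)] that(2) by linarith
  qed
  have fary: "\<delta> / 2 \<le> norm (of_real (y k) + z\<^sup>2 / 4)" if "z \<in> ball z0 e" "of_real (y k) + w0 \<noteq> 0" for k z
    using \<delta>1(2)[OF that(2)] by (intro far[OF that(1)]) (simp add: \<delta>_def)
  have farb: "\<delta> / 2 \<le> norm (of_real (b k) + z\<^sup>2 / 4)" if "z \<in> ball z0 e" "of_real (b k) + w0 \<noteq> 0" for k z
    using \<delta>2(2)[OF that(2)] by (intro far[OF that(1)]) (simp add: \<delta>_def)
  define f where "f k z = (if of_real (y k) + w0 = 0 then 0 else of_real (d k * y k) / (of_real (y k) + z\<^sup>2 / 4))" for k and z :: complex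
  define f' where "f' k z = (if of_real (y k) + w0 = 0 then 0 else - of_real (d k * y k) * (z / 2) / (of_real (y k) + z\<^sup>2 / 4)\<^sup>2)" for k and z :: complex
  have fd: "(f k has_field_derivative f' k z) (at z)" if z: "z \<in> ball z0 e" for k z
  proof (cases "of_real (y k) + w0 = 0")
    case True
    then show ?thesis by (simp add: f_def [abs_def] f'_def)
  next
    case False
    have "of_real (y k) + z\<^sup>2 / 4 \<noteq> 0" using fary[OF z False] \<delta> by auto
    then show ?thesis using False unfolding f_def [abs_def] f'_def
      by (auto intro!: derivative_eq_intros simp: power2_eq_square)
  qed
  define h where "h k = d k * (1 + (norm w0 + 1) / (\<delta> / 2))" for k
  have fh: "norm (f k z) \<le> h k" if z: "z \<in> ball z0 e" for k z
  proof (cases "of_real (y k) + w0 = 0")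
    case True
    then show ?thesis using d(1)[of k] \<delta> by (simp add: f_def h_def)
  next
    case False
    let ?q = "of_real (y k) + z\<^sup>2 / 4"
    have q: "?q \<noteq> 0" using fary[OF z False] \<delta> by auto
    have "of_real (y k) / ?q = 1 - (z\<^sup>2 / 4) / ?q" using q by (simp add: divide_simps)
    then have "norm (of_real (y k) / ?q) \<le> 1 + norm (z\<^sup>2 / 4) / norm ?q"
      by (metis norm_one norm_triangle_ineq4 norm_divide)
    also have "\<dots> \<le> 1 + (norm w0 + 1) / (\<delta> / 2)"
    proof (intro add_left_mono frac_le)
      show "norm (z\<^sup>2 / 4) \<le> norm w0 + 1"
        using near[OF z] norm_triangle_ineq2[of "z\<^sup>2 / 4" w0] by (simp add: \<delta>_def)
    qed (use \<delta> fary[OF z False] in auto)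
    finally have "d k * norm (of_real (y k) / ?q) \<le> h k" unfolding h_def by (intro mult_left_mono d)
    moreover have "norm (f k z) = d k * norm (of_real (y k) / ?q)" using False d(1)[of k] by (simp add: f_def norm_mult norm_divide)
    ultimately show ?thesis by simp
  qed
  have hs: "summable h" unfolding h_def by (intro summable_mult2 d)
  obtain g g' where g: "\<forall>x \<in> ball z0 e. ((\<lambda>n. f n x) sums g x) \<and> ((\<lambda>n. f' n x) sums g' x) \<and> (g has_field_derivative g' x) (at x)"
  proof (rule series_and_derivative_comparison[OF open_ball hs, of z0 e f f'])
    show "eventually (\<lambda>n. \<forall>x\<in>ball z0 e. norm (f n x) \<le> h n) sequentially" using fh by simp
  qed (use fd in auto)
  show thesis
  proof (rule that[OF e])
    show "g holomorphic_on ball z0 e"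
      using g by (auto simp: holomorphic_on_open)
    fix z assume z: "z \<in> ball z0 e" "z \<noteq> z0"
    have zy: "of_real (y k) + z\<^sup>2 / 4 \<noteq> 0" for k
      using fary[OF z(1), of k] ne[OF z] \<delta> by (cases "of_real (y k) + w0 = 0") (auto simp: add_eq_0_iff)
    have zb: "of_real (b k) + z\<^sup>2 / 4 \<noteq> 0" for k
      using farb[OF z(1), of k] ne[OF z] \<delta> by (cases "of_real (b k) + w0 = 0") (auto simp: add_eq_0_iff)
    have "z\<^sup>2 / 4 \<notin> range (\<lambda>k. - of_real (y k))" "z\<^sup>2 / 4 \<notin> range (\<lambda>k. - of_real ((n / 4 + \<gamma> / 2 + real k)\<^sup>2))"
    proof -
      have "z\<^sup>2 / 4 \<notin> range (\<lambda>k. - of_real (u k))" if "\<And>k. of_real (u k) + z\<^sup>2 / 4 \<noteq> 0" for u :: "nat \<Rightarrow> real"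
        using that by (metis (no_types, lifting) add.right_inverse rangeE)
      from this[OF zy] this[OF zb] show "z\<^sup>2 / 4 \<notin> range (\<lambda>k. - of_real (y k))"
        "z\<^sup>2 / 4 \<notin> range (\<lambda>k. - of_real ((n / 4 + \<gamma> / 2 + real k)\<^sup>2))" unfolding b_def by this+
    qed
    have inv: "1 / a = b" if "a * b = 1" for a b :: complex
      using that by (auto simp: divide_eq_eq mult.commute)
    from eq[rule_format, OF \<open>z\<^sup>2 / 4 \<notin> range (\<lambda>k. - of_real (y k))\<close> \<open>z\<^sup>2 / 4 \<notin> range (\<lambda>k. - of_real ((n / 4 + \<gamma> / 2 + real k)\<^sup>2))\<close>] have 1: "resolvent_symbol n \<gamma> \<kappa> z = (\<Sum>k. of_real (d k * y k) / (of_real (y k) + z\<^sup>2 / 4))"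
      unfolding resolvent_symbol_def by (rule inv)
    let ?K = "{k. of_real (y k) + z0\<^sup>2 / 4 = 0}"
    let ?F = "\<lambda>k. of_real (d k * y k) / (of_real (y k) + z\<^sup>2 / 4)"
    have fin: "finite ?K"
    proof (rule finite_subset)
      show "?K \<subseteq> y -` {- Re w0} \<inter> UNIV"
        by (auto simp: w0_def complex_eq_iff)
      show "finite (y -` {- Re w0} \<inter> UNIV)"
        using y(2) by (intro finite_vimage_IntI) (auto simp: strict_mono_imp_inj_on)
    qed
    have "(\<lambda>k. f k z + (if k \<in> ?K then ?F k else 0)) sums (g z + (\<Sum>k\<in>?K. ?F k))"
      using g z fin by (intro sums_add sums_If_finite_set) auto
    moreover have "f k z + (if k \<in> ?K then ?F k else 0) = ?F k" for k by (auto simp: f_def w0_def)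
    ultimately have "(\<lambda>k. ?F k) sums (g z + (\<Sum>k\<in>?K. ?F k))" by simp
    then show "resolvent_symbol n \<gamma> \<kappa> z = g z + (\<Sum>k\<in>?K. ?F k)"
      unfolding 1 by (simp add: sums_iff)
  qed
qed

text \<open>At most one k is singular at \<open>z0\<close> because \<open>y\<close> is injective.
  Its denominator is (z - z0) (z + z0) / 4, and \<open>z0\<close> is not 0 because
  \<open>y k\<close> is not; so the pole is simple, with residue 4 d y / (2 z0).\<close>

lemma resolvent_poles:
  fixes n :: nat and \<gamma> \<kappa> :: real and y d :: "nat \<Rightarrow> real" and z0 :: complex
  assumes \<gamma>: "0 < \<gamma>" and y: "\<And>k. 0 \<le> y k" "strict_mono y" "filterlim y at_top sequentially"
    and d: "\<And>k. 0 \<le> d k" "summable d"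
    and eq: "\<forall>z. z\<^sup>2 / 4 \<notin> range (\<lambda>k. - of_real (y k)) \<longrightarrow>
      z\<^sup>2 / 4 \<notin> range (\<lambda>k. - of_real ((n / 4 + \<gamma> / 2 + real k)\<^sup>2)) \<longrightarrow>
       (Theta0 n \<gamma> z - of_real \<kappa>) * (\<Sum>k. of_real (d k * y k) / (of_real (y k) + z\<^sup>2 / 4)) = 1"
  shows "is_pole (resolvent_symbol n \<gamma> \<kappa>) z0 \<longleftrightarrow> (\<exists>k. d k * y k \<noteq> 0 \<and> of_real (y k) + z0\<^sup>2 / 4 = 0)" (is ?A)
    and "\<And>k. d k * y k \<noteq> 0 \<Longrightarrow> of_real (y k) + z0\<^sup>2 / 4 = 0 \<Longrightarrow>
       residue (resolvent_symbol n \<gamma> \<kappa>) z0 = 2 * of_real (d k * y k) / z0"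
proof -
  let ?R = "resolvent_symbol n \<gamma> \<kappa>"
  let ?K = "{k. of_real (y k) + z0\<^sup>2 / 4 = 0}"
  obtain e g where e: "e > 0" and g: "g holomorphic_on ball z0 e" and
    Rg: "\<And>z. z \<in> ball z0 e \<Longrightarrow> z \<noteq> z0 \<Longrightarrow> resolvent_symbol n \<gamma> \<kappa> z =
       g z + (\<Sum>k\<in>?K. of_real (d k * y k) / (of_real (y k) + z\<^sup>2 / 4))"
    by (fact resolvent_local[OF \<gamma> y d eq])
  have ev: "eventually (\<lambda>z. z \<in> ball z0 \<epsilon> \<and> z \<noteq> z0) (at z0)" if "\<epsilon> > 0" for \<epsilon>
    using that by (simp add: eventually_at dist_commute) blast
  have K1: "j = k" if "j \<in> ?K" "k \<in> ?K" for j k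
    using that y(2) by (auto simp: complex_eq_iff strict_mono_eq add_eq_0_iff)
  have pole: "is_pole ?R z0 \<and> residue ?R z0 = 2 * of_real (d k * y k) / z0"
    if k: "d k * y k \<noteq> 0" "of_real (y k) + z0\<^sup>2 / 4 = 0" for k
  proof -
    have z0: "z0 \<noteq> 0" using k by auto
    have K: "?K = {k}" using K1 k by auto
    define \<epsilon> where "\<epsilon> = min e (norm z0)"
    have \<epsilon>: "\<epsilon> > 0" using e z0 by (simp add: \<epsilon>_def)
    define G where "G z = g z * (z - z0) + 4 * of_real (d k * y k) / (z + z0)" for z
    have nz: "z + z0 \<noteq> 0" if "z \<in> ball z0 \<epsilon>" for z
    proof
      assume "z + z0 = 0"
      then have "z = - z0" by (simp add: add_eq_0_iff2)
      then show False using that by (auto simp: \<epsilon>_def dist_norm)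
    qed
    have sub: "ball z0 \<epsilon> \<subseteq> ball z0 e" by (auto simp: \<epsilon>_def)
    have G: "G holomorphic_on ball z0 \<epsilon>"
      unfolding G_def by (intro holomorphic_intros holomorphic_on_subset[OF g sub]) (use nz in auto)
    have RG: "?R z = G z / (z - z0)" if "z \<in> ball z0 \<epsilon>" "z \<noteq> z0" for z
    proof -
      have "of_real (y k) = - (z0\<^sup>2 / 4)" using k(2) by (simp add: add_eq_0_iff2)
      then have "of_real (y k) + z\<^sup>2 / 4 = (z - z0) * (z + z0) / 4" by (simp add: power2_eq_square algebra_simps)
      then have "?R z = g z + 4 * of_real (d k * y k) / ((z - z0) * (z + z0))"
      proof -
        have "z \<in> ball z0 e" using that sub by blast
        from Rg[OF this that(2)] show ?thesis
          unfolding K \<open>of_real (y k) + z\<^sup>2 / 4 = (z - z0) * (z + z0) / 4\<close> by (simp add: \<open>of_real (y k) + z\<^sup>2 / 4 = (z - z0) * (z + z0) / 4\<close>)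
      qed
      also have "\<dots> = G z / (z - z0)"
      proof -
        have "u + q / (a * b) = (u * a + q / b) / a" if "a \<noteq> 0" for a b u q :: complex
          using that by (simp add: add_divide_distrib mult.commute)
        then show ?thesis unfolding G_def using that by simp
      qed
      finally show ?thesis .
    qed
    have RG': "eventually (\<lambda>z. ?R z = G z / (z - z0)) (at z0)"
      using ev[OF \<epsilon>] by eventually_elim (use RG in auto)
    have G0: "G z0 = 2 * of_real (d k * y k) / z0" using z0 by (simp add: G_def field_simps)
    have "residue ?R z0 = residue (\<lambda>z. G z / (z - z0)) z0" by (rule residue_cong[OF RG']) simp
    also have "\<dots> = G z0" using \<epsilon> by (intro residue_simple[OF open_ball _ G]) simp
    finally have res: "residue ?R z0 = 2 * of_real (d k * y k) / z0" by (simp add: G0)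
    have "G z0 \<noteq> 0" using k z0 unfolding G0 by simp
    then have "is_pole (\<lambda>z. G z / (z - z0) ^ 1) z0"
      using \<epsilon> by (intro is_pole_basic[OF G]) auto
    then have "is_pole ?R z0" using is_pole_cong[OF RG'] by simp
    then show ?thesis using res by simp
  qed
  then show "\<And>k. d k * y k \<noteq> 0 \<Longrightarrow> of_real (y k) + z0\<^sup>2 / 4 = 0 \<Longrightarrow>
       residue (resolvent_symbol n \<gamma> \<kappa>) z0 = 2 * of_real (d k * y k) / z0" by blast
  have "\<not> is_pole ?R z0" if "\<not> (\<exists>k. d k * y k \<noteq> 0 \<and> of_real (y k) + z0\<^sup>2 / 4 = 0)"
  proof -
    have "eventually (\<lambda>z. ?R z = g z) (at z0)"
      using ev[OF e]
    proof eventually_elim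
      case (elim z)
      have "(\<Sum>k\<in>?K. of_real (d k * y k) / (of_real (y k) + z\<^sup>2 / 4)) = 0"
        using that by (intro sum.neutral) auto
      then show ?case using Rg[of z] elim by simp
    qed
    then have "is_pole ?R z0 \<longleftrightarrow> is_pole g z0" by (intro is_pole_cong) auto
    then show ?thesis using not_is_pole_holomorphic[OF open_ball _ g] e by simp
  qed
  then show ?A using pole by blast
qed

text \<open>For the pole i \<sigma> one has y = \<sigma>^2 / 4, and the residue formula becomes c =
  d \<sigma> / 2. Positivity and summability of the coefficients \<open>d\<close> thus turn into
  those of c and c / \<sigma>. The point \<xi> = 0 is left out because \<open>y 0\<close> might be
  0; under a Fourier integral one point is negligible.\<close>

theorem green_function_symbol:
  fixes n :: nat and \<gamma> \<kappa> :: real and \<sigma> \<tau> c :: "nat \<Rightarrow> real"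
  assumes \<gamma>: "0 < \<gamma>" "\<gamma> < 1" and n: "n \<ge> 2" and \<kappa>: "0 \<le> \<kappa>" "\<kappa> < hardy_const n \<gamma>"
    and pd: "pole_data n \<gamma> \<kappa> \<sigma> \<tau>"
    and c: "\<And>j. c j = green_coeff n \<gamma> \<kappa> (\<sigma> j) (\<tau> j)"
    and \<tau>: "\<And>j. \<tau> j = 0"
  shows "0 < \<sigma> 0" and "\<sigma> 0 \<le> \<sigma> j" and "0 < c j" and "summable (\<lambda>j. c j / \<sigma> j)"
    and "\<And>\<xi>. \<xi> \<noteq> 0 \<Longrightarrow> (Theta0 n \<gamma> (of_real \<xi>) - of_real \<kappa>) * of_real (\<Sum>j. 2 * c j * \<sigma> j / (\<xi>\<^sup>2 + (\<sigma> j)\<^sup>2)) = 1"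
proof -
  show \<sigma>0: "0 < \<sigma> 0" using pd by (auto simp: pole_data_def)
  have \<sigma>0_le: "\<sigma> 0 \<le> \<sigma> j" for j using pd by (cases "j = 0") (auto simp: pole_data_def Suc_le_eq intro: less_imp_le)
  then show "\<sigma> 0 \<le> \<sigma> j" .
  have \<sigma>pos: "0 < \<sigma> j" for j using \<sigma>0 \<sigma>0_le[of j] by linarith
  obtain y d :: "nat \<Rightarrow> real" where y: "\<And>k. 0 \<le> y k" "strict_mono y" "filterlim y at_top sequentially"
    and d: "\<And>k. 0 \<le> d k" "summable d" and
    eq: "\<forall>z. z\<^sup>2 / 4 \<notin> range (\<lambda>k. - of_real (y k)) \<longrightarrow>
      z\<^sup>2 / 4 \<notin> range (\<lambda>k. - of_real ((n / 4 + \<gamma> / 2 + real k)\<^sup>2)) \<longrightarrow>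
       (Theta0 n \<gamma> z - of_real \<kappa>) * (\<Sum>k. of_real (d k * y k) / (of_real (y k) + z\<^sup>2 / 4)) = 1"
    by (fact resolvent_expansion[OF \<gamma> n \<kappa>])
  have rp1: "is_pole (resolvent_symbol n \<gamma> \<kappa>) z0 \<longleftrightarrow> (\<exists>k. d k * y k \<noteq> 0 \<and> of_real (y k) + z0\<^sup>2 / 4 = 0)" for z0
    by (rule resolvent_poles(1)[OF \<gamma>(1) y d eq])
  have rp2: "residue (resolvent_symbol n \<gamma> \<kappa>) z0 = 2 * of_real (d k * y k) / z0"
    if "d k * y k \<noteq> 0" "of_real (y k) + z0\<^sup>2 / 4 = 0" for k z0
    by (rule resolvent_poles(2)[OF \<gamma>(1) y d eq that])
  have poles: "{z. is_pole (resolvent_symbol n \<gamma> \<kappa>) z} = (\<Union>j. {Complex 0 (\<sigma> j), Complex 0 (- \<sigma> j)})"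
    using pd \<tau> by (simp add: pole_data_def insert_commute insert_absorb2)
  have sq: "(Complex 0 s)\<^sup>2 / 4 = - of_real (s\<^sup>2 / 4)" for s
    by (simp add: complex_eq_iff power2_eq_square)
  define I where "I = {k. d k * y k \<noteq> 0}"
  have "\<exists>k. k \<in> I \<and> y k = (\<sigma> j)\<^sup>2 / 4" for j
  proof -
    have "is_pole (resolvent_symbol n \<gamma> \<kappa>) (Complex 0 (\<sigma> j))" using poles by auto
    then obtain k where "d k * y k \<noteq> 0" "of_real (y k) + (Complex 0 (\<sigma> j))\<^sup>2 / 4 = 0" unfolding rp1 by blast
    then have "complex_of_real (y k) = of_real ((\<sigma> j)\<^sup>2 / 4)" "k \<in> I" unfolding sq I_def by auto
    then show ?thesis unfolding of_real_eq_iff by blast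
  qed
  then obtain p where p: "\<And>j. p j \<in> I" "\<And>j. y (p j) = (\<sigma> j)\<^sup>2 / 4" by metis
  \<comment> \<open>Injectivity comes from the listing without repetition. Surjectivity holds
    because every term with nonzero coefficient produces a pole on the positive imaginary axis,
    which has to be some i \<sigma>.\<close>
  have bij: "bij_betw p UNIV I"
    unfolding bij_betw_def
  proof
    have "inj \<sigma>" using pd \<tau> by (auto simp: pole_data_def inj_def)
    have "\<sigma> i = \<sigma> j" if "p i = p j" for i j
      using p(2)[of i] p(2)[of j] that \<sigma>pos[of i] \<sigma>pos[of j] by (simp add: power2_eq_iff)
    then show "inj p" by (intro injI injD[OF \<open>inj \<sigma>\<close>])
    show "range p = I"
    proof (intro equalityI subsetI)
      fix k assume k: "k \<in> I"
      define s where "s = 2 * sqrt (y k)"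
      have s: "s > 0" "s\<^sup>2 / 4 = y k" using k y(1)[of k] by (auto simp: s_def I_def power_mult_distrib less_le)
      have "is_pole (resolvent_symbol n \<gamma> \<kappa>) (Complex 0 s)"
        unfolding rp1 sq using k s(2) by (auto simp: I_def intro!: exI[of _ k])
      then have "Complex 0 s \<in> (\<Union>j. {Complex 0 (\<sigma> j), Complex 0 (- \<sigma> j)})" using poles by blast
      then obtain j where "Complex 0 s = Complex 0 (\<sigma> j) \<or> Complex 0 s = Complex 0 (- \<sigma> j)" by blast
      then have "s = \<sigma> j" using s(1) \<sigma>pos[of j] by auto
      then have "y (p j) = y k" using p(2)[of j] s(2) by simp
      then have "p j = k" using y(2) by (simp add: strict_mono_eq)
      then show "k \<in> range p" by auto
    qed (use p in auto)
  qed
  have cd: "c j = d (p j) * \<sigma> j / 2" for j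
  proof -
    have "of_real (y (p j)) + (Complex 0 (\<sigma> j))\<^sup>2 / 4 = 0" unfolding sq p(2) by simp
    then have "residue (resolvent_symbol n \<gamma> \<kappa>) (Complex 0 (\<sigma> j)) = 2 * of_real (d (p j) * y (p j)) / Complex 0 (\<sigma> j)"
      using p(1)[of j] by (intro rp2) (auto simp: I_def)
    also have "\<dots> = Complex 0 (- (d (p j) * \<sigma> j / 2))"
      using \<sigma>pos[of j] by (simp add: p(2) complex_eq_iff power2_eq_square Re_divide Im_divide)
    finally show ?thesis by (simp add: c \<tau> green_coeff_def)
  qed
  show cpos: "0 < c j" for j
  proof -
    have "d (p j) \<noteq> 0" using p(1)[of j] by (auto simp: I_def)
    then show ?thesis unfolding cd using d(1)[of "p j"] \<sigma>pos[of j] by simp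
  qed
  have dI: "summable (\<lambda>j. d (p j))"
  proof -
    define d' where "d' k = (if k \<in> I then d k else 0)" for k
    have "summable (\<lambda>k. norm (d' k))"
      by (rule summable_comparison_test'[OF d(2)]) (use d(1) in \<open>auto simp: d'_def\<close>)
    from suminf_reindex_support(1)[OF bij _ this] have "summable (\<lambda>j. norm (d' (p j)))" by (simp add: d'_def)
    then show ?thesis using p(1) d(1) by (simp add: d'_def)
  qed
  then show sc: "summable (\<lambda>j. c j / \<sigma> j)"
    unfolding cd using \<sigma>pos summable_divide[OF dI, of 2] by (simp add: less_imp_neq[symmetric])
  fix \<xi> :: real assume \<xi>: "\<xi> \<noteq> 0"
  have x2: "(complex_of_real \<xi>)\<^sup>2 / 4 = of_real (\<xi>\<^sup>2 / 4)" by simp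
  have pos: "0 < y k + \<xi>\<^sup>2 / 4" "0 < (n / 4 + \<gamma> / 2 + real k)\<^sup>2 + \<xi>\<^sup>2 / 4" for k
    using y(1)[of k] \<xi> by (auto intro: add_nonneg_pos)
  have no: "(complex_of_real \<xi>)\<^sup>2 / 4 \<notin> range (\<lambda>k. - of_real (f k))" if f: "\<And>k. 0 < f k + \<xi>\<^sup>2 / 4" for f :: "nat \<Rightarrow> real"
  proof
    assume "(complex_of_real \<xi>)\<^sup>2 / 4 \<in> range (\<lambda>k. - of_real (f k))"
    then obtain k where "complex_of_real (\<xi>\<^sup>2 / 4) = of_real (- f k)" unfolding x2 by auto
    then have "\<xi>\<^sup>2 / 4 = - f k" by (simp only: of_real_eq_iff)
    then show False using f[of k] by simp
  qed
  define F where "F k = d k * y k / (y k + \<xi>\<^sup>2 / 4)" for k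
  have F: "0 \<le> F k" "F k \<le> d k" for k
  proof -
    show "0 \<le> F k" unfolding F_def using pos(1)[of k] d(1)[of k] y(1)[of k] by simp
    have "y k / (y k + \<xi>\<^sup>2 / 4) \<le> 1" using pos(1)[of k] by simp
    from mult_left_mono[OF this d(1)[of k]] show "F k \<le> d k" by (simp add: F_def)
  qed
  have Fs: "summable (\<lambda>k. norm (F k))"
    by (rule summable_comparison_test'[OF d(2)]) (use F in auto)
  have "(\<Sum>k. of_real (d k * y k) / (of_real (y k) + (complex_of_real \<xi>)\<^sup>2 / 4)) = (\<Sum>k. of_real (F k))"
    by (simp add: F_def)
  also have "\<dots> = of_real (\<Sum>k. F k)"
    using Fs by (intro suminf_of_real[symmetric]) (rule summable_norm_cancel)
  also have "(\<Sum>k. F k) = (\<Sum>j. F (p j))"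
    by (rule suminf_reindex_support(2)[OF bij _ Fs, symmetric]) (auto simp: F_def I_def)
  also have "(\<lambda>j. F (p j)) = (\<lambda>j. 2 * c j * \<sigma> j / (\<xi>\<^sup>2 + (\<sigma> j)\<^sup>2))"
  proof
    fix j
    have "(\<sigma> j)\<^sup>2 / 4 + \<xi>\<^sup>2 / 4 = (\<xi>\<^sup>2 + (\<sigma> j)\<^sup>2) / 4" by simp
    then show "F (p j) = 2 * c j * \<sigma> j / (\<xi>\<^sup>2 + (\<sigma> j)\<^sup>2)"
      unfolding F_def p(2) cd by (simp add: power2_eq_square mult_ac add.commute)
  qed
  finally show "(Theta0 n \<gamma> (of_real \<xi>) - of_real \<kappa>) * of_real (\<Sum>j. 2 * c j * \<sigma> j / (\<xi>\<^sup>2 + (\<sigma> j)\<^sup>2)) = 1"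
    using eq[rule_format, OF no[OF pos(1)] no[OF pos(2)]] by simp
qed

section \<open>Convolution with an exponential kernel\<close>

lemma integral_exp_half_line:
  fixes a :: complex
  assumes a: "Re a > 0"
  shows "set_integrable lborel {0<..} (\<lambda>x. exp (- a * of_real x))"
    and "(LINT x:{0<..}|lborel. exp (- a * of_real x)) = 1 / a"
proof -
  show int: "set_integrable lborel {0<..} (\<lambda>x. exp (- a * of_real x))"
  proof (rule set_integrable_bound[OF integrable_I0i_exp_mscale[OF a]])
    show "set_borel_measurable lborel {0<..} (\<lambda>x. exp (- a * complex_of_real x))"
      unfolding set_borel_measurable_def by measurable
    show "AE x in lborel. x \<in> {0<..} \<longrightarrow> cmod (exp (- a * complex_of_real x)) \<le> norm (exp (- (x * Re a)))"
      by (simp add: norm_exp_eq_Re mult.commute)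
  qed
  have "(LBINT x=0..\<infinity>. exp (- a * of_real x)) = 0 - (- (1 / a))"
  proof (rule interval_integral_FTC_integrable[where F = "\<lambda>x. - exp (- a * of_real x) / a"])
    show "((\<lambda>x. - exp (- a * of_real x) / a) has_vector_derivative exp (- a * of_real x)) (at x)" for x
      using a by (auto intro!: derivative_eq_intros has_vector_derivative_real_field)
    show "isCont (\<lambda>x. exp (- a * complex_of_real x)) x" for x by (intro continuous_intros)
    show "set_integrable lborel (einterval 0 \<infinity>) (\<lambda>x. exp (- a * complex_of_real x))"
      using int by (simp add: einterval_def greaterThan_def zero_ereal_def)
    have "((\<lambda>x. - exp (- a * of_real x) / a) \<longlongrightarrow> - exp (- a * of_real 0) / a) (at_right 0)"
      using a by (intro tendsto_intros) auto
    then show "(((\<lambda>x. - exp (- a * complex_of_real x) / a) \<circ> real_of_ereal) \<longlongrightarrow> - (1 / a)) (at_right 0)"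
      unfolding zero_ereal_def ereal_tendsto_simps1 by simp
    have "((\<lambda>x. exp (- (Re a * x))) \<longlongrightarrow> 0) at_top" using a by real_asymp
    then have "((\<lambda>x. norm (exp (- a * of_real x))) \<longlongrightarrow> 0) at_top" by (simp add: norm_exp_eq_Re)
    then have "((\<lambda>x. exp (- a * of_real x)) \<longlongrightarrow> 0) at_top" by (rule tendsto_norm_zero_cancel)
    then have "((\<lambda>x. - exp (- a * of_real x) / a) \<longlongrightarrow> - 0 / a) at_top"
      using a by (intro tendsto_intros) auto
    then show "(((\<lambda>x. - exp (- a * complex_of_real x) / a) \<circ> real_of_ereal) \<longlongrightarrow> 0) (at_left \<infinity>)"
      unfolding ereal_tendsto_simps1 by simp
  qed auto
  then show "(LINT x:{0<..}|lborel. exp (- a * of_real x)) = 1 / a"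
    by (simp add: interval_lebesgue_integral_0_infty)
qed

lemma fourier_exp_abs:
  fixes s \<xi> :: real
  assumes s: "s > 0"
  shows "integrable lborel (\<lambda>t. exp (- s * \<bar>t\<bar>))"
    and "(LBINT t. exp (- \<i> * of_real (\<xi> * t)) * of_real (exp (- s * \<bar>t\<bar>))) = of_real (2 * s / (\<xi>\<^sup>2 + s\<^sup>2))"
    and "(LBINT t. exp (- s * \<bar>t\<bar>)) = 2 / s"
proof -
  have main: "integrable lborel (\<lambda>t. exp (- \<i> * of_real (\<xi> * t)) * of_real (exp (- s * \<bar>t\<bar>))) \<and>
     (LBINT t. exp (- \<i> * of_real (\<xi> * t)) * of_real (exp (- s * \<bar>t\<bar>))) = of_real (2 * s / (\<xi>\<^sup>2 + s\<^sup>2))" for \<xi>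
  proof -
    let ?f = "\<lambda>t. exp (- \<i> * of_real (\<xi> * t)) * complex_of_real (exp (- s * \<bar>t\<bar>))"
    let ?a = "of_real s + \<i> * of_real \<xi>" and ?b = "of_real s - \<i> * of_real \<xi>"
    let ?p = "\<lambda>t. indicator {0<..} t *\<^sub>R exp (- ?a * of_real t)" and ?q = "\<lambda>t. indicator {0<..} t *\<^sub>R exp (- ?b * of_real t)"
    have p: "integrable lborel ?p" "integral\<^sup>L lborel ?p = 1 / ?a"
      using integral_exp_half_line[of ?a] s by (simp_all add: set_integrable_def set_lebesgue_integral_def)
    have q: "integrable lborel ?q" "integral\<^sup>L lborel ?q = 1 / ?b"
      using integral_exp_half_line[of ?b] s by (simp_all add: set_integrable_def set_lebesgue_integral_def)
    have q': "integrable lborel (\<lambda>t. ?q (0 + (-1) * t))" "integral\<^sup>L lborel (\<lambda>t. ?q (0 + (-1) * t)) = 1 / ?b"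
      using lborel_integrable_real_affine[OF q(1), of "-1" 0] lborel_integral_real_affine[of "-1" ?q 0] q(2) by simp_all
    have eq: "?f t = ?p t + ?q (0 + (-1) * t)" if "t \<noteq> 0" for t
      using that by (cases "t > 0") (auto simp: exp_add[symmetric] exp_of_real[symmetric] algebra_simps simp del: exp_of_real)
    have int: "integrable lborel (\<lambda>t. ?p t + ?q (0 + (-1) * t))" using p(1) q'(1) by (rule Bochner_Integration.integrable_add)
    have I: "integrable lborel ?f \<longleftrightarrow> integrable lborel (\<lambda>t. ?p t + ?q (0 + (-1) * t))"
      by (rule integrable_discrete_difference[where X = "{0}"]) (use eq in auto)
    have "integral\<^sup>L lborel ?f = integral\<^sup>L lborel (\<lambda>t. ?p t + ?q (0 + (-1) * t))"
      by (rule integral_discrete_difference[where X = "{0}"]) (use eq in auto)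
    also have "\<dots> = 1 / ?a + 1 / ?b"
      by (subst Bochner_Integration.integral_add[OF p(1) q'(1)]) (simp only: p(2) q'(2))
    also have "\<dots> = of_real (2 * s / (\<xi>\<^sup>2 + s\<^sup>2))"
    proof -
      have n: "?a \<noteq> 0" "?b \<noteq> 0" using s by (auto simp: complex_eq_iff)
      have ab: "?a * ?b = of_real (\<xi>\<^sup>2 + s\<^sup>2)" by (simp add: complex_eq_iff power2_eq_square)
      have "1 / ?a + 1 / ?b = (?b + ?a) / (?a * ?b)" using n by (simp add: field_simps)
      also have "\<dots> = of_real (2 * s / (\<xi>\<^sup>2 + s\<^sup>2))" unfolding ab by simp
      finally show ?thesis .
    qed
    finally show ?thesis using I int by blast
  qed
  show "(LBINT t. exp (- \<i> * of_real (\<xi> * t)) * of_real (exp (- s * \<bar>t\<bar>))) = of_real (2 * s / (\<xi>\<^sup>2 + s\<^sup>2))"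
    using main by blast
  have m0: "integrable lborel (\<lambda>t. complex_of_real (exp (- s * \<bar>t\<bar>)))"
     "(LBINT t. complex_of_real (exp (- s * \<bar>t\<bar>))) = of_real (2 / s)"
    using main[of 0] s by (simp_all add: power2_eq_square)
  show i: "integrable lborel (\<lambda>t. exp (- s * \<bar>t\<bar>))"
    using integrable_Re[OF m0(1)] by simp
  show "(LBINT t. exp (- s * \<bar>t\<bar>)) = 2 / s"
    using m0(2) unfolding integral_complex_of_real of_real_eq_iff .
qed

text \<open>The kernel is 2 s times the fundamental solution of s^2 minus the second
  derivative.\<close>

definition exp_conv :: "real \<Rightarrow> (real \<Rightarrow> real) \<Rightarrow> real \<Rightarrow> real" where
  "exp_conv s h t = (LBINT u. exp (- s * \<bar>t - u\<bar>) * h u)"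

lemma integrable_exp_shift:
  fixes s t :: real
  assumes "s > 0"
  shows "integrable lborel (\<lambda>u. exp (- s * \<bar>t - u\<bar>))" and "(LBINT u. exp (- s * \<bar>t - u\<bar>)) = 2 / s"
  using lborel_integrable_real_affine[OF fourier_exp_abs(1)[OF assms], of "-1" t]
    lborel_integral_real_affine[of "-1" "\<lambda>u. exp (- s * \<bar>u\<bar>)" t] fourier_exp_abs(3)[OF assms] by simp_all

lemma integrable_exp_conv_kernel:
  fixes h :: "real \<Rightarrow> real"
  assumes s: "s > 0" and h: "h \<in> borel_measurable borel" "\<And>t. \<bar>h t\<bar> \<le> M"
  shows "integrable lborel (\<lambda>u. exp (- s * \<bar>t - u\<bar>) * h u)"
proof (rule Bochner_Integration.integrable_bound)
  show "integrable lborel (\<lambda>u. exp (- s * \<bar>t - u\<bar>) * M)"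
    by (rule integrable_mult_left[OF integrable_exp_shift(1)[OF s]])
  show "AE u in lborel. norm (exp (- s * \<bar>t - u\<bar>) * h u) \<le> norm (exp (- s * \<bar>t - u\<bar>) * M)"
    using h(2) order_trans[OF h(2) abs_ge_self] by (auto simp: abs_mult intro!: mult_left_mono AE_I2)
qed (use h(1) in measurable)

lemma exp_conv_nonneg: "(\<And>t. 0 \<le> h t) \<Longrightarrow> 0 \<le> exp_conv s h t"
  unfolding exp_conv_def by (intro integral_nonneg_AE) auto

lemma exp_conv_bound:
  assumes s: "s > 0" and h: "h \<in> borel_measurable borel" "\<And>t. \<bar>h t\<bar> \<le> M"
  shows "\<bar>exp_conv s h t\<bar> \<le> 2 * M / s"
proof -
  have "norm (exp_conv s h t) \<le> (LBINT u. norm (exp (- s * \<bar>t - u\<bar>) * h u))"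
    unfolding exp_conv_def by (rule integral_norm_bound)
  also have "\<dots> \<le> (LBINT u. exp (- s * \<bar>t - u\<bar>) * M)"
    using integrable_exp_conv_kernel[OF s h, of t] integrable_exp_shift(1)[OF s, of t] h(2)
    by (intro integral_mono integrable_norm integrable_mult_left) (auto simp: abs_mult)
  also have "\<dots> = 2 * M / s" using integrable_exp_shift(2)[OF s, of t] by simp
  finally show ?thesis by simp
qed

lemma exp_conv_alt: "exp_conv s h t = (LBINT u. exp (- s * \<bar>u\<bar>) * h (t - u))"
  unfolding exp_conv_def
  using lborel_integral_real_affine[of "-1" "\<lambda>u. exp (- s * \<bar>t - u\<bar>) * h u" t] by simp

text \<open>Convolution commutes with translations and the kernel has mass 2 / s. The factor 1 / s
  is what later allows summation against the \<open>c j\<close>.\<close>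

lemma exp_conv_shift_diff:
  assumes s: "s > 0" and h: "h \<in> borel_measurable borel" "\<And>t. \<bar>h t\<bar> \<le> M"
    and K: "\<And>t. \<bar>h (t + \<delta>) - h t\<bar> \<le> K"
  shows "\<bar>exp_conv s h (t + \<delta>) - exp_conv s h t\<bar> \<le> 2 * K / s"
proof -
  have [measurable]: "h \<in> borel_measurable borel" by (rule h)
  have i: "integrable lborel (\<lambda>u. exp (- s * \<bar>u\<bar>) * h (x - u))" for x
    using lborel_integrable_real_affine[OF integrable_exp_conv_kernel[OF s h, of x], of "-1" x] by simp
  have "exp_conv s h (t + \<delta>) - exp_conv s h t = (LBINT u. exp (- s * \<bar>u\<bar>) * h (t + \<delta> - u) - exp (- s * \<bar>u\<bar>) * h (t - u))"
    unfolding exp_conv_alt by (rule Bochner_Integration.integral_diff[symmetric]) (rule i)+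
  also have "\<dots> = exp_conv s (\<lambda>u. h (u + \<delta>) - h u) t"
    unfolding exp_conv_alt by (intro Bochner_Integration.integral_cong refl) (simp add: algebra_simps)
  finally show ?thesis using exp_conv_bound[OF s, of "\<lambda>u. h (u + \<delta>) - h u" K t] K by simp
qed

lemma has_real_derivative_integral_atMost:
  fixes f :: "real \<Rightarrow> real"
  assumes f: "continuous_on UNIV f" and int: "\<And>t. set_integrable lborel {..t} f"
  shows "((\<lambda>t. LINT u:{..t}|lborel. f u) has_real_derivative f t) (at t)"
proof -
  let ?a = "t - 1"
  have "((\<lambda>x. integral {?a..x} f) has_real_derivative f t) (at t within {?a..t+1})"
    by (intro integral_has_real_derivative continuous_on_subset[OF f]) auto
  then have "((\<lambda>x. integral {?a..x} f) has_real_derivative f t) (at t)"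
    by (subst (asm) at_within_interior) auto
  then have d: "((\<lambda>x. (LINT u:{..?a}|lborel. f u) + integral {?a..x} f) has_real_derivative f t) (at t)"
    by (auto intro!: derivative_eq_intros)
  have eq: "(LINT u:{..x}|lborel. f u) = (LINT u:{..?a}|lborel. f u) + integral {?a..x} f" if x: "x \<in> {?a<..}" for x
  proof -
    have i: "set_integrable lborel {?a<..x} f" "set_integrable lborel {?a..x} f"
      by (rule set_integrable_subset[OF int[of x]]; auto)+
    have "{..x} = {..?a} \<union> {?a<..x}" using x by auto
    then have "(LINT u:{..x}|lborel. f u) = (LINT u:{..?a}|lborel. f u) + (LINT u:{?a<..x}|lborel. f u)"
      using set_integral_Un[OF _ int[of ?a] i(1)] by (simp add: disjoint_iff)
    also have "(LINT u:{?a<..x}|lborel. f u) = (LINT u:{?a..x}|lborel. f u)"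
      unfolding set_lebesgue_integral_def
      by (rule integral_discrete_difference[where X = "{?a}"]) (auto simp: indicator_def)
    also have "\<dots> = integral {?a..x} f" by (rule set_borel_integral_eq_integral[OF i(2)])
    finally show ?thesis .
  qed
  show ?thesis
    by (rule has_field_derivative_transform_within_open[OF d, of "{?a<..}"]) (use eq in auto)
qed

lemma has_real_derivative_integral_atLeast:
  fixes f :: "real \<Rightarrow> real"
  assumes f: "continuous_on UNIV f" and int: "\<And>t. set_integrable lborel {t..} f"
  shows "((\<lambda>t. LINT u:{t..}|lborel. f u) has_real_derivative - f t) (at t)"
proof -
  have ind: "indicator {t..} (- u) = (indicator {..- t} u :: real)" for t u :: real by (auto simp: indicator_def)
  have i: "set_integrable lborel {..t} (\<lambda>u. f (- u))" for t
    using lborel_integrable_real_affine[OF int[of "- t", unfolded set_integrable_def], of "-1" 0]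
    by (simp add: set_integrable_def ind)
  have e: "(LINT u:{t..}|lborel. f u) = (LINT u:{..- t}|lborel. f (- u))" for t
    using lborel_integral_real_affine[of "-1" "\<lambda>u. indicator {t..} u *\<^sub>R f u" 0]
    by (simp add: set_lebesgue_integral_def ind)
  have "((\<lambda>t. LINT u:{..t}|lborel. f (- u)) has_real_derivative f (- (- t))) (at (- t))"
    by (rule has_real_derivative_integral_atMost[OF _ i]) (intro continuous_on_compose2[OF f] continuous_intros, auto)
  from DERIV_chain2[where f = "\<lambda>t. LINT u:{..t}|lborel. f (- u)" and g = uminus and Db = "-1" and s = UNIV, OF this DERIV_minus[OF DERIV_ident]] have "((\<lambda>t. LINT u:{..- t}|lborel. f (- u)) has_real_derivative f t * -1) (at t)"
    by (simp add: field_differentiable_minus DERIV_minus)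
  then show ?thesis unfolding e by simp
qed

text \<open>The derivative of \<open>exp_conv s h\<close>, found by splitting the kernel at u = t.
  The explicit form is available before differentiability is known and can be differentiated
  again.\<close>

definition exp_conv' :: "real \<Rightarrow> (real \<Rightarrow> real) \<Rightarrow> real \<Rightarrow> real" where
  "exp_conv' s h t = s * (exp (s * t) * (LINT u:{t..}|lborel. exp (- s * u) * h u) -
     exp (- s * t) * (LINT u:{..t}|lborel. exp (s * u) * h u))"

text \<open>With the half-line integrals A and B of the proof, the convolution is e^(-st) A + e^(st)
  B. In its first derivative the contributions of A' and B' cancel, in the second they add up to - 2
  s h. Both summands are nonnegative, and the derivative is s times their difference, hence the last
  bound.\<close>

lemma exp_conv_properties:
  fixes h :: "real \<Rightarrow> real"
  assumes s: "s > 0" and h: "continuous_on UNIV h" "\<And>t. 0 \<le> h t" "\<And>t. h t \<le> M"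
  shows "(exp_conv s h has_real_derivative exp_conv' s h t) (at t)"
    and "(exp_conv' s h has_real_derivative s\<^sup>2 * exp_conv s h t - 2 * s * h t) (at t)"
    and "\<bar>exp_conv' s h t\<bar> \<le> s * exp_conv s h t"
proof -
  have [measurable]: "h \<in> borel_measurable borel" using h(1) by (rule borel_measurable_continuous_onI)
  have habs: "\<bar>h t\<bar> \<le> M" for t using h(2,3)[of t] by simp
  define A where "A t = (LINT u:{..t}|lborel. exp (s * u) * h u)" for t
  define B where "B t = (LINT u:{t..}|lborel. exp (- s * u) * h u)" for t
  have ker: "integrable lborel (\<lambda>u. exp (- s * \<bar>t - u\<bar>) * h u)" for t
    by (rule integrable_exp_conv_kernel[OF s _ habs]) measurable
  have kI: "integrable lborel (\<lambda>u. indicator S u * (exp (- s * \<bar>t - u\<bar>) * h u))" if "S \<in> sets borel" for t S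
    using integrable_mult_indicator[OF _ ker[of t], of S] that by simp
  have eA: "indicator {..t} u *\<^sub>R (exp (s * u) * h u) = exp (s * t) * (indicator {..t} u * (exp (- s * \<bar>t - u\<bar>) * h u))" for t u
    by (auto simp: indicator_def algebra_simps simp flip: exp_add)
  have eB: "indicator {t..} u *\<^sub>R (exp (- s * u) * h u) = exp (- s * t) * (indicator {t..} u * (exp (- s * \<bar>t - u\<bar>) * h u))" for t u
    by (auto simp: indicator_def algebra_simps simp flip: exp_add)
  have iA: "set_integrable lborel {..t} (\<lambda>u. exp (s * u) * h u)" for t
    unfolding set_integrable_def eA by (intro integrable_mult_right kI) auto
  have iB: "set_integrable lborel {t..} (\<lambda>u. exp (- s * u) * h u)" for t
    unfolding set_integrable_def eB by (intro integrable_mult_right kI) auto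
  have dA: "(A has_real_derivative exp (s * t) * h t) (at t)" for t
    unfolding A_def using has_real_derivative_integral_atMost[OF _ iA, where t = t] h(1) by (simp add: continuous_intros)
  have dB: "(B has_real_derivative - (exp (- s * t) * h t)) (at t)" for t
    unfolding B_def using has_real_derivative_integral_atLeast[OF _ iB, where t = t] h(1) by (simp add: continuous_intros)
  have AB0: "A t \<ge> 0" "B t \<ge> 0" for t
    unfolding A_def B_def set_lebesgue_integral_def using h(2) by (auto intro!: integral_nonneg_AE)
  have E: "exp_conv s h t = exp (- s * t) * A t + exp (s * t) * B t" for t
  proof -
    have "exp (- s * t) * A t + exp (s * t) * B t =
        (LBINT u. indicator {..t} u * (exp (- s * \<bar>t - u\<bar>) * h u)) + (LBINT u. indicator {t..} u * (exp (- s * \<bar>t - u\<bar>) * h u))"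
    proof -
      have "exp (- s * t) * (exp (s * t) * x) = x" "exp (s * t) * (exp (- s * t) * x) = x" for x
        by (simp_all flip: exp_add mult.assoc)
      then show ?thesis
        unfolding A_def B_def set_lebesgue_integral_def eA eB integral_mult_right_zero by (simp only:)
    qed
    also have "\<dots> = (LBINT u. indicator {..t} u * (exp (- s * \<bar>t - u\<bar>) * h u) + indicator {t..} u * (exp (- s * \<bar>t - u\<bar>) * h u))"
      by (intro Bochner_Integration.integral_add[symmetric] kI) auto
    also have "\<dots> = exp_conv s h t" unfolding exp_conv_def
      by (rule integral_discrete_difference[where X = "{t}"]) (auto simp: indicator_def)
    finally show ?thesis by simp
  qed
  have E': "exp_conv' s h t = s * (exp (s * t) * B t - exp (- s * t) * A t)" for t
    by (simp add: exp_conv'_def A_def B_def)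
  have ee: "exp (- (s * t)) * exp (s * t) = 1" for t by (simp flip: exp_add)
  have "((\<lambda>t. exp (- s * t) * A t + exp (s * t) * B t) has_real_derivative
      (- s * exp (- s * t)) * A t + exp (- s * t) * (exp (s * t) * h t) +
      ((s * exp (s * t)) * B t + exp (s * t) * (- (exp (- s * t) * h t)))) (at t)"
    by (auto intro!: derivative_eq_intros dA dB)
  also have "(- s * exp (- s * t)) * A t + exp (- s * t) * (exp (s * t) * h t) +
      ((s * exp (s * t)) * B t + exp (s * t) * (- (exp (- s * t) * h t))) = exp_conv' s h t"
    unfolding E' by (simp add: algebra_simps)
  finally show "(exp_conv s h has_real_derivative exp_conv' s h t) (at t)" unfolding E[abs_def] .
  have "((\<lambda>t. s * (exp (s * t) * B t - exp (- s * t) * A t)) has_real_derivative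
      s * ((s * exp (s * t)) * B t + exp (s * t) * (- (exp (- s * t) * h t)) -
      ((- s * exp (- s * t)) * A t + exp (- s * t) * (exp (s * t) * h t)))) (at t)"
    by (auto intro!: derivative_eq_intros dA dB)
  also have "s * ((s * exp (s * t)) * B t + exp (s * t) * (- (exp (- s * t) * h t)) -
      ((- s * exp (- s * t)) * A t + exp (- s * t) * (exp (s * t) * h t))) =
      s\<^sup>2 * exp_conv s h t - 2 * s * ((exp (- (s * t)) * exp (s * t)) * h t)"
    unfolding E by (simp add: algebra_simps power2_eq_square)
  finally show "(exp_conv' s h has_real_derivative s\<^sup>2 * exp_conv s h t - 2 * s * h t) (at t)"
    unfolding E'[abs_def] ee by simp
  have "\<bar>exp (s * t) * B t - exp (- s * t) * A t\<bar> \<le> exp_conv s h t"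
    unfolding E using AB0[of t] by (smt (verit) exp_ge_zero mult_nonneg_nonneg)
  then show "\<bar>exp_conv' s h t\<bar> \<le> s * exp_conv s h t"
    unfolding E' using s by (simp add: abs_mult)
qed

text \<open>Symmetry of the kernel together with Tonelli. The nonnegative integral is used because
  the integrability of \<open>w\<close> is still to be derived from this identity.\<close>

lemma nn_integral_exp_conv:
  fixes f g :: "real \<Rightarrow> real"
  assumes s: "s > 0" and f: "f \<in> borel_measurable borel" "\<And>t. 0 \<le> f t" "\<And>t. f t \<le> M"
    and g: "g \<in> borel_measurable borel" "\<And>t. 0 \<le> g t" "\<And>t. g t \<le> N"
  shows "(\<integral>\<^sup>+t. ennreal (exp_conv s f t * g t) \<partial>lborel) = (\<integral>\<^sup>+t. ennreal (f t * exp_conv s g t) \<partial>lborel)"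
proof -
  note [measurable] = f(1) g(1)
  have nn: "ennreal (exp_conv s h t) = (\<integral>\<^sup>+u. ennreal (exp (- s * \<bar>t - u\<bar>) * h u) \<partial>lborel)"
    if "h \<in> borel_measurable borel" "\<And>t. 0 \<le> h t" "\<And>t. h t \<le> M" for h M t
    unfolding exp_conv_def using that
    by (intro nn_integral_eq_integral[symmetric] integrable_exp_conv_kernel[OF s, where M = M]) (auto simp: abs_le_iff order_trans[OF _ that(2)] intro!: AE_I2)
  have "(\<integral>\<^sup>+t. ennreal (exp_conv s f t * g t) \<partial>lborel) =
      (\<integral>\<^sup>+t. (\<integral>\<^sup>+u. ennreal (exp (- s * \<bar>t - u\<bar>) * f u * g t) \<partial>lborel) \<partial>lborel)"
    using exp_conv_nonneg[of f s] f g
    by (intro nn_integral_cong) (simp add: ennreal_mult nn[OF f] nn_integral_multc)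
  also have "\<dots> = (\<integral>\<^sup>+u. (\<integral>\<^sup>+t. ennreal (exp (- s * \<bar>t - u\<bar>) * f u * g t) \<partial>lborel) \<partial>lborel)"
    by (rule lborel_pair.Fubini') measurable
  also have "\<dots> = (\<integral>\<^sup>+u. ennreal (f u * exp_conv s g u) \<partial>lborel)"
  proof (rule nn_integral_cong)
    fix u
    have "(\<integral>\<^sup>+t. ennreal (exp (- s * \<bar>t - u\<bar>) * f u * g t) \<partial>lborel) = (\<integral>\<^sup>+t. ennreal (f u) * ennreal (exp (- s * \<bar>u - t\<bar>) * g t) \<partial>lborel)"
      using f g by (intro nn_integral_cong) (simp add: ennreal_mult[symmetric] abs_minus_commute mult_ac)
    also have "\<dots> = ennreal (f u * exp_conv s g u)"
      using f(2) exp_conv_nonneg[of g s u] g by (simp add: nn_integral_cmult nn[OF g] ennreal_mult)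
    finally show "(\<integral>\<^sup>+t. ennreal (exp (- s * \<bar>t - u\<bar>) * f u * g t) \<partial>lborel) = ennreal (f u * exp_conv s g u)" .
  qed
  finally show ?thesis .
qed

section \<open>Pohozaev identities\<close>

lemma powr_diff_bound:
  fixes x y B p :: real
  assumes p: "1 < p" and x: "0 \<le> x" "x \<le> B" and y: "0 \<le> y" "y \<le> B"
  shows "\<bar>x powr p - y powr p\<bar> \<le> p * B powr (p - 1) * \<bar>x - y\<bar>"
proof -
  have less: "\<bar>x powr p - y powr p\<bar> \<le> p * B powr (p - 1) * \<bar>x - y\<bar>" if "0 \<le> x" "x < y" "y \<le> B" for x y
  proof -
    have "\<exists>l z. x < z \<and> z < y \<and> DERIV (\<lambda>x. x powr p) z :> l \<and> y powr p - x powr p = (y - x) * l"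
    proof (rule MVT[OF that(2)])
      show "continuous_on {x..y} (\<lambda>x. x powr p)"
        using that p by (intro continuous_on_powr' continuous_intros) auto
      fix z assume "x < z" "z < y"
      then show "(\<lambda>x. x powr p) differentiable (at z)"
        using that by (auto simp: real_differentiable_def intro!: exI derivative_eq_intros)
    qed
    then obtain l z where z: "x < z" "z < y" "DERIV (\<lambda>x. x powr p) z :> l" "y powr p - x powr p = (y - x) * l" by blast
    have "z > 0" using that z by linarith
    then have "DERIV (\<lambda>x. x powr p) z :> p * z powr (p - 1)" by (rule has_real_derivative_powr)
    then have l: "l = p * z powr (p - 1)" using z(3) DERIV_unique by blast
    have "z powr (p - 1) \<le> B powr (p - 1)" using z that p by (intro powr_mono2) auto
    then have "0 \<le> l" "l \<le> p * B powr (p - 1)" using p l by auto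
    then have "\<bar>y powr p - x powr p\<bar> \<le> (y - x) * (p * B powr (p - 1))"
      unfolding z(4) using that by (simp add: abs_mult mult_left_mono)
    then show ?thesis using that by (simp add: abs_minus_commute mult.commute)
  qed
  show ?thesis
    using less[of x y] less[of y x] x y by (cases x y rule: linorder_cases) (auto simp: abs_minus_commute)
qed

text \<open>Half of the decay of the kernel transports the weight from u to t, since \<epsilon>
  \<bar>t\<bar> \<le> \<epsilon> \<bar>t - u\<bar> + \<epsilon> \<bar>u\<bar> and \<epsilon> \<le> s
  / 2. The other half is a kernel of mass 4 / s. The constant does not depend on \<epsilon>, so
  \<epsilon> can tend to 0 afterwards.\<close>

lemma exp_conv_weight:
  fixes s \<epsilon> :: real
  assumes s: "0 < s" and e: "0 \<le> \<epsilon>" "\<epsilon> \<le> s / 2"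
  shows "exp_conv s (\<lambda>u. exp (- \<epsilon> * \<bar>u\<bar>)) t \<le> 4 / s * exp (- \<epsilon> * \<bar>t\<bar>)"
proof -
  have s2: "s / 2 > 0" using s by simp
  have "exp_conv s (\<lambda>u. exp (- \<epsilon> * \<bar>u\<bar>)) t \<le> (LBINT u. exp (- \<epsilon> * \<bar>t\<bar>) * exp (- (s/2) * \<bar>t - u\<bar>))"
    unfolding exp_conv_def
  proof (rule integral_mono)
    show "integrable lborel (\<lambda>u. exp (- s * \<bar>t - u\<bar>) * exp (- \<epsilon> * \<bar>u\<bar>))"
      using e by (intro integrable_exp_conv_kernel[OF s, where M = 1]) auto
    show "integrable lborel (\<lambda>u. exp (- \<epsilon> * \<bar>t\<bar>) * exp (- (s/2) * \<bar>t - u\<bar>))"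
      by (intro integrable_mult_right integrable_exp_shift s2)
    fix u
    have "\<epsilon> * \<bar>t\<bar> \<le> \<epsilon> * (\<bar>t - u\<bar> + \<bar>u\<bar>)" using e by (intro mult_left_mono) auto
    moreover have "\<epsilon> * \<bar>t - u\<bar> \<le> s / 2 * \<bar>t - u\<bar>" using e by (intro mult_right_mono) auto
    moreover have "- s * x + - \<epsilon> * y \<le> - \<epsilon> * z + - (s/2) * x"
      if "\<epsilon> * z \<le> \<epsilon> * (x + y)" "\<epsilon> * x \<le> s / 2 * x" for x y z
    proof -
      have "\<epsilon> * z \<le> \<epsilon> * x + \<epsilon> * y" using that(1) by (simp only: distrib_left)
      moreover have "s * x = s / 2 * x + s / 2 * x" by simp
      ultimately show ?thesis using that(2) unfolding mult_minus_left by linarith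
    qed
    ultimately have "- s * \<bar>t - u\<bar> + - \<epsilon> * \<bar>u\<bar> \<le> - \<epsilon> * \<bar>t\<bar> + - (s/2) * \<bar>t - u\<bar>" by blast
    then show "exp (- s * \<bar>t - u\<bar>) * exp (- \<epsilon> * \<bar>u\<bar>) \<le> exp (- \<epsilon> * \<bar>t\<bar>) * exp (- (s/2) * \<bar>t - u\<bar>)"
      unfolding exp_add[symmetric] exp_le_cancel_iff .
  qed
  also have "\<dots> = exp (- \<epsilon> * \<bar>t\<bar>) * (2 / (s / 2))"
    unfolding integral_mult_right_zero integrable_exp_shift(2)[OF s2] ..
  finally show ?thesis by (simp add: mult.commute)
qed

lemma bounded_of_limits:
  fixes w :: "real \<Rightarrow> real"
  assumes w: "continuous_on UNIV w" "(w \<longlongrightarrow> 0) at_top" "(w \<longlongrightarrow> 0) at_bot"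
  obtains B where "B > 0" "\<And>t. \<bar>w t\<bar> \<le> B"
proof -
  have "eventually (\<lambda>t. \<bar>w t\<bar> < 1) at_top" "eventually (\<lambda>t. \<bar>w t\<bar> < 1) at_bot"
    using tendstoD[OF w(2), of 1] tendstoD[OF w(3), of 1] by simp_all
  then obtain a b where ab: "\<And>t. t \<ge> a \<Longrightarrow> \<bar>w t\<bar> < 1" "\<And>t. t \<le> b \<Longrightarrow> \<bar>w t\<bar> < 1"
    by (auto simp: eventually_at_top_linorder eventually_at_bot_linorder)
  have "compact (w ` {b..a})" by (intro compact_continuous_image continuous_on_subset[OF w(1)]) auto
  then obtain B where "\<forall>x\<in>w ` {b..a}. norm x \<le> B"
    using compact_imp_bounded bounded_iff by metis
  then have B: "\<bar>w t\<bar> \<le> B" if "b \<le> t" "t \<le> a" for t using that by auto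
  show thesis
  proof (rule that[of "max 1 B"])
    show "\<bar>w t\<bar> \<le> max 1 B" for t
      using B[of t] ab[of t] by (cases "b \<le> t"; cases "t \<le> a") auto
  qed simp
qed

section \<open>Bounds and integrability for solutions given by the series\<close>

locale exp_sum_kernel =
  fixes c \<sigma> :: "nat \<Rightarrow> real"
  assumes c_pos: "\<And>j. 0 < c j" and \<sigma>0: "0 < \<sigma> 0" and \<sigma>_ge: "\<And>j. \<sigma> 0 \<le> \<sigma> j"
    and c_sum: "summable (\<lambda>j. c j / \<sigma> j)"
begin

lemma \<sigma>_pos: "0 < \<sigma> j" using \<sigma>0 \<sigma>_ge[of j] by linarith

end

text \<open>The nonlocal operator enters only through the series representation, so that the
  analysis of the solution concerns a family of second order equations coupled by
  \<open>w\<close>.\<close>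

locale exp_sum_solution = exp_sum_kernel +
  fixes p :: real and w :: "real \<Rightarrow> real"
  assumes p: "1 < p"
    and w_cont: "continuous_on UNIV w" and w_nonneg: "\<And>t. 0 \<le> w t"
    and w_top: "(w \<longlongrightarrow> 0) at_top" and w_bot: "(w \<longlongrightarrow> 0) at_bot"
    and rep: "\<And>t. (\<lambda>j. c j * exp_conv (\<sigma> j) (\<lambda>u. w u powr p) t) sums w t"
begin

definition h where "h t = w t powr p"
definition W where "W j = exp_conv (\<sigma> j) h"
definition W' where "W' j = exp_conv' (\<sigma> j) h"

lemma w_sums: "(\<lambda>j. c j * W j t) sums w t"
  using rep[of t] by (simp add: W_def h_def [abs_def])

lemma small_outside:
  assumes "e > 0"
  obtains T where "T > 0" "\<And>t. \<bar>t\<bar> \<ge> T \<Longrightarrow> w t < e"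
proof -
  obtain A B where "\<And>t. t \<ge> A \<Longrightarrow> w t < e" "\<And>t. t \<le> B \<Longrightarrow> w t < e"
    using order_tendstoD(2)[OF w_top assms] order_tendstoD(2)[OF w_bot assms]
    by (auto simp: eventually_at_top_linorder eventually_at_bot_linorder)
  then show thesis by (intro that[of "max 1 (max \<bar>A\<bar> \<bar>B\<bar>)"]) (auto simp: abs_if split: if_splits)
qed

lemma w_bounded: obtains B where "B > 0" "\<And>t. w t \<le> B"
  using bounded_of_limits[OF w_cont w_top w_bot] by (metis abs_le_D1)

lemma h_cont: "continuous_on UNIV h"
  unfolding h_def [abs_def] using w_nonneg p by (intro continuous_on_powr' w_cont continuous_intros) auto

lemma h_meas [measurable]: "h \<in> borel_measurable borel"
  and w_meas [measurable]: "w \<in> borel_measurable borel"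
  using h_cont w_cont by (auto intro: borel_measurable_continuous_onI)

lemma h_nonneg: "0 \<le> h t" by (simp add: h_def)

lemma h_bounded: obtains M where "M > 0" "\<And>t. h t \<le> M"
proof -
  obtain B where "B > 0" "\<And>t. w t \<le> B" using w_bounded by blast
  then show thesis using w_nonneg p by (intro that[of "B powr p"]) (auto simp: h_def intro!: powr_mono2)
qed

lemma W_nonneg: "0 \<le> W j t" unfolding W_def by (intro exp_conv_nonneg h_nonneg)

lemma W_bound: assumes "\<And>t. h t \<le> M" shows "\<sigma> j * W j t \<le> 2 * M"
  using exp_conv_bound[OF \<sigma>_pos[of j] h_meas, of M t] assms h_nonneg \<sigma>_pos[of j]
  by (auto simp: W_def field_simps abs_le_iff)

lemma W_deriv: "(W j has_real_derivative W' j t) (at t)"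
  and W'_deriv: "(W' j has_real_derivative (\<sigma> j)\<^sup>2 * W j t - 2 * \<sigma> j * h t) (at t)"
  and W'_bound: "\<bar>W' j t\<bar> \<le> \<sigma> j * W j t"
proof -
  obtain M where "M > 0" and M: "\<And>t. h t \<le> M" using h_bounded by blast
  note props = exp_conv_properties[OF \<sigma>_pos[of j] h_cont h_nonneg M, folded W_def W'_def]
  show "(W j has_real_derivative W' j t) (at t)" by (rule props)
  show "(W' j has_real_derivative (\<sigma> j)\<^sup>2 * W j t - 2 * \<sigma> j * h t) (at t)" by (rule props)
  show "\<bar>W' j t\<bar> \<le> \<sigma> j * W j t" by (rule props)
qed

lemma W_cont: "continuous_on S (W j)" and W'_cont: "continuous_on S (W' j)"
  by (rule DERIV_continuous_on, rule has_field_derivative_at_within, rule W_deriv)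
    (rule DERIV_continuous_on, rule has_field_derivative_at_within, rule W'_deriv)

lemma W_meas [measurable]: "W j \<in> borel_measurable borel" "W' j \<in> borel_measurable borel"
  using W_cont[of UNIV] W'_cont[of UNIV] by (auto intro: borel_measurable_continuous_onI)

text \<open>Absorption at infinity. Integrating the series bounds the integral of \<open>w\<close>
  by a multiple of that of \<open>h\<close>, and outside a compact set \<open>h\<close> is a small
  multiple of \<open>w\<close> because p > 1 and \<open>w\<close> tends to 0. To subtract, the
  integrals must be known to be finite; the weight \<open>exp (- \<epsilon> * \<bar>t\<bar>)\<close>
  guarantees this and is removed at the end.\<close>

lemma w_integrable: "integrable lborel w"
proof -
  define C where "C = 4 * (\<Sum>j. c j / \<sigma> j)"
  have C: "C > 0" unfolding C_def using c_sum c_pos \<sigma>_pos by (simp add: suminf_pos)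
  obtain B where B: "B > 0" "\<And>t. w t \<le> B" using w_bounded by blast
  obtain M where M: "M > 0" "\<And>t. h t \<le> M" using h_bounded by blast
  \<comment> \<open>Chosen so that w < e implies h \<le> w / (2 C); the factor C lost in the
    integrated series then leaves half of the integral of \<open>w\<close>, which is absorbed. The 4
    in \<open>C\<close> is the constant of \<open>exp_conv_weight\<close>.\<close>
  define e where "e = (1 / (2 * C)) powr (1 / (p - 1))"
  have e: "e > 0" "e powr (p - 1) = 1 / (2 * C)"
    using C p by (auto simp: e_def powr_powr)
  obtain T where T: "T > 0" "\<And>t. \<bar>t\<bar> \<ge> T \<Longrightarrow> w t < e" using small_outside[OF e(1)] by blast
  have h_le: "h t \<le> M * indicator {-T..T} t + 1 / (2 * C) * w t" for t
  proof (cases "\<bar>t\<bar> \<le> T")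
    case True
    then have "t \<in> {-T..T}" by auto
    then show ?thesis using M(2)[of t] C w_nonneg[of t] by (simp add: add_increasing2)
  next
    case False
    then have "t \<notin> {-T..T}" by auto
    moreover have "h t = w t powr (p - 1) * w t"
      using w_nonneg[of t] p by (cases "w t = 0") (auto simp: h_def powr_diff)
    moreover have "w t powr (p - 1) \<le> e powr (p - 1)"
      using T(2)[of t] False w_nonneg[of t] p by (intro powr_mono2) auto
    ultimately show ?thesis using mult_right_mono[OF _ w_nonneg[of t], of "w t powr (p - 1)" "1 / (2 * C)"] e(2) by simp
  qed
  \<comment> \<open>The bound is free of \<epsilon>; the restriction \<epsilon> \<le>
    \<open>\<sigma> 0 / 2\<close> makes the weight estimate valid for all j at once.\<close>
  have key: "(\<integral>\<^sup>+t. ennreal (w t * exp (- \<epsilon> * \<bar>t\<bar>)) \<partial>lborel) \<le> ennreal (4 * C * M * T)"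
    if \<epsilon>: "0 < \<epsilon>" "\<epsilon> \<le> \<sigma> 0 / 2" for \<epsilon>
  proof -
    let ?\<eta> = "\<lambda>t. exp (- \<epsilon> * \<bar>t\<bar>)"
    have \<eta>1: "?\<eta> t \<le> 1" for t using \<epsilon> by simp
    have i\<eta>: "integrable lborel ?\<eta>" by (rule fourier_exp_abs(1)[OF \<epsilon>(1)])
    have iw: "integrable lborel (\<lambda>t. w t * ?\<eta> t)"
      by (rule Bochner_Integration.integrable_bound[OF integrable_mult_right[OF i\<eta>, of B]])
        (use B w_nonneg in \<open>auto simp: abs_mult intro!: mult_right_mono\<close>)
    have ih: "integrable lborel (\<lambda>t. h t * ?\<eta> t)"
      by (rule Bochner_Integration.integrable_bound[OF integrable_mult_right[OF i\<eta>, of M]])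
        (use M h_nonneg in \<open>auto simp: abs_mult intro!: mult_right_mono\<close>)
    define I J where "I = (LBINT t. w t * ?\<eta> t)" and "J = (LBINT t. h t * ?\<eta> t)"
    have J0: "J \<ge> 0"
      unfolding J_def using h_nonneg by (auto intro!: integral_nonneg_AE)
    have nI: "(\<integral>\<^sup>+t. ennreal (w t * ?\<eta> t) \<partial>lborel) = ennreal I" unfolding I_def
      using w_nonneg by (intro nn_integral_eq_integral iw) auto
    have nJ: "(\<integral>\<^sup>+t. ennreal (h t * ?\<eta> t) \<partial>lborel) = ennreal J" unfolding J_def
      using h_nonneg by (intro nn_integral_eq_integral ih) auto
    have "ennreal I = (\<integral>\<^sup>+t. (\<Sum>j. ennreal (c j * (W j t * ?\<eta> t))) \<partial>lborel)"
      unfolding nI[symmetric]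
    proof (rule nn_integral_cong)
      fix t
      have "(\<lambda>j. c j * (W j t * ?\<eta> t)) sums (w t * ?\<eta> t)"
        using sums_mult2[OF w_sums[of t], of "?\<eta> t"] by (simp add: mult.assoc)
      then show "ennreal (w t * ?\<eta> t) = (\<Sum>j. ennreal (c j * (W j t * ?\<eta> t)))"
        using less_imp_le[OF c_pos] W_nonneg by (intro suminf_ennreal_eq[symmetric] mult_nonneg_nonneg) auto
    qed
    also have "\<dots> = (\<Sum>j. (\<integral>\<^sup>+t. ennreal (c j * (W j t * ?\<eta> t)) \<partial>lborel))"
      by (rule nn_integral_suminf) measurable
    also have "\<dots> \<le> (\<Sum>j. ennreal (c j / \<sigma> j * (4 * J)))"
    proof (intro suminf_le allI)
      fix j
      have "(\<integral>\<^sup>+t. ennreal (c j * (W j t * ?\<eta> t)) \<partial>lborel) = ennreal (c j) * (\<integral>\<^sup>+t. ennreal (exp_conv (\<sigma> j) h t * ?\<eta> t) \<partial>lborel)"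
        using c_pos[of j] W_nonneg by (simp add: ennreal_mult nn_integral_cmult W_def[symmetric])
      note 1 = this
      have "(\<integral>\<^sup>+t. ennreal (exp_conv (\<sigma> j) h t * ?\<eta> t) \<partial>lborel) = (\<integral>\<^sup>+t. ennreal (h t * exp_conv (\<sigma> j) ?\<eta> t) \<partial>lborel)"
        by (rule nn_integral_exp_conv[OF \<sigma>_pos h_meas h_nonneg M(2) _ _ \<eta>1]) auto
      also have "\<dots> \<le> (\<integral>\<^sup>+t. ennreal (4 / \<sigma> j) * ennreal (h t * ?\<eta> t) \<partial>lborel)"
      proof (rule nn_integral_mono)
        fix t
        have "\<epsilon> \<le> \<sigma> j / 2" using \<epsilon> \<sigma>_ge[of j] by simp
        then have "h t * exp_conv (\<sigma> j) ?\<eta> t \<le> h t * (4 / \<sigma> j * ?\<eta> t)"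
          using \<epsilon> \<sigma>_pos[of j] by (intro mult_left_mono exp_conv_weight h_nonneg) auto
        then show "ennreal (h t * exp_conv (\<sigma> j) ?\<eta> t) \<le> ennreal (4 / \<sigma> j) * ennreal (h t * ?\<eta> t)"
          using \<sigma>_pos[of j] h_nonneg[of t] by (subst ennreal_mult[symmetric]) (auto intro!: ennreal_leI simp: mult_ac)
      qed
      also have "\<dots> = ennreal (4 / \<sigma> j) * ennreal J" using nJ by (simp add: nn_integral_cmult)
      finally have "ennreal (c j) * (\<integral>\<^sup>+t. ennreal (exp_conv (\<sigma> j) h t * ?\<eta> t) \<partial>lborel) \<le> ennreal (c j) * (ennreal (4 / \<sigma> j) * ennreal J)"
        by (intro mult_left_mono) auto
      also have "\<dots> = ennreal (c j / \<sigma> j * (4 * J))"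
        using c_pos[of j] \<sigma>_pos[of j] J0 by (simp add: ennreal_mult[symmetric] mult_ac)
      finally show "(\<integral>\<^sup>+t. ennreal (c j * (W j t * ?\<eta> t)) \<partial>lborel) \<le> ennreal (c j / \<sigma> j * (4 * J))"
        unfolding 1 .
    qed auto
    also have "\<dots> = ennreal (C * J)"
    proof (rule suminf_ennreal_eq)
      show "(\<lambda>j. c j / \<sigma> j * (4 * J)) sums (C * J)"
        using sums_mult2[OF summable_sums[OF c_sum], of "4 * J"] by (simp add: C_def mult_ac)
      show "0 \<le> c j / \<sigma> j * (4 * J)" for j using c_pos[of j] \<sigma>_pos[of j] J0 by simp
    qed
    finally have IJ: "I \<le> C * J" using C J0 by (subst (asm) ennreal_le_iff) auto
    have i1: "integrable lborel (\<lambda>t. M * indicator {-T..T} t)"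
      by (intro integrable_mult_right integrable_real_indicator) (auto simp: emeasure_lborel_Icc_eq)
    have i2: "integrable lborel (\<lambda>t. 1 / (2 * C) * (w t * ?\<eta> t))"
      by (intro integrable_mult_right iw)
    have "J \<le> (LBINT t. M * indicator {-T..T} t + 1 / (2 * C) * (w t * ?\<eta> t))"
      unfolding J_def
    proof (rule integral_mono[OF ih])
      show "integrable lborel (\<lambda>t. M * indicator {-T..T} t + 1 / (2 * C) * (w t * ?\<eta> t))"
        by (intro Bochner_Integration.integrable_add i1 i2)
      fix t
      have "h t * ?\<eta> t \<le> (M * indicator {-T..T} t + 1 / (2 * C) * w t) * ?\<eta> t"
        by (intro mult_right_mono h_le) auto
      moreover have "M * indicator {-T..T} t * ?\<eta> t \<le> M * indicator {-T..T} t * 1"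
        using M \<eta>1 by (intro mult_left_mono) auto
      ultimately show "h t * ?\<eta> t \<le> M * indicator {-T..T} t + 1 / (2 * C) * (w t * ?\<eta> t)"
        by (simp only: distrib_right mult.assoc mult_1_right)
    qed
    also have "\<dots> = M * (2 * T) + 1 / (2 * C) * I"
      unfolding Bochner_Integration.integral_add[OF i1 i2] integral_mult_right_zero I_def using T by simp
    finally have "C * J \<le> C * (M * (2 * T) + 1 / (2 * C) * I)" using C by (intro mult_left_mono) auto
    then have "C * J \<le> 2 * C * M * T + I / 2" using C by (simp add: distrib_left mult_ac)
    with IJ have "I \<le> 4 * C * M * T" by linarith
    then show ?thesis unfolding nI by (intro ennreal_leI)
  qed
  \<comment> \<open>Decreasing to 0 within the admissible range, so that the weights increase to 1
    and monotone convergence applies.\<close>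
  define \<epsilon> where "\<epsilon> i = (\<sigma> 0 / 2) / (real i + 1)" for i
  have \<epsilon>: "0 < \<epsilon> i" "\<epsilon> i \<le> \<sigma> 0 / 2" for i
    using \<sigma>0 by (auto simp: \<epsilon>_def divide_simps)
  have "(\<lambda>i. \<integral>\<^sup>+t. ennreal (w t * exp (- \<epsilon> i * \<bar>t\<bar>)) \<partial>lborel) \<longlonglongrightarrow> (\<integral>\<^sup>+t. ennreal (w t) \<partial>lborel)"
  proof (rule nn_integral_LIMSEQ)
    show "incseq (\<lambda>i t. ennreal (w t * exp (- \<epsilon> i * \<bar>t\<bar>)))"
    proof (intro incseq_SucI le_funI ennreal_leI mult_left_mono w_nonneg)
      fix i t
      have "\<epsilon> (Suc i) \<le> \<epsilon> i" unfolding \<epsilon>_def using \<sigma>0 by (intro divide_left_mono) auto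
      then show "exp (- \<epsilon> i * \<bar>t\<bar>) \<le> exp (- \<epsilon> (Suc i) * \<bar>t\<bar>)" by (simp add: mult_right_mono)
    qed
    show "(\<lambda>i. ennreal (w t * exp (- \<epsilon> i * \<bar>t\<bar>))) \<longlonglongrightarrow> ennreal (w t)" for t
    proof (rule tendsto_ennrealI)
      have "\<epsilon> \<longlonglongrightarrow> 0" unfolding \<epsilon>_def by real_asymp
      then have "(\<lambda>i. w t * exp (- \<epsilon> i * \<bar>t\<bar>)) \<longlonglongrightarrow> w t * exp (- 0 * \<bar>t\<bar>)" by (intro tendsto_intros)
      then show "(\<lambda>i. w t * exp (- \<epsilon> i * \<bar>t\<bar>)) \<longlonglongrightarrow> w t" by simp
    qed
  qed measurable
  then have "(\<integral>\<^sup>+t. ennreal (w t) \<partial>lborel) \<le> ennreal (4 * C * M * T)"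
    using key[OF \<epsilon>] by (intro LIMSEQ_le_const2) auto
  then show ?thesis
    using w_nonneg by (intro integrableI_bounded) (auto simp: le_less_trans)
qed

lemma h_integrable: "integrable lborel h"
proof -
  obtain B where B: "B > 0" "\<And>t. w t \<le> B" using w_bounded by blast
  show ?thesis
  proof (rule Bochner_Integration.integrable_bound[OF integrable_mult_right[OF w_integrable, of "B powr (p - 1)"]])
    have "h t \<le> B powr (p - 1) * w t" for t
    proof -
      have "h t = w t powr (p - 1) * w t"
        using w_nonneg[of t] p by (cases "w t = 0") (auto simp: h_def powr_diff)
      also have "\<dots> \<le> B powr (p - 1) * w t"
        using B w_nonneg p by (intro mult_right_mono powr_mono2) auto
      finally show ?thesis .
    qed
    then show "AE t in lborel. norm (h t) \<le> norm (B powr (p - 1) * w t)"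
      using h_nonneg w_nonneg by (auto simp: abs_mult)
  qed auto
qed

lemma W_integral: "integrable lborel (W j)" "(LBINT t. W j t) = 2 / \<sigma> j * (LBINT t. h t)"
proof -
  obtain M where M: "M > 0" "\<And>t. h t \<le> M" using h_bounded by blast
  define J where "J = (LBINT t. h t)"
  have J: "0 \<le> J" unfolding J_def using h_nonneg by (auto intro!: integral_nonneg_AE)
  have one: "exp_conv s (\<lambda>_. 1) t = 2 / s" if "s > 0" for s t
    using integrable_exp_shift(2)[OF that, of t] by (simp add: exp_conv_def)
  have "(\<integral>\<^sup>+t. ennreal (exp_conv (\<sigma> j) h t * 1) \<partial>lborel) = (\<integral>\<^sup>+t. ennreal (h t * exp_conv (\<sigma> j) (\<lambda>_. 1) t) \<partial>lborel)"
    by (rule nn_integral_exp_conv[OF \<sigma>_pos h_meas h_nonneg M(2)]) auto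
  also have "\<dots> = (\<integral>\<^sup>+t. ennreal (2 / \<sigma> j * h t) \<partial>lborel)" by (simp add: one[OF \<sigma>_pos] mult.commute)
  also have "\<dots> = ennreal (LBINT t. 2 / \<sigma> j * h t)"
    using \<sigma>_pos[of j] h_nonneg by (intro nn_integral_eq_integral integrable_mult_right h_integrable) auto
  finally have nn: "(\<integral>\<^sup>+t. ennreal (W j t) \<partial>lborel) = ennreal (2 / \<sigma> j * J)"
    by (simp add: W_def J_def)
  show "integrable lborel (W j)"
    using W_nonneg nn by (intro integrableI_bounded) auto
  show "(LBINT t. W j t) = 2 / \<sigma> j * J"
    using W_nonneg nn J \<sigma>_pos[of j] by (intro integral_eq_nn_integral[THEN trans]) auto
qed

lemma W_sq_le: assumes "\<And>t. h t \<le> M" shows "(W j t)\<^sup>2 \<le> 2 * M / \<sigma> j * W j t"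
proof -
  have "W j t \<le> 2 * M / \<sigma> j" using W_bound[OF assms, of j t] \<sigma>_pos[of j] by (simp add: field_simps)
  then show ?thesis unfolding power2_eq_square using W_nonneg by (rule mult_right_mono)
qed

lemma W_sq_integrable: "integrable lborel (\<lambda>t. (W j t)\<^sup>2)"
  and W'_sq_integrable: "integrable lborel (\<lambda>t. (W' j t)\<^sup>2)"
proof -
  obtain M where M: "M > 0" "\<And>t. h t \<le> M" using h_bounded by blast
  show 1: "integrable lborel (\<lambda>t. (W j t)\<^sup>2)"
  proof (rule Bochner_Integration.integrable_bound[OF integrable_mult_right[OF W_integral(1)[of j], of "2 * M / \<sigma> j"]])
    show "AE t in lborel. norm ((W j t)\<^sup>2) \<le> norm (2 * M / \<sigma> j * W j t)"
      using order_trans[OF W_sq_le[OF M(2)] abs_ge_self] by (intro AE_I2) simp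
  qed auto
  show "integrable lborel (\<lambda>t. (W' j t)\<^sup>2)"
  proof (rule Bochner_Integration.integrable_bound[OF integrable_mult_right[OF 1, of "(\<sigma> j)\<^sup>2"]])
    have "\<bar>W' j t\<bar>\<^sup>2 \<le> (\<sigma> j * W j t)\<^sup>2" for t by (intro power_mono W'_bound) auto
    then show "AE t in lborel. norm ((W' j t)\<^sup>2) \<le> norm ((\<sigma> j)\<^sup>2 * (W j t)\<^sup>2)" by (simp add: power_mult_distrib)
  qed auto
qed

lemma W'_sq_le: "(W' j t)\<^sup>2 \<le> (\<sigma> j)\<^sup>2 * (W j t)\<^sup>2"
proof -
  have "\<bar>W' j t\<bar>\<^sup>2 \<le> (\<sigma> j * W j t)\<^sup>2" by (intro power_mono W'_bound) auto
  then show ?thesis by (simp add: power_mult_distrib)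
qed

text \<open>One factor of the square is bounded by 2 M / \<sigma> and the other has integral 2 /
  \<sigma> times that of \<open>h\<close>. Multiplied by \<sigma> c this is a multiple of c /
  \<sigma>, exactly the available summability.\<close>

lemma summable_W_sq: "summable (\<lambda>j. \<sigma> j * c j * (LBINT t. (W j t)\<^sup>2))"
  and summable_W'_sq: "summable (\<lambda>j. c j / \<sigma> j * (LBINT t. (W' j t)\<^sup>2))"
proof -
  obtain M where M: "M > 0" "\<And>t. h t \<le> M" using h_bounded by blast
  define J where "J = (LBINT t. h t)"
  have 1: "\<sigma> j * c j * (LBINT t. (W j t)\<^sup>2) \<le> 4 * M * J * (c j / \<sigma> j)" for j
  proof -
    have "(LBINT t. (W j t)\<^sup>2) \<le> (LBINT t. 2 * M / \<sigma> j * W j t)"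
      by (intro integral_mono W_sq_integrable integrable_mult_right W_integral W_sq_le M)
    also have "\<dots> = 4 * M * J / (\<sigma> j)\<^sup>2" by (simp add: W_integral J_def power2_eq_square)
    finally have "\<sigma> j * c j * (LBINT t. (W j t)\<^sup>2) \<le> \<sigma> j * c j * (4 * M * J / (\<sigma> j)\<^sup>2)"
      using c_pos[of j] \<sigma>_pos[of j] by (intro mult_left_mono) auto
    then show ?thesis using \<sigma>_pos[of j] by (simp add: power2_eq_square mult_ac)
  qed
  have n: "0 \<le> (LBINT t. (W j t)\<^sup>2)" "0 \<le> (LBINT t. (W' j t)\<^sup>2)" for j by (auto intro!: integral_nonneg_AE)
  show s: "summable (\<lambda>j. \<sigma> j * c j * (LBINT t. (W j t)\<^sup>2))"
    by (rule summable_comparison_test'[OF summable_mult[OF c_sum, of "4 * M * J"]])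
      (use 1 n c_pos \<sigma>_pos in \<open>auto simp: abs_mult less_imp_le\<close>)
  have 2: "c j / \<sigma> j * (LBINT t. (W' j t)\<^sup>2) \<le> \<sigma> j * c j * (LBINT t. (W j t)\<^sup>2)" for j
  proof -
    have "(LBINT t. (W' j t)\<^sup>2) \<le> (LBINT t. (\<sigma> j)\<^sup>2 * (W j t)\<^sup>2)"
      by (intro integral_mono W_sq_integrable W'_sq_integrable integrable_mult_right W'_sq_le)
    then have "c j / \<sigma> j * (LBINT t. (W' j t)\<^sup>2) \<le> c j / \<sigma> j * ((\<sigma> j)\<^sup>2 * (LBINT t. (W j t)\<^sup>2))"
      using c_pos[of j] \<sigma>_pos[of j] by (intro mult_left_mono) auto
    then show ?thesis using \<sigma>_pos[of j] by (simp add: power2_eq_square mult_ac)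
  qed
  show "summable (\<lambda>j. c j / \<sigma> j * (LBINT t. (W' j t)\<^sup>2))"
    by (rule summable_comparison_test'[OF s])
      (use 2 n c_pos \<sigma>_pos in \<open>auto simp: abs_mult abs_of_pos\<close>)
qed

end

section \<open>Lipschitz regularity and termwise differentiation\<close>

lemma abs_deriv_le_Lipschitz:
  fixes f :: "real \<Rightarrow> real"
  assumes f: "(f has_real_derivative D) (at t)" and L: "\<And>\<delta>. 0 < \<delta> \<Longrightarrow> \<bar>f (t + \<delta>) - f t\<bar> \<le> L * \<delta>"
  shows "\<bar>D\<bar> \<le> L"
proof -
  have "((\<lambda>\<delta>. (f (t + \<delta>) - f t) / \<delta>) \<longlongrightarrow> D) (at_right 0)"
    using f unfolding DERIV_def by (rule filterlim_mono[OF _ order_refl at_le]) auto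
  then have "((\<lambda>\<delta>. \<bar>(f (t + \<delta>) - f t) / \<delta>\<bar>) \<longlongrightarrow> \<bar>D\<bar>) (at_right 0)" by (rule tendsto_rabs)
  moreover have "eventually (\<lambda>\<delta>. \<bar>(f (t + \<delta>) - f t) / \<delta>\<bar> \<le> L) (at_right 0)"
    using eventually_at_right_less[of 0]
  proof eventually_elim
    case (elim \<delta>)
    then show ?case using L[of \<delta>] by (simp add: abs_divide pos_divide_le_eq)
  qed
  ultimately show ?thesis by (intro tendsto_upperbound) auto
qed

context exp_sum_solution
begin

lemma h_le_Lipschitz: obtains L where "L > 0" "\<And>x y. \<bar>h x - h y\<bar> \<le> L * \<bar>w x - w y\<bar>"
proof -
  obtain B where B: "B > 0" "\<And>t. w t \<le> B" using w_bounded by blast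
  show thesis
  proof (rule that[of "p * B powr (p - 1)"])
    show "\<bar>h x - h y\<bar> \<le> p * B powr (p - 1) * \<bar>w x - w y\<bar>" for x y
      unfolding h_def using p w_nonneg B by (intro powr_diff_bound) auto
  qed (use p B in simp)
qed

text \<open>Absorption: the tail of the series convolves \<open>h\<close> with a kernel of small mass, so its increments are
  at most half of the largest increment of \<open>w\<close>, while the finitely many remaining terms are Lipschitz.\<close>
lemma w_Lipschitz: obtains K where "K \<ge> 0" "\<And>t \<delta>. 0 < \<delta> \<Longrightarrow> \<bar>w (t + \<delta>) - w t\<bar> \<le> K * \<delta>"
proof -
  obtain B where B: "B > 0" "\<And>t. w t \<le> B" using w_bounded by blast
  obtain M where M: "M > 0" "\<And>t. h t \<le> M" using h_bounded by blast
  have habs: "\<bar>h t\<bar> \<le> M" for t using M h_nonneg[of t] by simp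
  obtain L where L: "L > 0" and hL: "\<And>x y. \<bar>h x - h y\<bar> \<le> L * \<bar>w x - w y\<bar>" using h_le_Lipschitz by blast
  have Lsum: "summable (\<lambda>j. 2 * L * (c j / \<sigma> j))" by (intro summable_mult c_sum)
  have "(\<lambda>n. \<Sum>j. 2 * L * (c (j + n) / \<sigma> (j + n))) \<longlonglongrightarrow> 0"
    using suminf_exist_split2[OF Lsum] by simp
  then have "eventually (\<lambda>n. (\<Sum>j. 2 * L * (c (j + n) / \<sigma> (j + n))) < 1/2) sequentially"
    by (rule order_tendstoD) simp
  then obtain N where N: "(\<Sum>j. 2 * L * (c (j + N) / \<sigma> (j + N))) < 1/2"
    by (auto simp: eventually_sequentially)
  define C where "C = 2 * M * (\<Sum>j<N. c j)"
  have C0: "C \<ge> 0" unfolding C_def using M c_pos by (intro mult_nonneg_nonneg sum_nonneg) (auto intro: less_imp_le)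
  have "\<bar>w (t + \<delta>) - w t\<bar> \<le> 2 * C * \<delta>" if \<delta>: "0 < \<delta>" for t \<delta>
  proof -
    \<comment> \<open>The largest increment for one fixed step. It is finite because
      \<open>w\<close> is bounded, and this finiteness is what permits subtracting half of
      it.\<close>
    define \<omega> where "\<omega> = (SUP t. \<bar>w (t + \<delta>) - w t\<bar>)"
    have bdd: "bdd_above (range (\<lambda>t. \<bar>w (t + \<delta>) - w t\<bar>))"
    proof (rule bdd_aboveI2)
      fix t show "\<bar>w (t + \<delta>) - w t\<bar> \<le> B"
        using B(2)[of t] B(2)[of "t + \<delta>"] w_nonneg[of t] w_nonneg[of "t + \<delta>"] by linarith
    qed
    have \<omega>: "\<bar>w (t + \<delta>) - w t\<bar> \<le> \<omega>" for t unfolding \<omega>_def by (rule cSUP_upper[OF _ bdd]) simp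
    have \<omega>0: "\<omega> \<ge> 0" using \<omega>[of 0] by linarith
    have near: "\<bar>W j (t + \<delta>) - W j t\<bar> \<le> 2 * M * \<delta>" for j t
    proof -
      obtain z where "W j (t + \<delta>) - W j t = (t + \<delta> - t) * W' j z"
        using MVT2[of t "t + \<delta>" "W j" "W' j"] W_deriv \<delta> by (metis less_add_same_cancel1)
      moreover have "\<bar>W' j z\<bar> \<le> 2 * M"
        using W'_bound[of j z] W_bound[OF M(2), of j z] by linarith
      ultimately show ?thesis using \<delta> by (simp add: abs_mult mult.commute)
    qed
    have far: "\<bar>W j (t + \<delta>) - W j t\<bar> \<le> 2 * (L * \<omega>) / \<sigma> j" for j t
      unfolding W_def
    proof (rule exp_conv_shift_diff[OF \<sigma>_pos h_meas habs])
      show "\<bar>h (t + \<delta>) - h t\<bar> \<le> L * \<omega>" for t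
        using order_trans[OF hL mult_left_mono[OF \<omega>]] L by simp
    qed
    have "\<bar>w (t + \<delta>) - w t\<bar> \<le> C * \<delta> + \<omega> / 2" for t
    proof -
      define b where "b j = (if j < N then c j * (2 * M * \<delta>) else 2 * L * (c j / \<sigma> j) * \<omega>)" for j
      have diff: "(\<lambda>j. c j * W j (t + \<delta>) - c j * W j t) sums (w (t + \<delta>) - w t)"
        by (intro sums_diff w_sums)
      have bnd: "\<bar>c j * W j (t + \<delta>) - c j * W j t\<bar> \<le> b j" for j
      proof -
        have "\<bar>c j * W j (t + \<delta>) - c j * W j t\<bar> = c j * \<bar>W j (t + \<delta>) - W j t\<bar>"
          using c_pos[of j] by (simp add: abs_mult right_diff_distrib[symmetric])
        also have "\<dots> \<le> b j"
          using mult_left_mono[OF near[of j t] less_imp_le[OF c_pos[of j]]] mult_left_mono[OF far[of j t] less_imp_le[OF c_pos[of j]]]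
          by (simp add: b_def mult_ac)
        finally show ?thesis .
      qed
      have sb': "summable (\<lambda>j. b (j + N))"
        using summable_mult2[OF summable_ignore_initial_segment[OF Lsum, of N], of \<omega>] by (simp add: b_def)
      then have sb: "summable b" by (rule summable_iff_shift[THEN iffD1])
      have "\<bar>w (t + \<delta>) - w t\<bar> \<le> suminf b"
      proof -
        have "norm (\<Sum>j. c j * W j (t + \<delta>) - c j * W j t) \<le> suminf b"
          by (rule norm_suminf_le[OF _ sb]) (use bnd in simp)
        then show ?thesis using diff by (simp add: sums_iff)
      qed
      also have "\<dots> = (\<Sum>j. b (j + N)) + (\<Sum>j<N. b j)" by (rule suminf_split_initial_segment[OF sb])
      also have "(\<Sum>j<N. b j) = C * \<delta>" by (simp add: b_def C_def sum_distrib_left sum_distrib_right mult_ac)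
      also have "(\<Sum>j. b (j + N)) = (\<Sum>j. 2 * L * (c (j + N) / \<sigma> (j + N))) * \<omega>"
        unfolding suminf_mult2[OF summable_ignore_initial_segment[OF Lsum, of N]] by (simp add: b_def)
      also have "\<dots> \<le> 1/2 * \<omega>" using N \<omega>0 by (intro mult_right_mono) auto
      finally show ?thesis by simp
    qed
    then have "\<omega> \<le> C * \<delta> + \<omega> / 2" unfolding \<omega>_def by (intro cSUP_least) auto
    then have "\<omega> \<le> 2 * C * \<delta>" by simp
    then show ?thesis using \<omega>[of t] by linarith
  qed
  then show thesis using C0 by (intro that[of "2 * C"]) auto
qed

text \<open>Now \<open>h\<close> is Lipschitz as well, and this passes through the convolution with
  the factor 2 / \<sigma>. The gain of 1 / \<sigma> over the bound by 2 M makes the sum of the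
  \<open>c j * W' j t\<close> converge uniformly.\<close>

lemma W'_bound_Lipschitz: obtains K where "K \<ge> 0" "\<And>j t. \<bar>W' j t\<bar> \<le> K / \<sigma> j"
proof -
  obtain K where K: "K \<ge> 0" "\<And>t \<delta>. 0 < \<delta> \<Longrightarrow> \<bar>w (t + \<delta>) - w t\<bar> \<le> K * \<delta>" using w_Lipschitz by blast
  obtain M where M: "M > 0" "\<And>t. h t \<le> M" using h_bounded by blast
  have habs: "\<bar>h t\<bar> \<le> M" for t using M h_nonneg[of t] by simp
  obtain L where L: "L > 0" and hL: "\<And>x y. \<bar>h x - h y\<bar> \<le> L * \<bar>w x - w y\<bar>" using h_le_Lipschitz by blast
  show thesis
  proof (rule that[of "2 * (L * K)"])
    show "2 * (L * K) \<ge> 0" using L K by simp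
    fix j t
    show "\<bar>W' j t\<bar> \<le> 2 * (L * K) / \<sigma> j"
    proof (rule abs_deriv_le_Lipschitz[OF W_deriv])
      fix \<delta> :: real assume \<delta>: "0 < \<delta>"
      have "\<bar>W j (t + \<delta>) - W j t\<bar> \<le> 2 * (L * (K * \<delta>)) / \<sigma> j"
        unfolding W_def
      proof (rule exp_conv_shift_diff[OF \<sigma>_pos h_meas habs])
        show "\<bar>h (t + \<delta>) - h t\<bar> \<le> L * (K * \<delta>)" for t
          using order_trans[OF hL mult_left_mono[OF K(2)[OF \<delta>]]] L by simp
      qed
      then show "\<bar>W j (t + \<delta>) - W j t\<bar> \<le> 2 * (L * K) / \<sigma> j * \<delta>" by (simp add: mult_ac)
    qed
  qed
qed

lemma w_deriv: "(w has_real_derivative (\<Sum>j. c j * W' j t)) (at t)"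
  and summable_W': "summable (\<lambda>j. c j * W' j t)"
proof -
  obtain K where K: "K \<ge> 0" "\<And>j t. \<bar>W' j t\<bar> \<le> K / \<sigma> j" using W'_bound_Lipschitz by blast
  have b: "norm (c j * W' j t) \<le> K * (c j / \<sigma> j)" for j t
    using mult_left_mono[OF K(2)[of j t], of "c j"] c_pos[of j] by (simp add: abs_mult mult_ac)
  show "summable (\<lambda>j. c j * W' j t)"
    by (rule summable_comparison_test'[OF summable_mult[OF c_sum, of K]]) (rule b)
  have "((\<lambda>t. \<Sum>j. c j * W j t) has_real_derivative (\<Sum>j. c j * W' j t)) (at t)"
  proof (rule has_field_derivative_series'(2)[of UNIV])
    show "((\<lambda>t. c j * W j t) has_real_derivative c j * W' j t) (at t within UNIV)" for j t
      by (intro DERIV_cmult W_deriv)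
    show "uniformly_convergent_on UNIV (\<lambda>n x. \<Sum>i<n. c i * W' i x)"
      by (rule Weierstrass_m_test'[OF _ summable_mult[OF c_sum, of K]]) (use b in auto)
    show "summable (\<lambda>j. c j * W j 0)" using w_sums[of 0] by (rule sums_summable)
  qed auto
  then show "(w has_real_derivative (\<Sum>j. c j * W' j t)) (at t)"
    using w_sums by (simp add: sums_iff)
qed

text \<open>The chain rule for \<open>powr\<close> requires a positive base. At a zero of
  \<open>w\<close> the Lipschitz bound gives w^(p+1) = O(\<bar>\<delta>\<bar>^(p+1)), so the
  derivative is 0, in agreement with \<open>h t = 0\<close>.\<close>

lemma w_power_deriv: "((\<lambda>t. w t powr (p + 1)) has_real_derivative (p + 1) * h t * (\<Sum>j. c j * W' j t)) (at t)"
proof (cases "w t = 0")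
  case False
  then have "w t > 0" using w_nonneg[of t] by simp
  then have "((\<lambda>t. w t powr (p + 1)) has_real_derivative (p + 1) * w t powr (p + 1 - 1) * (\<Sum>j. c j * W' j t)) (at t)"
    by (intro DERIV_chain2[where f = "\<lambda>x. x powr (p + 1)"] has_real_derivative_powr w_deriv)
  then show ?thesis by (simp add: h_def)
next
  case True
  obtain K where K: "K \<ge> 0" "\<And>t \<delta>. 0 < \<delta> \<Longrightarrow> \<bar>w (t + \<delta>) - w t\<bar> \<le> K * \<delta>" using w_Lipschitz by blast
  have K': "w (t + \<delta>) \<le> K * \<bar>\<delta>\<bar>" for \<delta>
  proof (cases "\<delta> = 0")
    case False
    then show ?thesis using K(2)[of \<delta> t] K(2)[of "-\<delta>" "t + \<delta>"] True w_nonneg[of "t + \<delta>"]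
      by (cases "\<delta> > 0") auto
  qed (simp add: True)
  have "((\<lambda>\<delta>. (w (t + \<delta>) powr (p + 1) - w t powr (p + 1)) / \<delta>) \<longlongrightarrow> 0) (at 0)"
  proof (rule Lim_null_comparison)
    show "eventually (\<lambda>\<delta>. norm ((w (t + \<delta>) powr (p + 1) - w t powr (p + 1)) / \<delta>) \<le> K powr (p + 1) * \<bar>\<delta>\<bar> powr p) (at 0)"
      unfolding eventually_at_filter
    proof (intro always_eventually allI impI)
      fix \<delta> :: real assume \<delta>: "\<delta> \<noteq> 0"
      have "w (t + \<delta>) powr (p + 1) \<le> (K * \<bar>\<delta>\<bar>) powr (p + 1)"
        using K' w_nonneg p by (intro powr_mono2) auto
      also have "\<dots> = K powr (p + 1) * \<bar>\<delta>\<bar> powr p * \<bar>\<delta>\<bar>"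
        using \<delta> K by (simp add: powr_mult powr_add)
      finally have "w (t + \<delta>) powr (p + 1) / \<bar>\<delta>\<bar> \<le> K powr (p + 1) * \<bar>\<delta>\<bar> powr p"
        using \<delta> by (simp add: pos_divide_le_eq)
      then show "norm ((w (t + \<delta>) powr (p + 1) - w t powr (p + 1)) / \<delta>) \<le> K powr (p + 1) * \<bar>\<delta>\<bar> powr p"
        using True p by simp
    qed
    have "((\<lambda>\<delta>::real. \<bar>\<delta>\<bar> powr p) \<longlongrightarrow> \<bar>0\<bar> powr p) (at 0)"
      using p by (intro tendsto_powr' tendsto_intros) auto
    then show "((\<lambda>\<delta>. K powr (p + 1) * \<bar>\<delta>\<bar> powr p) \<longlongrightarrow> 0) (at 0)"
      using p by (auto intro: tendsto_mult_right_zero)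
  qed
  then show ?thesis unfolding DERIV_def using True p by (simp add: h_def)
qed

section \<open>The conserved quantity and the energy identity\<close>

text \<open>The summed derivatives are - 4 h w', the opposite of the derivative of the power term.
  The constant is 0 because both quadratic terms lie between 0 and
  \<open>2 * M * (c j * W j t)\<close>: the whole series is at most 2 M w in absolute value and
  vanishes at infinity, with no separate decay estimate for the components.\<close>

lemma hamiltonian:
  shows "summable (\<lambda>j. c j / \<sigma> j * (W' j t)\<^sup>2)" "summable (\<lambda>j. \<sigma> j * c j * (W j t)\<^sup>2)"
    and "(\<Sum>j. c j / \<sigma> j * (W' j t)\<^sup>2) - (\<Sum>j. \<sigma> j * c j * (W j t)\<^sup>2) + 4 / (p + 1) * w t powr (p + 1) = 0"
proof -
  obtain M where M: "M > 0" "\<And>t. h t \<le> M" using h_bounded by blast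
  obtain K where K: "K \<ge> 0" "\<And>j t. \<bar>W' j t\<bar> \<le> K / \<sigma> j" using W'_bound_Lipschitz by blast
  have b1: "0 \<le> \<sigma> j * c j * (W j t)\<^sup>2" "\<sigma> j * c j * (W j t)\<^sup>2 \<le> 2 * M * (c j * W j t)" for j t
  proof -
    show "0 \<le> \<sigma> j * c j * (W j t)\<^sup>2" using c_pos[of j] \<sigma>_pos[of j] by simp
    have "c j * W j t * (\<sigma> j * W j t) \<le> c j * W j t * (2 * M)"
      using c_pos[of j] W_nonneg[of j t] by (intro mult_left_mono W_bound M) simp
    then show "\<sigma> j * c j * (W j t)\<^sup>2 \<le> 2 * M * (c j * W j t)" by (simp add: power2_eq_square mult_ac)
  qed
  have b2: "0 \<le> c j / \<sigma> j * (W' j t)\<^sup>2" "c j / \<sigma> j * (W' j t)\<^sup>2 \<le> \<sigma> j * c j * (W j t)\<^sup>2" for j t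
  proof -
    show "0 \<le> c j / \<sigma> j * (W' j t)\<^sup>2" using c_pos[of j] \<sigma>_pos[of j] by simp
    have "c j / \<sigma> j * (W' j t)\<^sup>2 \<le> c j / \<sigma> j * ((\<sigma> j)\<^sup>2 * (W j t)\<^sup>2)"
      using c_pos[of j] \<sigma>_pos[of j] by (intro mult_left_mono W'_sq_le) simp
    then show "c j / \<sigma> j * (W' j t)\<^sup>2 \<le> \<sigma> j * c j * (W j t)\<^sup>2"
      using \<sigma>_pos[of j] by (simp add: power2_eq_square mult_ac)
  qed
  have s0: "summable (\<lambda>j. 2 * M * (c j * W j t))" for t
    using w_sums[of t] by (intro summable_mult) (rule sums_summable)
  show s1: "summable (\<lambda>j. \<sigma> j * c j * (W j t)\<^sup>2)" for t
    by (rule summable_comparison_test'[OF s0[of t]]) (use b1 in simp)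
  show s2: "summable (\<lambda>j. c j / \<sigma> j * (W' j t)\<^sup>2)" for t
    by (rule summable_comparison_test'[OF s1[of t]]) (use b2 c_pos \<sigma>_pos in \<open>simp add: abs_mult abs_of_pos\<close>)
  define f where "f j t = c j / \<sigma> j * (W' j t)\<^sup>2 - \<sigma> j * c j * (W j t)\<^sup>2" for j t
  have sf: "summable (\<lambda>j. f j t)" for t unfolding f_def by (intro summable_diff s1 s2)
  have fabs: "\<bar>f j t\<bar> \<le> 2 * M * (c j * W j t)" for j t
    using b1[of j t] b2[of j t] unfolding f_def by linarith
  \<comment> \<open>With W'' = \<sigma>^2 W - 2 \<sigma> h the two products 2 c \<sigma> W W'
    cancel, and only the coupling to \<open>h\<close> is left.\<close>
  have df: "(f j has_real_derivative - 4 * h t * (c j * W' j t)) (at t)" for j t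
  proof -
    have "(f j has_real_derivative
       c j / \<sigma> j * (2 * W' j t * ((\<sigma> j)\<^sup>2 * W j t - 2 * \<sigma> j * h t)) - \<sigma> j * c j * (2 * W j t * W' j t)) (at t)"
      unfolding f_def [abs_def]
      by (auto intro!: derivative_eq_intros W_deriv W'_deriv simp: less_imp_neq[OF \<sigma>_pos, symmetric])
    also have "c j / \<sigma> j * (2 * W' j t * ((\<sigma> j)\<^sup>2 * W j t - 2 * \<sigma> j * h t)) - \<sigma> j * c j * (2 * W j t * W' j t) =
       - 4 * h t * (c j * W' j t)"
      using less_imp_neq[OF \<sigma>_pos[of j], symmetric] by (simp add: field_simps power2_eq_square)
    finally show ?thesis .
  qed
  have d1: "((\<lambda>t. \<Sum>j. f j t) has_real_derivative (\<Sum>j. - 4 * h t * (c j * W' j t))) (at t)" for t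
  proof (rule has_field_derivative_series'(2)[of UNIV])
    show "uniformly_convergent_on UNIV (\<lambda>n x. \<Sum>i<n. - 4 * h x * (c i * W' i x))"
    proof (rule Weierstrass_m_test'[OF _ summable_mult[OF c_sum, of "4 * M * K"]])
      show "norm (- 4 * h x * (c i * W' i x)) \<le> 4 * M * K * (c i / \<sigma> i)" for i x
      proof -
        have "norm (- 4 * h x * (c i * W' i x)) = 4 * h x * (c i * \<bar>W' i x\<bar>)"
          using h_nonneg[of x] c_pos[of i] by (simp add: abs_mult)
        also have "\<dots> \<le> 4 * M * (c i * (K / \<sigma> i))"
          using h_nonneg[of x] c_pos[of i] M K by (intro mult_mono mult_left_mono mult_nonneg_nonneg) auto
        finally show ?thesis by (simp add: mult_ac)
      qed
    qed
    show "(f j has_real_derivative - 4 * h t * (c j * W' j t)) (at t within UNIV)" for j t using df by simp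
    show "summable (\<lambda>j. f j 0)" by (rule sf)
  qed auto
  define H where "H t = (\<Sum>j. f j t) + 4 / (p + 1) * w t powr (p + 1)" for t
  have dH: "(H has_real_derivative 0) (at t)" for t
  proof -
    have "(H has_real_derivative (\<Sum>j. - 4 * h t * (c j * W' j t)) + 4 / (p + 1) * ((p + 1) * h t * (\<Sum>j. c j * W' j t))) (at t)"
      unfolding H_def [abs_def] by (intro DERIV_add d1 DERIV_cmult w_power_deriv)
    also have "(\<Sum>j. - 4 * h t * (c j * W' j t)) = - 4 * h t * (\<Sum>j. c j * W' j t)"
      by (rule suminf_mult[OF summable_W'])
    also have "- 4 * h t * (\<Sum>j. c j * W' j t) + 4 / (p + 1) * ((p + 1) * h t * (\<Sum>j. c j * W' j t)) = 0"
      using p by simp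
    finally show ?thesis .
  qed
  have Hconst: "H x = H 0" for x
    by (rule DERIV_isconst_all) (use dH in blast)
  have "(H \<longlongrightarrow> 0) at_top"
  proof (rule Lim_null_comparison)
    show "((\<lambda>t. 2 * M * w t + 4 / (p + 1) * w t powr (p + 1)) \<longlongrightarrow> 0) at_top"
    proof -
      have "((\<lambda>t. w t powr (p + 1)) \<longlongrightarrow> 0 powr (p + 1)) at_top"
        using p w_nonneg by (intro tendsto_powr' w_top tendsto_const) auto
      from tendsto_add[OF tendsto_mult_left[OF w_top, of "2 * M"] tendsto_mult_left[OF this, of "4 / (p + 1)"]]
      show ?thesis using p by simp
    qed
    have "norm (H t) \<le> 2 * M * w t + 4 / (p + 1) * w t powr (p + 1)" for t
    proof -
      have "norm (\<Sum>j. f j t) \<le> (\<Sum>j. 2 * M * (c j * W j t))"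
        by (rule norm_suminf_le[OF _ s0]) (use fabs in simp)
      also have "\<dots> = 2 * M * w t" using sums_mult[OF w_sums[of t], of "2 * M"] by (simp add: sums_iff)
      finally have "\<bar>\<Sum>j. f j t\<bar> \<le> 2 * M * w t" by simp
      moreover have "0 \<le> 4 / (p + 1) * w t powr (p + 1)" using p by simp
      ultimately show ?thesis unfolding H_def by (simp add: abs_le_iff)
    qed
    then show "eventually (\<lambda>t. norm (H t) \<le> 2 * M * w t + 4 / (p + 1) * w t powr (p + 1)) at_top" by simp
  qed
  moreover have "H = (\<lambda>_. H 0)" using Hconst by blast
  ultimately have "H 0 = 0" by (metis tendsto_const_iff trivial_limit_at_top_linorder)
  then have "H t = 0" using Hconst by simp
  then show "(\<Sum>j. c j / \<sigma> j * (W' j t)\<^sup>2) - (\<Sum>j. \<sigma> j * c j * (W j t)\<^sup>2) + 4 / (p + 1) * w t powr (p + 1) = 0"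
    unfolding H_def f_def suminf_diff[OF s2 s1] .
qed

text \<open>The derivative of W W' is W'^2 + \<sigma>^2 W^2 - 2 \<sigma> h W; it is integrable and W
  W' vanishes at both ends.\<close>

lemma W_energy: "(LBINT t. (W' j t)\<^sup>2) + (\<sigma> j)\<^sup>2 * (LBINT t. (W j t)\<^sup>2) = 2 * \<sigma> j * (LBINT t. h t * W j t)"
  and hW_integrable: "integrable lborel (\<lambda>t. h t * W j t)"
proof -
  obtain M where M: "M > 0" "\<And>t. h t \<le> M" using h_bounded by blast
  show ihW: "integrable lborel (\<lambda>t. h t * W j t)"
    by (rule Bochner_Integration.integrable_bound[OF integrable_mult_right[OF W_integral(1)[of j], of M]])
      (use M h_nonneg W_nonneg in \<open>auto simp: abs_mult intro!: mult_right_mono AE_I2\<close>)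
  let ?g = "\<lambda>t. (W' j t)\<^sup>2 + ((\<sigma> j)\<^sup>2 * (W j t)\<^sup>2 - 2 * \<sigma> j * (h t * W j t))"
  have ig: "integrable lborel ?g"
    by (intro Bochner_Integration.integrable_add Bochner_Integration.integrable_diff integrable_mult_right
        W_sq_integrable W'_sq_integrable ihW)
  \<comment> \<open>All summands of the series for \<open>w\<close> are nonnegative, so
    \<open>c j * W j t\<close> is at most \<open>w t\<close>: the components inherit the decay of
    \<open>w\<close>.\<close>
  have lim: "((\<lambda>t. W j t * W' j t) \<longlongrightarrow> 0) F" if "(w \<longlongrightarrow> 0) F" for F
  proof (rule Lim_null_comparison)
    have "norm (W j t * W' j t) \<le> 2 * M / c j * w t" for t
    proof -
      have "c j * W j t = (\<Sum>i\<in>{j}. c i * W i t)" by simp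
      also have "\<dots> \<le> (\<Sum>i. c i * W i t)"
        by (rule sum_le_suminf) (use w_sums[of t] c_pos W_nonneg in \<open>auto simp: sums_iff less_imp_le\<close>)
      also have "\<dots> = w t" using w_sums[of t] by (simp add: sums_iff)
      finally have 1: "W j t \<le> w t / c j" using c_pos[of j] by (simp add: field_simps)
      have "\<bar>W' j t\<bar> \<le> 2 * M" using W'_bound[of j t] W_bound[OF M(2), of j t] by linarith
      then have "W j t * \<bar>W' j t\<bar> \<le> w t / c j * (2 * M)"
        using 1 W_nonneg[of j t] w_nonneg[of t] c_pos[of j] by (intro mult_mono) auto
      then show ?thesis using W_nonneg[of j t] by (simp add: abs_mult mult_ac)
    qed
    then show "eventually (\<lambda>t. norm (W j t * W' j t) \<le> 2 * M / c j * w t) F" by simp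
    show "((\<lambda>t. 2 * M / c j * w t) \<longlongrightarrow> 0) F" using tendsto_mult_left[OF that, of "2 * M / c j"] by simp
  qed
  have "(LBINT t=-\<infinity>..\<infinity>. ?g t) = 0 - 0"
  proof (rule interval_integral_FTC_integrable[where F = "\<lambda>t. W j t * W' j t"])
    fix t
    have "((\<lambda>t. W j t * W' j t) has_real_derivative W' j t * W' j t + ((\<sigma> j)\<^sup>2 * W j t - 2 * \<sigma> j * h t) * W j t) (at t)"
      by (rule DERIV_mult[OF W_deriv W'_deriv])
    then show "((\<lambda>t. W j t * W' j t) has_vector_derivative ?g t) (at t)"
      by (simp add: has_real_derivative_iff_has_vector_derivative power2_eq_square algebra_simps)
    have "continuous_on UNIV ?g"
      by (intro continuous_intros W_cont W'_cont h_cont)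
    then show "isCont ?g t" by (simp add: continuous_on_eq_continuous_at)
  next
    show "set_integrable lborel (einterval (-\<infinity>) \<infinity>) ?g" using ig by (simp add: set_integrable_def)
    show "(((\<lambda>t. W j t * W' j t) \<circ> real_of_ereal) \<longlongrightarrow> 0) (at_right (-\<infinity>))"
      unfolding ereal_tendsto_simps1 by (rule lim[OF w_bot])
    show "(((\<lambda>t. W j t * W' j t) \<circ> real_of_ereal) \<longlongrightarrow> 0) (at_left \<infinity>)"
      unfolding ereal_tendsto_simps1 by (rule lim[OF w_top])
  qed auto
  then have "(LBINT t. ?g t) = 0"
    by (simp add: interval_lebesgue_integral_def set_lebesgue_integral_def)
  then show "(LBINT t. (W' j t)\<^sup>2) + (\<sigma> j)\<^sup>2 * (LBINT t. (W j t)\<^sup>2) = 2 * \<sigma> j * (LBINT t. h t * W j t)"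
    by (simp add: W_sq_integrable W'_sq_integrable ihW)
qed

text \<open>The first relation sums the energy identities, the second integrates the vanishing
  conserved quantity. Sums and integrals may be exchanged because the terms are nonnegative with
  summable integrals.\<close>

theorem pohozaev:
  defines "A \<equiv> (\<Sum>j. c j / \<sigma> j * (LBINT t. (W' j t)\<^sup>2))"
    and "B \<equiv> (\<Sum>j. \<sigma> j * c j * (LBINT t. (W j t)\<^sup>2))"
    and "I \<equiv> (LBINT t. w t powr (p + 1))"
  shows "integrable lborel (\<lambda>t. w t powr (p + 1))"
    and "A + B = 2 * I" and "A - B + 4 / (p + 1) * I = 0"
proof -
  have hw: "w t powr (p + 1) = h t * w t" for t
    using w_nonneg[of t] p by (cases "w t = 0") (auto simp: h_def powr_add)
  obtain C where C: "C > 0" "\<And>t. w t \<le> C" using w_bounded by blast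
  show iI: "integrable lborel (\<lambda>t. w t powr (p + 1))"
    unfolding hw
    by (rule Bochner_Integration.integrable_bound[OF integrable_mult_right[OF h_integrable, of C]])
      (use C h_nonneg w_nonneg in \<open>auto simp: abs_mult mult.commute[of C] intro!: mult_left_mono AE_I2\<close>)
  have cs: "0 \<le> c j / \<sigma> j" "0 \<le> \<sigma> j * c j" for j using c_pos[of j] \<sigma>_pos[of j] by auto
  have sumA: "(LBINT t. (\<Sum>j. c j / \<sigma> j * (W' j t)\<^sup>2)) = A" "integrable lborel (\<lambda>t. \<Sum>j. c j / \<sigma> j * (W' j t)\<^sup>2)"
  proof -
    have i: "integrable lborel (\<lambda>t. c j / \<sigma> j * (W' j t)\<^sup>2)" for j by (intro integrable_mult_right W'_sq_integrable)
    have s: "AE t in lborel. summable (\<lambda>j. norm (c j / \<sigma> j * (W' j t)\<^sup>2))"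
      using hamiltonian(1) by (simp add: abs_mult abs_of_pos[OF c_pos] abs_of_pos[OF \<sigma>_pos])
    have s': "summable (\<lambda>j. LBINT t. norm (c j / \<sigma> j * (W' j t)\<^sup>2))"
      using summable_W'_sq by (simp add: abs_mult abs_of_pos[OF c_pos] abs_of_pos[OF \<sigma>_pos])
    show "(LBINT t. (\<Sum>j. c j / \<sigma> j * (W' j t)\<^sup>2)) = A"
      unfolding A_def using integral_suminf[OF i s s'] by simp
    show "integrable lborel (\<lambda>t. \<Sum>j. c j / \<sigma> j * (W' j t)\<^sup>2)" by (rule integrable_suminf[OF i s s'])
  qed
  have sumB: "(LBINT t. (\<Sum>j. \<sigma> j * c j * (W j t)\<^sup>2)) = B" "integrable lborel (\<lambda>t. \<Sum>j. \<sigma> j * c j * (W j t)\<^sup>2)"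
  proof -
    have i: "integrable lborel (\<lambda>t. \<sigma> j * c j * (W j t)\<^sup>2)" for j by (intro integrable_mult_right W_sq_integrable)
    have s: "AE t in lborel. summable (\<lambda>j. norm (\<sigma> j * c j * (W j t)\<^sup>2))"
      using hamiltonian(2) cs(2) by (simp add: abs_mult abs_of_pos[OF c_pos] abs_of_pos[OF \<sigma>_pos])
    have s': "summable (\<lambda>j. LBINT t. norm (\<sigma> j * c j * (W j t)\<^sup>2))"
      using summable_W_sq cs(2) by (simp add: abs_mult abs_of_pos[OF c_pos] abs_of_pos[OF \<sigma>_pos])
    show "(LBINT t. (\<Sum>j. \<sigma> j * c j * (W j t)\<^sup>2)) = B"
      unfolding B_def using integral_suminf[OF i s s'] by simp
    show "integrable lborel (\<lambda>t. \<Sum>j. \<sigma> j * c j * (W j t)\<^sup>2)" by (rule integrable_suminf[OF i s s'])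
  qed
  have "0 = (LBINT t. (\<Sum>j. c j / \<sigma> j * (W' j t)\<^sup>2) - (\<Sum>j. \<sigma> j * c j * (W j t)\<^sup>2) + 4 / (p + 1) * w t powr (p + 1))"
    unfolding hamiltonian(3) by simp
  also have "\<dots> = A - B + 4 / (p + 1) * I"
    using sumA sumB iI by (simp add: I_def)
  finally show "A - B + 4 / (p + 1) * I = 0" by simp
  \<comment> \<open>The energy identity multiplied by c / \<sigma>, the factor that produces the
    weights of both \<open>A\<close> and \<open>B\<close>.\<close>
  have e: "c j / \<sigma> j * (LBINT t. (W' j t)\<^sup>2) + \<sigma> j * c j * (LBINT t. (W j t)\<^sup>2) = 2 * (c j * (LBINT t. h t * W j t))" for j
  proof -
    have "c j / \<sigma> j * (2 * \<sigma> j * (LBINT t. h t * W j t)) = 2 * (c j * (LBINT t. h t * W j t))"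
      using \<sigma>_pos[of j] by simp
    then show ?thesis unfolding W_energy[symmetric] using \<sigma>_pos[of j] by (simp add: distrib_left power2_eq_square mult_ac)
  qed
  have iI': "(LBINT t. (\<Sum>j. c j * (h t * W j t))) = (\<Sum>j. c j * (LBINT t. h t * W j t))"
    and sI: "summable (\<lambda>j. c j * (LBINT t. h t * W j t))"
  proof -
    have nn: "0 \<le> c j * (h t * W j t)" for j t using c_pos[of j] h_nonneg[of t] W_nonneg[of j t] by simp
    have "summable (\<lambda>j. 2 * (c j * (LBINT t. h t * W j t)))"
      unfolding e[symmetric] by (intro summable_add summable_W_sq summable_W'_sq)
    then show s: "summable (\<lambda>j. c j * (LBINT t. h t * W j t))" by simp
    have i: "integrable lborel (\<lambda>t. c j * (h t * W j t))" for j by (intro integrable_mult_right hW_integrable)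
    have "summable (\<lambda>j. h t * (c j * W j t))" for t using w_sums[of t] by (intro summable_mult) (rule sums_summable)
    then have "AE t in lborel. summable (\<lambda>j. norm (c j * (h t * W j t)))" using nn by (simp add: mult_ac)
    from integral_suminf[OF i this] show "(LBINT t. (\<Sum>j. c j * (h t * W j t))) = (\<Sum>j. c j * (LBINT t. h t * W j t))"
      using nn s by simp
  qed
  have "(\<Sum>j. c j * (h t * W j t)) = w t powr (p + 1)" for t
    using sums_mult[OF w_sums[of t], of "h t"] unfolding hw by (simp add: sums_iff mult_ac)
  then have "I = (\<Sum>j. c j * (LBINT t. h t * W j t))" using iI' by (simp add: I_def)
  then have "2 * I = (\<Sum>j. 2 * (c j * (LBINT t. h t * W j t)))" by (simp add: suminf_mult[OF sI])
  also have "\<dots> = A + B"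
    unfolding e[symmetric] A_def B_def by (rule suminf_add[OF summable_W'_sq summable_W_sq, symmetric])
  finally show "A + B = 2 * I" by simp
qed

end

section \<open>Representation by the Green function\<close>

lemma power_le_fact_exp:
  fixes x :: real
  assumes "0 \<le> x"
  shows "x ^ n \<le> fact n * exp x"
proof -
  have "x ^ n /\<^sub>R fact n = (\<Sum>k\<in>{n}. x ^ k /\<^sub>R fact k)" by simp
  also have "\<dots> \<le> (\<Sum>k. x ^ k /\<^sub>R fact k)"
    by (rule sum_le_suminf[OF summable_exp_generic]) (use assms in auto)
  also have "\<dots> = exp x" by (simp add: exp_def)
  finally show ?thesis by (simp add: field_simps)
qed

lemma std_normal_fourier:
  shows "integrable lborel (\<lambda>x. exp (\<i> * of_real (t * x)) * complex_of_real (exp (- x\<^sup>2 / 2)))"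
    and "(LBINT x. exp (\<i> * of_real (t * x)) * complex_of_real (exp (- x\<^sup>2 / 2))) = of_real (sqrt (2 * pi) * exp (- t\<^sup>2 / 2))"
proof -
  have g: "integrable lborel (\<lambda>x. exp (- x\<^sup>2 / 2) :: real)"
    using integrable_mult_right[OF integrable_normal_moment[of 1 0 0], of "sqrt (2 * pi)"]
    by (simp add: std_normal_density_def)
  show "integrable lborel (\<lambda>x. exp (\<i> * of_real (t * x)) * complex_of_real (exp (- x\<^sup>2 / 2)))"
    by (rule Bochner_Integration.integrable_bound[OF g]) (auto simp: norm_mult)
  have "char std_normal_distribution t = (LBINT x. std_normal_density x *\<^sub>R exp (\<i> * of_real (t * x)))"
    unfolding char_def by (subst integral_density) (auto simp: normal_density_nonneg)
  also have "\<dots> = (LBINT x. of_real (1 / sqrt (2 * pi)) * (exp (\<i> * of_real (t * x)) * complex_of_real (exp (- x\<^sup>2 / 2))))"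
    by (intro Bochner_Integration.integral_cong) (auto simp: std_normal_density_def scaleR_conv_of_real)
  also have "\<dots> = of_real (1 / sqrt (2 * pi)) * (LBINT x. exp (\<i> * of_real (t * x)) * complex_of_real (exp (- x\<^sup>2 / 2)))"
    by (rule integral_mult_right_zero)
  finally have "of_real (1 / sqrt (2 * pi)) * (LBINT x. exp (\<i> * of_real (t * x)) * complex_of_real (exp (- x\<^sup>2 / 2))) = complex_of_real (exp (- t\<^sup>2 / 2))"
    by (simp add: char_std_normal_distribution)
  then have "of_real (sqrt (2 * pi)) * (of_real (1 / sqrt (2 * pi)) * (LBINT x. exp (\<i> * of_real (t * x)) * complex_of_real (exp (- x\<^sup>2 / 2)))) = of_real (sqrt (2 * pi)) * complex_of_real (exp (- t\<^sup>2 / 2))"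
    by (rule arg_cong)
  moreover have "of_real (sqrt (2 * pi)) * (of_real (1 / sqrt (2 * pi)) * z) = z" for z :: complex
    by (simp flip: of_real_mult mult.assoc)
  ultimately show "(LBINT x. exp (\<i> * of_real (t * x)) * complex_of_real (exp (- x\<^sup>2 / 2))) = of_real (sqrt (2 * pi) * exp (- t\<^sup>2 / 2))"
    by simp
qed

text \<open>Absolute integrability is checked for \<open>F\<close> alone. The factor
  \<open>k\<close> stands for an oscillating exponential or for a bounded function such as the
  nonlinearity.\<close>

lemma Fubini_integral_bounded_factor:
  fixes F k :: "real \<Rightarrow> real \<Rightarrow> complex"
  assumes F: "integrable (lborel \<Otimes>\<^sub>M lborel) (\<lambda>(x, y). F x y)"
    and k: "(\<lambda>(x, y). k x y) \<in> borel_measurable (borel \<Otimes>\<^sub>M borel)" "\<And>x y. norm (k x y) \<le> N"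
  shows "integrable lborel (\<lambda>y. LBINT x. F x y * k x y)"
    and "(LBINT y. LBINT x. F x y * k x y) = (LBINT x. LBINT y. F x y * k x y)"
proof -
  have [measurable]: "(\<lambda>(x, y). k x y) \<in> borel_measurable (lborel \<Otimes>\<^sub>M lborel)" using k(1) by (simp cong: measurable_cong_sets sets_pair_measure_cong)
  note [measurable] = borel_measurable_integrable[OF F]
  have int: "integrable (lborel \<Otimes>\<^sub>M lborel) (\<lambda>(x, y). F x y * k x y)"
  proof (rule Bochner_Integration.integrable_bound[OF integrable_mult_left[OF F, of "of_real N"]])
    show "AE z in lborel \<Otimes>\<^sub>M lborel. norm (case z of (x, y) \<Rightarrow> F x y * k x y) \<le> norm ((case z of (x, y) \<Rightarrow> F x y) * of_real N)"
      using order_trans[OF k(2) abs_ge_self] by (intro AE_I2) (auto simp: norm_mult intro!: mult_left_mono)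
  qed (unfold split_beta', measurable)
  show "integrable lborel (\<lambda>y. LBINT x. F x y * k x y)" by (rule lborel_pair.integrable_snd[OF int])
  show "(LBINT y. LBINT x. F x y * k x y) = (LBINT x. LBINT y. F x y * k x y)"
    by (rule lborel_pair.Fubini_integral[OF int])
qed

lemma integrable_pair_product:
  fixes f g :: "real \<Rightarrow> complex"
  assumes f: "integrable lborel f" and g: "integrable lborel g"
  shows "integrable (lborel \<Otimes>\<^sub>M lborel) (\<lambda>(x, y). f x * g y)"
proof (rule lborel_pair.Fubini_integrable)
  note [measurable] = borel_measurable_integrable[OF f] borel_measurable_integrable[OF g]
  show "(\<lambda>(x, y). f x * g y) \<in> borel_measurable (lborel \<Otimes>\<^sub>M lborel)" by measurable
  show "integrable lborel (\<lambda>x. LBINT y. norm (case (x, y) of (x, y) \<Rightarrow> f x * g y))"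
    using f by (simp add: norm_mult)
  show "AE x in lborel. integrable lborel (\<lambda>y. case (x, y) of (x, y) \<Rightarrow> f x * g y)"
    using g by (intro AE_I2) simp
qed

lemma integrable_pair_convolution:
  fixes f g :: "real \<Rightarrow> complex"
  assumes f: "integrable lborel f" and g: "integrable lborel g"
  shows "integrable (lborel \<Otimes>\<^sub>M lborel) (\<lambda>(x, y). f x * g (y - x))"
proof (rule lborel_pair.Fubini_integrable)
  have [measurable]: "f \<in> borel_measurable borel" "g \<in> borel_measurable borel"
    using borel_measurable_integrable[OF f] borel_measurable_integrable[OF g] by simp_all
  have shift: "integrable lborel (\<lambda>y. g (y - x))" "(LBINT y. norm (g (y - x))) = (LBINT y. norm (g y))" for x
    using lborel_integrable_real_affine[OF g, of 1 "- x"] lborel_integral_real_affine[of 1 "\<lambda>y. norm (g y)" "- x"]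
    by simp_all
  show "(\<lambda>(x, y). f x * g (y - x)) \<in> borel_measurable (lborel \<Otimes>\<^sub>M lborel)" by measurable
  show "integrable lborel (\<lambda>x. LBINT y. norm (case (x, y) of (x, y) \<Rightarrow> f x * g (y - x)))"
    using f by (simp add: norm_mult shift)
  show "AE x in lborel. integrable lborel (\<lambda>y. case (x, y) of (x, y) \<Rightarrow> f x * g (y - x))"
    using shift by (intro AE_I2) simp
qed

section \<open>Gaussian test functions\<close>

text \<open>Centre a and width 1 / b. This family is rich enough for the argument: as b grows it
  separates continuous functions, and its Fourier transforms are explicit.\<close>

definition gaussian :: "real \<Rightarrow> real \<Rightarrow> real \<Rightarrow> complex" where
  "gaussian a b t = of_real (exp (- (b * (t - a))\<^sup>2 / 2))"

lemma gaussian_substitution: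
  fixes f :: "real \<Rightarrow> complex"
  assumes "b > 0"
  shows "(LBINT t. f t * gaussian a b t) = of_real (1 / b) * (LBINT x. f (a + x / b) * of_real (exp (- x\<^sup>2 / 2)))"
  using lborel_integral_real_affine[of "1 / b" "\<lambda>t. f t * gaussian a b t" a] assms
  by (simp add: gaussian_def scaleR_conv_of_real)

lemma integrable_gaussian:
  assumes "b > 0"
  shows "integrable lborel (gaussian a b)"
proof -
  have "integrable lborel (\<lambda>x. gaussian a b (a + 1 / b * x))"
    using std_normal_fourier(1)[of 0] assms by (simp add: gaussian_def)
  then show ?thesis
    by (subst (asm) lborel_integrable_real_affine_iff) (use assms in auto)
qed

lemma fourier_gaussian:
  assumes "b > 0"
  shows "fourier (gaussian a b) \<xi> = of_real (sqrt (2 * pi) / b) * exp (- \<i> * of_real (\<xi> * a)) * of_real (exp (- (\<xi> / b)\<^sup>2 / 2))"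
proof -
  have "fourier (gaussian a b) \<xi> = of_real (1 / b) * (LBINT x. exp (- \<i> * of_real (\<xi> * (a + x / b))) * of_real (exp (- x\<^sup>2 / 2)))"
    unfolding fourier_def by (rule gaussian_substitution[OF assms])
  also have "(LBINT x. exp (- \<i> * of_real (\<xi> * (a + x / b))) * of_real (exp (- x\<^sup>2 / 2))) =
      (LBINT x. exp (- \<i> * of_real (\<xi> * a)) * (exp (\<i> * of_real ((- \<xi> / b) * x)) * of_real (exp (- x\<^sup>2 / 2))))"
  proof (intro Bochner_Integration.integral_cong refl)
    fix x
    have "- \<i> * of_real (\<xi> * (a + x / b)) = - \<i> * of_real (\<xi> * a) + \<i> * of_real ((- \<xi> / b) * x)"
      by (simp add: distrib_left)
    then show "exp (- \<i> * of_real (\<xi> * (a + x / b))) * complex_of_real (exp (- x\<^sup>2 / 2)) =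
        exp (- \<i> * of_real (\<xi> * a)) * (exp (\<i> * of_real ((- \<xi> / b) * x)) * of_real (exp (- x\<^sup>2 / 2)))"
      by (simp only: exp_add mult.assoc)
  qed
  also have "\<dots> = exp (- \<i> * of_real (\<xi> * a)) * of_real (sqrt (2 * pi) * exp (- (- \<xi> / b)\<^sup>2 / 2))"
    unfolding integral_mult_right_zero std_normal_fourier(2) ..
  finally show ?thesis by simp
qed

lemma integrable_fourier_gaussian:
  assumes "b > 0"
  shows "integrable lborel (fourier (gaussian a b))"
proof -
  have "integrable lborel (gaussian 0 (1 / b))" using assms by (intro integrable_gaussian) simp
  then have "integrable lborel (\<lambda>\<xi>. of_real (sqrt (2 * pi) / b) * gaussian 0 (1 / b) \<xi>)" by (rule integrable_mult_right)
  then show ?thesis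
    by (rule Bochner_Integration.integrable_bound)
      (auto simp: fourier_gaussian[OF assms, abs_def] norm_mult norm_divide norm_exp_eq_Re gaussian_def)
qed

text \<open>The transform is again a Gaussian, of reciprocal width and with a phase, so inversion is
  a second use of the same explicit integral.\<close>

lemma fourier_inversion_gaussian:
  assumes "b > 0"
  shows "(LBINT \<xi>. exp (\<i> * of_real (\<xi> * t)) * fourier (gaussian a b) \<xi>) = of_real (2 * pi) * gaussian a b t"
proof -
  let ?c = "complex_of_real (sqrt (2 * pi) / b)"
  have "(LBINT \<xi>. exp (\<i> * of_real (\<xi> * t)) * fourier (gaussian a b) \<xi>) =
      (LBINT \<xi>. (?c * exp (\<i> * of_real (\<xi> * (t - a)))) * gaussian 0 (1 / b) \<xi>)"
    unfolding fourier_gaussian[OF assms]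
  proof (intro Bochner_Integration.integral_cong refl)
    fix \<xi>
    have "\<i> * of_real (\<xi> * (t - a)) = \<i> * of_real (\<xi> * t) + - \<i> * of_real (\<xi> * a)"
      by (simp add: right_diff_distrib)
    then have "exp (\<i> * of_real (\<xi> * (t - a))) = exp (\<i> * of_real (\<xi> * t)) * exp (- \<i> * of_real (\<xi> * a))"
      by (simp only: exp_add)
    then show "exp (\<i> * of_real (\<xi> * t)) * (?c * exp (- \<i> * of_real (\<xi> * a)) * of_real (exp (- (\<xi> / b)\<^sup>2 / 2))) =
        ?c * exp (\<i> * of_real (\<xi> * (t - a))) * gaussian 0 (1 / b) \<xi>"
      by (simp add: gaussian_def mult_ac)
  qed
  also have "\<dots> = of_real b * (LBINT x. ?c * exp (\<i> * of_real (x * b * (t - a))) * of_real (exp (- x\<^sup>2 / 2)))"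
    using gaussian_substitution[of "1 / b" "\<lambda>\<xi>. ?c * exp (\<i> * of_real (\<xi> * (t - a)))" 0] assms by simp
  also have "(LBINT x. ?c * exp (\<i> * of_real (x * b * (t - a))) * of_real (exp (- x\<^sup>2 / 2))) =
      (LBINT x. ?c * (exp (\<i> * of_real ((b * (t - a)) * x)) * of_real (exp (- x\<^sup>2 / 2))))"
    by (intro Bochner_Integration.integral_cong refl) (simp add: mult_ac)
  also have "\<dots> = ?c * of_real (sqrt (2 * pi) * exp (- (b * (t - a))\<^sup>2 / 2))"
    unfolding integral_mult_right_zero std_normal_fourier(2) ..
  also have "of_real b * \<dots> = complex_of_real (b * (sqrt (2 * pi) / b * (sqrt (2 * pi) * exp (- (b * (t - a))\<^sup>2 / 2))))"
    by (simp only: of_real_mult of_real_divide)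
  also have "complex_of_real (b * (sqrt (2 * pi) / b * (sqrt (2 * pi) * exp (- (b * (t - a))\<^sup>2 / 2)))) = of_real (2 * pi) * gaussian a b t"
    using assms by (simp add: gaussian_def flip: of_real_mult)
  finally show ?thesis .
qed

lemma schwartz_gaussian:
  assumes b: "b > 0"
  shows "schwartz (gaussian a b)"
proof -
  \<comment> \<open>Hermite-type recursion: differentiating P(s) exp (- (b s)^2 / 2) replaces P by
    P' - b^2 s P.\<close>
  define P :: "nat \<Rightarrow> real poly" where "P k = rec_nat 1 (\<lambda>_ p. pderiv p - smult (b\<^sup>2) (pCons 0 p)) k" for k
  have P: "P 0 = 1" "P (Suc k) = pderiv (P k) - smult (b\<^sup>2) (pCons 0 (P k))" for k
    by (simp_all add: P_def)
  define e where "e s = exp (- (b * s)\<^sup>2 / 2)" for s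
  define D where "D k t = complex_of_real (poly (P k) (t - a) * e (t - a))" for k t
  have mon: "bounded (range (\<lambda>s. s ^ i * e s))" for i
  proof (rule boundedI)
    fix x assume "x \<in> range (\<lambda>s. s ^ i * e s)"
    then obtain s where x: "x = s ^ i * e s" by auto
    \<comment> \<open>Completing the square; it shows that the Gaussian absorbs exp \<bar>s\<bar>,
      which in turn dominates every power of \<bar>s\<bar>.\<close>
    have "\<bar>s\<bar> - (b * s)\<^sup>2 / 2 \<le> 1 / (2 * b\<^sup>2)"
    proof -
      have "0 \<le> (b * \<bar>s\<bar> - 1 / b)\<^sup>2" by simp
      also have "\<dots> = (b * s)\<^sup>2 - 2 * \<bar>s\<bar> + 1 / b\<^sup>2" using b by (simp add: power2_diff power_mult_distrib power_divide)
      finally show ?thesis by simp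
    qed
    then have "exp \<bar>s\<bar> * e s \<le> exp (1 / (2 * b\<^sup>2))" by (simp add: e_def flip: exp_add)
    then have "fact i * (exp \<bar>s\<bar> * e s) \<le> fact i * exp (1 / (2 * b\<^sup>2))" by (intro mult_left_mono) auto
    moreover have "\<bar>s\<bar> ^ i * e s \<le> fact i * exp \<bar>s\<bar> * e s"
      by (intro mult_right_mono power_le_fact_exp) (auto simp: e_def)
    moreover have "norm x = \<bar>s\<bar> ^ i * e s" by (simp add: x abs_mult power_abs e_def)
    ultimately show "norm x \<le> fact i * exp (1 / (2 * b\<^sup>2))" by (simp only: mult.assoc)
  qed
  have pol: "bounded (range (\<lambda>s. poly Q s * e s))" for Q
  proof -
    have bs: "bounded (range (\<lambda>s. \<Sum>i\<in>I. coeff Q i * (s ^ i * e s)))" if "finite I" for I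
      using that
    proof induction
      case (insert i I)
      have "bounded (range (\<lambda>s. coeff Q i * (s ^ i * e s)))"
        using bounded_scaling[OF mon[of i], of "coeff Q i"] by (simp add: image_image)
      from bounded_plus_comp[OF this insert.IH] insert.hyps show ?case by simp
    qed simp
    then have "bounded (range (\<lambda>s. \<Sum>i\<le>degree Q. coeff Q i * (s ^ i * e s)))" by simp
    then show ?thesis by (simp add: poly_altdef sum_distrib_right mult.assoc)
  qed
  show ?thesis
    unfolding schwartz_def
  proof (intro exI[of _ D] conjI allI)
    show "D 0 = gaussian a b" by (simp add: D_def P e_def gaussian_def fun_eq_iff)
    fix k t
    have "((\<lambda>t. poly (P k) (t - a) * e (t - a)) has_real_derivative poly (P (Suc k)) (t - a) * e (t - a)) (at t)"
    proof -
      have de: "(e has_real_derivative - (b\<^sup>2 * s) * e s) (at s)" for s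
        unfolding e_def [abs_def] by (auto intro!: derivative_eq_intros simp: power2_eq_square)
      have "((\<lambda>s. poly (P k) s * e s) has_real_derivative poly (P (Suc k)) s * e s) (at s)" for s
        unfolding P by (auto intro!: derivative_eq_intros poly_DERIV de simp: algebra_simps)
      from DERIV_shift[THEN iffD1, OF this[of "t + - a"]] show ?thesis by simp
    qed
    then show "(D k has_vector_derivative D (Suc k) t) (at t)"
      unfolding D_def by (intro has_vector_derivative_of_real) (simp add: has_real_derivative_iff_has_vector_derivative)
    fix m
    \<comment> \<open>The polynomial \<open>[:a, 1:]\<close> takes the value t at t - a, so its
      power is the weight t^m in the shifted variable.\<close>
    have "bounded (range (\<lambda>s. poly ([:a, 1:] ^ m * P k) s * e s))" by (rule pol)
    then obtain N where N: "\<And>s. \<bar>poly ([:a, 1:] ^ m * P k) s * e s\<bar> \<le> N" by (auto simp: bounded_iff)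
    show "bounded (range (\<lambda>t. t ^ m *\<^sub>R D k t))"
    proof (rule boundedI)
      fix x assume "x \<in> range (\<lambda>t. t ^ m *\<^sub>R D k t)"
      then obtain t where x: "x = t ^ m *\<^sub>R D k t" by auto
      show "norm x \<le> N" using N[of "t - a"] by (simp add: x D_def abs_mult power_abs mult.assoc norm_mult)
    qed
  qed
qed

text \<open>After rescaling, the pairing is an average of f(a + x / b) against a fixed Gaussian and
  tends to a positive multiple of f(a) as b grows.\<close>

lemma zero_if_orthogonal_to_gaussians:
  fixes f :: "real \<Rightarrow> real"
  assumes f: "continuous_on UNIV f" "\<And>t. \<bar>f t\<bar> \<le> N"
    and orth: "\<And>b. b > 0 \<Longrightarrow> (LBINT t. of_real (f t) * gaussian a b t) = 0"
  shows "f a = 0"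
proof -
  let ?g = "\<lambda>x. complex_of_real (exp (- x\<^sup>2 / 2))"
  have [measurable]: "f \<in> borel_measurable borel" using f(1) by (rule borel_measurable_continuous_onI)
  have g: "integrable lborel ?g" "integral\<^sup>L lborel ?g = of_real (sqrt (2 * pi))"
    using std_normal_fourier[of 0] by simp_all
  have "(\<lambda>n. LBINT x. of_real (f (a + x / real (Suc n))) * ?g x) \<longlonglongrightarrow> (LBINT x. of_real (f a) * ?g x)"
  proof (rule integral_dominated_convergence)
    show "integrable lborel (\<lambda>x. N * norm (?g x))" using g(1) by (intro integrable_mult_right integrable_norm)
    show "AE x in lborel. (\<lambda>n. of_real (f (a + x / real (Suc n))) * ?g x) \<longlonglongrightarrow> of_real (f a) * ?g x"
    proof (intro AE_I2 tendsto_intros)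
      fix x
      have "(\<lambda>n. a + x / real (Suc n)) \<longlonglongrightarrow> a" by real_asymp
      moreover have "isCont f a" using f(1) by (simp add: continuous_on_eq_continuous_at)
      ultimately show "(\<lambda>n. f (a + x / real (Suc n))) \<longlonglongrightarrow> f a" by (rule isCont_tendsto_compose[rotated])
    qed
    show "AE x in lborel. norm (of_real (f (a + x / real (Suc n))) * ?g x) \<le> N * norm (?g x)" for n
      using f(2) by (intro AE_I2) (auto simp: norm_mult intro!: mult_right_mono)
  qed measurable
  then have lim: "(\<lambda>n. LBINT x. of_real (f (a + x / real (Suc n))) * ?g x) \<longlonglongrightarrow> (LBINT x. of_real (f a) * ?g x)" .
  have "(LBINT x. of_real (f (a + x / real (Suc n))) * ?g x) = 0" for n
    using orth[of "real (Suc n)"] gaussian_substitution[of "real (Suc n)" "\<lambda>t. of_real (f t)" a] by (simp del: of_nat_Suc)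
  from lim[unfolded this] have "(LBINT x. of_real (f a) * ?g x) = 0"
    by (rule LIMSEQ_unique[OF _ tendsto_const])
  then have "of_real (f a) * complex_of_real (sqrt (2 * pi)) = 0"
    unfolding integral_mult_right_zero g(2) .
  then show ?thesis by simp
qed

section \<open>The Green kernel and duality\<close>

context exp_sum_kernel
begin

(* The series may diverge at 0, where the value is immaterial. *)
definition G :: "real \<Rightarrow> real" where
  "G t = (if t = 0 then 0 else \<Sum>j. c j * exp (- \<sigma> j * \<bar>t\<bar>))"

text \<open>From exp (- x) \<le> 1 / x the terms are at most c / (\<sigma> \<bar>t\<bar>).\<close>

lemma summable_G:
  assumes "t \<noteq> 0"
  shows "summable (\<lambda>j. c j * exp (- \<sigma> j * \<bar>t\<bar>))"
proof (rule summable_comparison_test'[OF summable_divide[OF c_sum, of "\<bar>t\<bar>"]])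
  fix j
  have p: "0 < \<sigma> j * \<bar>t\<bar>" using \<sigma>_pos[of j] assms by simp
  have "\<sigma> j * \<bar>t\<bar> \<le> exp (\<sigma> j * \<bar>t\<bar>)" using exp_ge_add_one_self[of "\<sigma> j * \<bar>t\<bar>"] by linarith
  then have "exp (- (\<sigma> j * \<bar>t\<bar>)) \<le> inverse (\<sigma> j * \<bar>t\<bar>)" unfolding exp_minus using p by (rule le_imp_inverse_le)
  then have "c j * exp (- (\<sigma> j * \<bar>t\<bar>)) \<le> c j * inverse (\<sigma> j * \<bar>t\<bar>)" using c_pos[of j] by (intro mult_left_mono) auto
  then show "norm (c j * exp (- \<sigma> j * \<bar>t\<bar>)) \<le> c j / \<sigma> j / \<bar>t\<bar>"
    using c_pos[of j] by (simp add: abs_mult divide_inverse mult_ac)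
qed

lemma G_nonneg: "0 \<le> G t"
  using summable_G[of t] c_pos by (auto simp: G_def less_imp_le intro!: suminf_nonneg)

lemma G_meas [measurable]: "G \<in> borel_measurable borel"
  unfolding G_def [abs_def] by measurable

text \<open>Against a function of growth exp (\<sigma> 0 \<bar>u\<bar> / 2), half of the decay of
  every exponential is left, with mass 4 / \<sigma>; hence the sum of the
  \<open>c j / \<sigma> j\<close> controls all terms. The growth allowed here covers bounded
  functions and polynomial moments.\<close>

lemma G_integral:
  fixes g :: "real \<Rightarrow> complex"
  assumes g [measurable]: "g \<in> borel_measurable borel" and N: "\<And>u. norm (g u) \<le> N * exp (\<sigma> 0 / 2 * \<bar>u\<bar>)"
  shows "integrable lborel (\<lambda>u. of_real (G u) * g u)"
    and "(\<lambda>j. of_real (c j) * (LBINT u. of_real (exp (- \<sigma> j * \<bar>u\<bar>)) * g u)) sums (LBINT u. of_real (G u) * g u)"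
proof -
  define f where "f j u = of_real (c j) * (complex_of_real (exp (- \<sigma> j * \<bar>u\<bar>)) * g u)" for j u
  have N0: "N \<ge> 0" using N[of 0] order_trans[OF norm_ge_zero] by fastforce
  have [measurable]: "f j \<in> borel_measurable borel" for j unfolding f_def by measurable
  have s2: "0 < \<sigma> j / 2" for j using \<sigma>_pos[of j] by simp
  have fb: "norm (f j u) \<le> c j * N * exp (- (\<sigma> j / 2) * \<bar>u\<bar>)" for j u
  proof -
    have "exp (- \<sigma> j * \<bar>u\<bar>) * norm (g u) \<le> exp (- \<sigma> j * \<bar>u\<bar>) * (N * exp (\<sigma> 0 / 2 * \<bar>u\<bar>))"
      by (intro mult_left_mono N) auto
    also have "\<dots> \<le> exp (- \<sigma> j * \<bar>u\<bar>) * (N * exp (\<sigma> j / 2 * \<bar>u\<bar>))"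
      using N0 \<sigma>_ge[of j] by (intro mult_left_mono) (auto intro!: mult_right_mono)
    also have "\<dots> = N * exp (- \<sigma> j * \<bar>u\<bar> + \<sigma> j / 2 * \<bar>u\<bar>)" by (simp only: exp_add mult_ac)
    also have "- \<sigma> j * \<bar>u\<bar> + \<sigma> j / 2 * \<bar>u\<bar> = - (\<sigma> j / 2) * \<bar>u\<bar>" by simp
    finally have "c j * (exp (- \<sigma> j * \<bar>u\<bar>) * norm (g u)) \<le> c j * (N * exp (- (\<sigma> j / 2) * \<bar>u\<bar>))"
      using c_pos[of j] by (intro mult_left_mono) auto
    then show ?thesis using c_pos[of j] by (simp add: f_def norm_mult mult.assoc)
  qed
  have fi: "integrable lborel (f j)" for j
  proof (rule Bochner_Integration.integrable_bound[OF integrable_mult_right[OF fourier_exp_abs(1)[OF s2[of j]], of "c j * N"]])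
    show "AE u in lborel. norm (f j u) \<le> norm (c j * N * exp (- (\<sigma> j / 2) * \<bar>u\<bar>))"
      using order_trans[OF fb abs_ge_self] by (intro AE_I2) simp
  qed simp
  have fs: "summable (\<lambda>j. norm (f j u))" "(\<Sum>j. f j u) = of_real (G u) * g u" if "u \<noteq> 0" for u
  proof -
    have 1: "summable (\<lambda>j. c j * exp (- \<sigma> j * \<bar>u\<bar>) * norm (g u))" by (intro summable_mult2 summable_G that)
    show "summable (\<lambda>j. norm (f j u))" using 1 c_pos by (simp add: f_def norm_mult mult.assoc less_imp_le)
    have "(\<lambda>j. complex_of_real (c j * exp (- \<sigma> j * \<bar>u\<bar>)) * g u) sums (of_real (G u) * g u)"
      using summable_sums[OF summable_G[OF that]] that by (intro sums_mult2 sums_of_real) (simp add: G_def)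
    then show "(\<Sum>j. f j u) = of_real (G u) * g u" by (simp add: f_def sums_iff mult.assoc)
  qed
  have AE: "AE u in lborel. summable (\<lambda>j. norm (f j u))"
    using AE_lborel_singleton[of 0] by eventually_elim (rule fs(1))
  have sm: "summable (\<lambda>j. LBINT u. norm (f j u))"
  proof (rule summable_comparison_test'[OF summable_mult[OF c_sum, of "4 * N"]])
    fix j
    have "(LBINT u. norm (f j u)) \<le> (LBINT u. c j * N * exp (- (\<sigma> j / 2) * \<bar>u\<bar>))"
      by (intro integral_mono integrable_norm fi integrable_mult_right fourier_exp_abs(1)[OF s2] fb)
    also have "\<dots> = c j * N * (2 / (\<sigma> j / 2))" unfolding integral_mult_right_zero fourier_exp_abs(3)[OF s2] ..
    finally have "(LBINT u. norm (f j u)) \<le> 4 * N * (c j / \<sigma> j)" by (simp add: mult_ac)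
    moreover have "0 \<le> (LBINT u. norm (f j u))" by (intro integral_nonneg_AE) auto
    ultimately show "norm (LBINT u. norm (f j u)) \<le> 4 * N * (c j / \<sigma> j)" by simp
  qed
  have "integrable lborel (\<lambda>u. \<Sum>j. f j u) \<longleftrightarrow> integrable lborel (\<lambda>u. of_real (G u) * g u)"
    by (rule integrable_discrete_difference[where X = "{0}"]) (use fs in auto)
  then show "integrable lborel (\<lambda>u. of_real (G u) * g u)" using integrable_suminf[OF fi AE sm] by simp
  have "(LBINT u. (\<Sum>j. f j u)) = (LBINT u. of_real (G u) * g u)"
    by (rule integral_discrete_difference[where X = "{0}"]) (use fs in auto)
  moreover have "(\<lambda>j. integral\<^sup>L lborel (f j)) sums (LBINT u. (\<Sum>j. f j u))"
    by (rule sums_integral[OF fi AE sm])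
  ultimately show "(\<lambda>j. of_real (c j) * (LBINT u. of_real (exp (- \<sigma> j * \<bar>u\<bar>)) * g u)) sums (LBINT u. of_real (G u) * g u)"
    unfolding f_def integral_mult_right_zero by simp
qed

lemma G_integral_bounded:
  fixes g :: "real \<Rightarrow> complex"
  assumes g: "g \<in> borel_measurable borel" and N: "\<And>u. norm (g u) \<le> N"
  shows "integrable lborel (\<lambda>u. of_real (G u) * g u)"
    and "(\<lambda>j. of_real (c j) * (LBINT u. of_real (exp (- \<sigma> j * \<bar>u\<bar>)) * g u)) sums (LBINT u. of_real (G u) * g u)"
proof -
  have N0: "N \<ge> 0" using order_trans[OF norm_ge_zero N] .
  have "norm (g u) \<le> N * exp (\<sigma> 0 / 2 * \<bar>u\<bar>)" for u
  proof -
    have "N * 1 \<le> N * exp (\<sigma> 0 / 2 * \<bar>u\<bar>)" using N0 \<sigma>0 by (intro mult_left_mono) auto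
    then show ?thesis using N[of u] by simp
  qed
  from G_integral[OF g this] show "integrable lborel (\<lambda>u. of_real (G u) * g u)"
    "(\<lambda>j. of_real (c j) * (LBINT u. of_real (exp (- \<sigma> j * \<bar>u\<bar>)) * g u)) sums (LBINT u. of_real (G u) * g u)" .
qed

lemma G_moment: "integrable lborel (\<lambda>u. G u * \<bar>u\<bar> ^ m)"
proof -
  have "norm (complex_of_real (\<bar>u\<bar> ^ m)) \<le> (2 / \<sigma> 0) ^ m * fact m * exp (\<sigma> 0 / 2 * \<bar>u\<bar>)" for u
  proof -
    have "\<bar>u\<bar> ^ m = (2 / \<sigma> 0) ^ m * (\<sigma> 0 / 2 * \<bar>u\<bar>) ^ m"
      using \<sigma>0 by (simp flip: power_mult_distrib)
    also have "\<dots> \<le> (2 / \<sigma> 0) ^ m * (fact m * exp (\<sigma> 0 / 2 * \<bar>u\<bar>))"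
      using \<sigma>0 by (intro mult_left_mono power_le_fact_exp) auto
    finally show ?thesis by (simp add: mult.assoc norm_power)
  qed
  from G_integral(1)[OF _ this] have "integrable lborel (\<lambda>u. complex_of_real (G u * \<bar>u\<bar> ^ m))" by simp
  then show ?thesis using integrable_Re by fastforce
qed

definition G_conv :: "(real \<Rightarrow> complex) \<Rightarrow> real \<Rightarrow> complex" where
  "G_conv \<psi> t = (LBINT u. of_real (G u) * \<psi> (t - u))"

text \<open>The kernel may be singular at 0, so all derivatives fall on \<psi>. Decay follows by
  distributing the power of t between the moments of the kernel and the decay of \<psi>.\<close>

lemma schwartz_G_conv:
  assumes "schwartz \<psi>"
  shows "schwartz (G_conv \<psi>)"
proof -
  obtain D where D0: "D 0 = \<psi>" and D: "\<And>k t. (D k has_vector_derivative D (Suc k) t) (at t)"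
    and Db: "\<And>k m. bounded (range (\<lambda>t. t ^ m *\<^sub>R D k t))"
    using assms unfolding schwartz_def by blast
  have "\<exists>N. \<forall>t. norm (t ^ m *\<^sub>R D k t) \<le> N" for k m
    using Db[of m k] by (auto simp: bounded_iff)
  note ex = this
  define N where "N k m = (SOME N. \<forall>t. norm (t ^ m *\<^sub>R D k t) \<le> N)" for k m
  have N: "norm (t ^ m *\<^sub>R D k t) \<le> N k m" for k m t
    using someI_ex[OF ex[of m k]] unfolding N_def by blast
  have N0: "norm (D k t) \<le> N k 0" for k t using N[of t 0 k] by simp
  have Npos: "0 \<le> N k m" for k m using order_trans[OF norm_ge_zero N] .
  have Dc: "continuous_on UNIV (D k)" for k
    by (rule continuous_on_vector_derivative) (use D has_vector_derivative_at_within in blast)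
  have [measurable]: "D k \<in> borel_measurable borel" for k using Dc by (rule borel_measurable_continuous_onI)
  have int: "integrable lborel (\<lambda>u. of_real (G u) * D k (t - u))" for k t
    by (rule G_integral_bounded(1)[of _ "N k 0"]) (use N0 in auto)
  have G1: "integrable lborel G" using G_moment[of 0] by simp
  \<comment> \<open>Taylor remainder of second order, uniform in x. Integrated against the kernel it
    gives an error of order \<delta>^2 and hence differentiation under the integral.\<close>
  have lin: "norm (D k (x + \<delta>) - D k x - \<delta> *\<^sub>R D (Suc k) x) \<le> \<bar>\<delta>\<bar> * (\<bar>\<delta>\<bar> * N (Suc (Suc k)) 0)" for k x \<delta>
  proof -
    let ?S = "closed_segment x (x + \<delta>)"
    have lip: "norm (D (Suc k) y - D (Suc k) x) \<le> \<bar>\<delta>\<bar> * N (Suc (Suc k)) 0" if y: "y \<in> ?S" for y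
    proof -
      have "norm (D (Suc k) y - D (Suc k) x) \<le> N (Suc (Suc k)) 0 * norm (y - x)"
      proof (rule differentiable_bound[of UNIV])
        show "(D (Suc k) has_derivative (\<lambda>h. h *\<^sub>R D (Suc (Suc k)) z)) (at z within UNIV)" for z
          using D[of "Suc k" z] by (simp add: has_vector_derivative_def)
        show "onorm (\<lambda>h. h *\<^sub>R D (Suc (Suc k)) z) \<le> N (Suc (Suc k)) 0" for z
          using N0 by (intro onorm_le) (simp add: mult.commute mult_left_mono)
      qed auto
      also have "norm (y - x) \<le> \<bar>\<delta>\<bar>" using segment_bound1[OF y] by simp
      then have "N (Suc (Suc k)) 0 * norm (y - x) \<le> N (Suc (Suc k)) 0 * \<bar>\<delta>\<bar>" using Npos by (intro mult_left_mono) auto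
      finally show ?thesis by (simp add: mult.commute)
    qed
    have "norm (D k (x + \<delta>) - D k x - (x + \<delta> - x) *\<^sub>R D (Suc k) x) \<le> norm (x + \<delta> - x) * (\<bar>\<delta>\<bar> * N (Suc (Suc k)) 0)"
      by (rule vector_differentiable_bound_linearization[of ?S]) (use D lip in \<open>auto intro: has_vector_derivative_at_within\<close>)
    then show ?thesis by simp
  qed
  define E where "E k = G_conv (D k)" for k
  show ?thesis
    unfolding schwartz_def
  proof (intro exI[of _ E] conjI allI)
    show "E 0 = G_conv \<psi>" by (simp add: E_def D0)
    fix k t
    define C where "C = N (Suc (Suc k)) 0 * integral\<^sup>L lborel G"
    have bnd: "norm (E k (t + \<delta>) - E k t - \<delta> *\<^sub>R E (Suc k) t) / norm \<delta> \<le> \<bar>\<delta>\<bar> * C" for \<delta> :: real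
    proof (cases "\<delta> = 0")
      case False
      have "E k (t + \<delta>) - E k t - \<delta> *\<^sub>R E (Suc k) t =
          (LBINT u. of_real (G u) * D k (t + \<delta> - u) - of_real (G u) * D k (t - u) - \<delta> *\<^sub>R (of_real (G u) * D (Suc k) (t - u)))"
        unfolding E_def G_conv_def
        by (simp add: int del: of_real_mult)
      also have "\<dots> = (LBINT u. of_real (G u) * (D k (t - u + \<delta>) - D k (t - u) - \<delta> *\<^sub>R D (Suc k) (t - u)))"
        by (intro Bochner_Integration.integral_cong refl) (simp add: algebra_simps)
      finally have "norm (E k (t + \<delta>) - E k t - \<delta> *\<^sub>R E (Suc k) t) \<le> (LBINT u. norm (of_real (G u) * (D k (t - u + \<delta>) - D k (t - u) - \<delta> *\<^sub>R D (Suc k) (t - u))))"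
        by (simp only: integral_norm_bound)
      also have "\<dots> \<le> (LBINT u. G u * (\<bar>\<delta>\<bar> * (\<bar>\<delta>\<bar> * N (Suc (Suc k)) 0)))"
      proof (rule integral_mono_AE')
        show "integrable lborel (\<lambda>u. G u * (\<bar>\<delta>\<bar> * (\<bar>\<delta>\<bar> * N (Suc (Suc k)) 0)))" by (intro integrable_mult_left G1)
        show "AE u in lborel. norm (of_real (G u) * (D k (t - u + \<delta>) - D k (t - u) - \<delta> *\<^sub>R D (Suc k) (t - u))) \<le> G u * (\<bar>\<delta>\<bar> * (\<bar>\<delta>\<bar> * N (Suc (Suc k)) 0))"
          using lin G_nonneg by (intro AE_I2) (auto simp: norm_mult intro!: mult_left_mono)
        show "AE u in lborel. 0 \<le> G u * (\<bar>\<delta>\<bar> * (\<bar>\<delta>\<bar> * N (Suc (Suc k)) 0))"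
          using G_nonneg Npos by (intro AE_I2 mult_nonneg_nonneg) simp_all
      qed
      also have "\<dots> = \<bar>\<delta>\<bar> * (\<bar>\<delta>\<bar> * C)" by (simp add: C_def)
      finally have "norm (E k (t + \<delta>) - E k t - \<delta> *\<^sub>R E (Suc k) t) \<le> \<bar>\<delta>\<bar> * C * norm \<delta>"
        by (simp only: mult_ac real_norm_def)
      then show ?thesis using False by (subst pos_divide_le_eq) auto
    qed simp
    have "((\<lambda>\<delta>. norm (E k (t + \<delta>) - E k t - \<delta> *\<^sub>R E (Suc k) t) / norm \<delta>) \<longlongrightarrow> 0) (at 0)"
    proof (rule Lim_null_comparison)
      show "eventually (\<lambda>\<delta>. norm (norm (E k (t + \<delta>) - E k t - \<delta> *\<^sub>R E (Suc k) t) / norm \<delta>) \<le> \<bar>\<delta>\<bar> * C) (at 0)"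
        using bnd by simp
      show "((\<lambda>\<delta>::real. \<bar>\<delta>\<bar> * C) \<longlongrightarrow> 0) (at 0)" by (auto intro!: tendsto_eq_intros)
    qed
    then show "(E k has_vector_derivative E (Suc k) t) (at t)"
      unfolding has_vector_derivative_def has_derivative_at by (simp add: bounded_linear_scaleR_left)
    fix m
    have "norm (t ^ m *\<^sub>R E k t) \<le> 2 ^ m * (N k 0 * (LBINT u. G u * \<bar>u\<bar> ^ m) + N k m * integral\<^sup>L lborel G)" for t
    proof -
      have "t ^ m *\<^sub>R E k t = (LBINT u. t ^ m *\<^sub>R (of_real (G u) * D k (t - u)))"
        unfolding E_def G_conv_def by (rule integral_scaleR_right[symmetric])
      then have "norm (t ^ m *\<^sub>R E k t) \<le> (LBINT u. norm (t ^ m *\<^sub>R (of_real (G u) * D k (t - u))))"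
        by (simp only: integral_norm_bound)
      also have "\<dots> \<le> (LBINT u. 2 ^ m * (N k 0 * (G u * \<bar>u\<bar> ^ m) + N k m * G u))"
      proof (rule integral_mono)
        show "integrable lborel (\<lambda>u. norm (t ^ m *\<^sub>R (of_real (G u) * D k (t - u))))"
          by (intro integrable_norm integrable_scaleR_right int)
        show "integrable lborel (\<lambda>u. 2 ^ m * (N k 0 * (G u * \<bar>u\<bar> ^ m) + N k m * G u))"
          by (intro integrable_mult_right Bochner_Integration.integrable_add G_moment G1)
        fix u
        \<comment> \<open>One of \<bar>u\<bar> and \<bar>t - u\<bar> is at least half of
          \<bar>t\<bar>.\<close>
        have "\<bar>t\<bar> ^ m \<le> 2 ^ m * (\<bar>u\<bar> ^ m + \<bar>t - u\<bar> ^ m)"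
        proof -
          have "\<bar>t\<bar> \<le> \<bar>u\<bar> + \<bar>t - u\<bar>" by linarith
          also have "\<dots> \<le> max \<bar>u\<bar> \<bar>t - u\<bar> + max \<bar>u\<bar> \<bar>t - u\<bar>" by (intro add_mono) auto
          finally have "\<bar>t\<bar> \<le> 2 * max \<bar>u\<bar> \<bar>t - u\<bar>" by simp
          then have "\<bar>t\<bar> ^ m \<le> (2 * max \<bar>u\<bar> \<bar>t - u\<bar>) ^ m" by (intro power_mono) auto
          also have "\<dots> = 2 ^ m * max \<bar>u\<bar> \<bar>t - u\<bar> ^ m" by (simp add: power_mult_distrib)
          also have "\<dots> \<le> 2 ^ m * (\<bar>u\<bar> ^ m + \<bar>t - u\<bar> ^ m)" by (intro mult_left_mono) (auto simp: max_def)
          finally show ?thesis .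
        qed
        then have "\<bar>t\<bar> ^ m * norm (D k (t - u)) \<le> 2 ^ m * (\<bar>u\<bar> ^ m + \<bar>t - u\<bar> ^ m) * norm (D k (t - u))"
          by (intro mult_right_mono) auto
        also have "\<dots> = 2 ^ m * (\<bar>u\<bar> ^ m * norm (D k (t - u)) + norm ((t - u) ^ m *\<^sub>R D k (t - u)))"
          by (simp add: distrib_right power_abs mult.assoc)
        also have "\<dots> \<le> 2 ^ m * (\<bar>u\<bar> ^ m * N k 0 + N k m)"
          by (intro mult_left_mono add_mono N N0) auto
        finally have "G u * (\<bar>t\<bar> ^ m * norm (D k (t - u))) \<le> G u * (2 ^ m * (\<bar>u\<bar> ^ m * N k 0 + N k m))"
          using G_nonneg by (intro mult_left_mono) auto
        then show "norm (t ^ m *\<^sub>R (of_real (G u) * D k (t - u))) \<le> 2 ^ m * (N k 0 * (G u * \<bar>u\<bar> ^ m) + N k m * G u)"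
          using G_nonneg[of u] by (simp add: norm_mult power_abs algebra_simps)
      qed
      also have "\<dots> = 2 ^ m * (N k 0 * (LBINT u. G u * \<bar>u\<bar> ^ m) + N k m * integral\<^sup>L lborel G)"
        by (simp add: G1 G_moment)
      finally show ?thesis .
    qed
    then show "bounded (range (\<lambda>t. t ^ m *\<^sub>R E k t))" by (intro boundedI) auto
  qed
qed

text \<open>The Fourier transform of \<open>G\<close>, which for the pole data in question equals 1
  / (Theta0 - \<kappa>) on the real line away from 0.\<close>

definition R :: "real \<Rightarrow> real" where
  "R \<xi> = (\<Sum>j. 2 * c j * \<sigma> j / (\<xi>\<^sup>2 + (\<sigma> j)\<^sup>2))"

lemma fourier_G: "(LBINT u. of_real (G u) * exp (- \<i> * of_real (\<xi> * u))) = of_real (R \<xi>)"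
proof -
  have "(\<lambda>j. of_real (c j) * (LBINT u. of_real (exp (- \<sigma> j * \<bar>u\<bar>)) * exp (- \<i> * of_real (\<xi> * u)))) sums
      (LBINT u. of_real (G u) * exp (- \<i> * of_real (\<xi> * u)))"
    by (rule G_integral_bounded(2)[of _ 1]) (auto simp: norm_exp_eq_Re)
  moreover have "of_real (c j) * (LBINT u. of_real (exp (- \<sigma> j * \<bar>u\<bar>)) * exp (- \<i> * of_real (\<xi> * u))) =
      complex_of_real (2 * c j * \<sigma> j / (\<xi>\<^sup>2 + (\<sigma> j)\<^sup>2))" for j
    using fourier_exp_abs(2)[OF \<sigma>_pos[of j], of \<xi>] by (simp add: mult.commute mult.left_commute)
  ultimately have "(\<lambda>j. complex_of_real (2 * c j * \<sigma> j / (\<xi>\<^sup>2 + (\<sigma> j)\<^sup>2))) sums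
      (LBINT u. of_real (G u) * exp (- \<i> * of_real (\<xi> * u)))" by simp
  moreover from sums_summable[OF this] have "(\<lambda>j. complex_of_real (2 * c j * \<sigma> j / (\<xi>\<^sup>2 + (\<sigma> j)\<^sup>2))) sums of_real (R \<xi>)"
    unfolding R_def by (intro sums_of_real summable_sums) (simp only: summable_of_real_iff)
  ultimately show ?thesis by (rule sums_unique2)
qed

lemma integrable_G: "integrable lborel (\<lambda>u. complex_of_real (G u))"
  using G_integral_bounded(1)[of "\<lambda>_. 1" 1] by simp

text \<open>Moves the convolution from \<psi> to the other factor. With an exponential as
  \<open>k\<close> it gives the convolution theorem, with the nonlinearity the Green
  representation.\<close>

lemma G_conv_pairing:
  assumes \<psi>: "integrable lborel \<psi>" and k [measurable]: "k \<in> borel_measurable borel" and N: "\<And>t. norm (k t) \<le> N"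
  shows "integrable lborel (\<lambda>t. G_conv \<psi> t * k t)"
    and "(LBINT t. G_conv \<psi> t * k t) = (LBINT u. of_real (G u) * (LBINT x. \<psi> x * k (x + u)))"
proof -
  have km: "(\<lambda>(x, y). k y) \<in> borel_measurable (borel \<Otimes>\<^sub>M borel)" by measurable
  note F = Fubini_integral_bounded_factor[OF integrable_pair_convolution[OF integrable_G \<psi>] km N]
  have e: "(LBINT u. of_real (G u) * \<psi> (t - u) * k t) = G_conv \<psi> t * k t" for t
    by (simp add: G_conv_def)
  show "integrable lborel (\<lambda>t. G_conv \<psi> t * k t)" using F(1) unfolding e .
  have "(LBINT t. of_real (G u) * \<psi> (t - u) * k t) = of_real (G u) * (LBINT x. \<psi> x * k (x + u))" for u
    using lborel_integral_real_affine[of 1 "\<lambda>t. \<psi> (t - u) * k t" u] by (simp add: mult.assoc add.commute)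
  note e' = this
  show "(LBINT t. G_conv \<psi> t * k t) = (LBINT u. of_real (G u) * (LBINT x. \<psi> x * k (x + u)))"
    using F(2) unfolding e e' .
qed

lemma fourier_G_conv:
  assumes \<psi>: "integrable lborel \<psi>"
  shows "fourier (G_conv \<psi>) \<xi> = of_real (R \<xi>) * fourier \<psi> \<xi>"
proof -
  let ?k = "\<lambda>t. exp (- \<i> * of_real (\<xi> * t))"
  have "fourier (G_conv \<psi>) \<xi> = (LBINT t. G_conv \<psi> t * ?k t)"
    unfolding fourier_def by (simp add: mult.commute)
  also have "\<dots> = (LBINT u. of_real (G u) * (LBINT x. \<psi> x * ?k (x + u)))"
    by (rule G_conv_pairing(2)[OF \<psi>, of _ 1]) (auto simp: norm_exp_eq_Re)
  also have "\<dots> = (LBINT u. of_real (G u) * ?k u * fourier \<psi> \<xi>)"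
  proof (intro Bochner_Integration.integral_cong refl)
    fix u
    have "(LBINT x. \<psi> x * ?k (x + u)) = (LBINT x. ?k u * (?k x * \<psi> x))"
    proof (intro Bochner_Integration.integral_cong refl)
      fix x
      have "- \<i> * of_real (\<xi> * (x + u)) = - \<i> * of_real (\<xi> * u) + - \<i> * of_real (\<xi> * x)" by (simp add: algebra_simps)
      then show "\<psi> x * ?k (x + u) = ?k u * (?k x * \<psi> x)" by (simp only: exp_add mult_ac)
    qed
    then show "of_real (G u) * (LBINT x. \<psi> x * ?k (x + u)) = of_real (G u) * ?k u * fourier \<psi> \<xi>"
      by (simp add: fourier_def mult.assoc)
  qed
  also have "\<dots> = of_real (R \<xi>) * fourier \<psi> \<xi>"
    unfolding integral_mult_left_zero fourier_G ..
  finally show ?thesis .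
qed

text \<open>\<open>G_conv\<close> solves the equation for the test function: on the Fourier side
  Theta0 R = 1 + \<kappa> R except at the null set {0}. The inverse transform of R times the
  Gaussian transform is computed by Fubini from Gaussian inversion, so only Gaussians are ever
  inverted.\<close>

lemma cyl_frac_lap_G_conv_gaussian:
  assumes symbol: "\<And>\<xi>. \<xi> \<noteq> 0 \<Longrightarrow> (Theta0 n \<gamma> (of_real \<xi>) - of_real \<kappa>) * of_real (R \<xi>) = 1" and b: "b > 0"
  shows "cyl_frac_lap n \<gamma> (G_conv (gaussian a b)) t = gaussian a b t + of_real \<kappa> * G_conv (gaussian a b) t"
proof -
  let ?\<psi> = "gaussian a b" and ?k = "\<lambda>\<xi>. exp (\<i> * of_real (\<xi> * t))"
  note i\<psi> = integrable_fourier_gaussian[OF b, of a]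
  let ?K = "\<lambda>u \<xi>. exp (\<i> * of_real (\<xi> * (t - u)))"
  have km: "(\<lambda>(u, \<xi>). ?K u \<xi>) \<in> borel_measurable (borel \<Otimes>\<^sub>M borel)" by measurable
  have kn: "norm (?K u \<xi>) \<le> 1" for u \<xi> by (simp add: norm_exp_eq_Re)
  note F = Fubini_integral_bounded_factor[OF integrable_pair_product[OF integrable_G i\<psi>] km kn]
  have e1: "(LBINT u. of_real (G u) * fourier ?\<psi> \<xi> * ?K u \<xi>) = ?k \<xi> * (of_real (R \<xi>) * fourier ?\<psi> \<xi>)" for \<xi>
  proof -
    have "(LBINT u. of_real (G u) * fourier ?\<psi> \<xi> * ?K u \<xi>) = (LBINT u. (?k \<xi> * fourier ?\<psi> \<xi>) * (of_real (G u) * exp (- \<i> * of_real (\<xi> * u))))"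
    proof (intro Bochner_Integration.integral_cong refl)
      fix u
      have "\<i> * of_real (\<xi> * (t - u)) = \<i> * of_real (\<xi> * t) + - \<i> * of_real (\<xi> * u)" by (simp add: algebra_simps)
      then show "of_real (G u) * fourier ?\<psi> \<xi> * ?K u \<xi> = (?k \<xi> * fourier ?\<psi> \<xi>) * (of_real (G u) * exp (- \<i> * of_real (\<xi> * u)))"
        by (simp only: exp_add mult_ac)
    qed
    also have "\<dots> = (?k \<xi> * fourier ?\<psi> \<xi>) * of_real (R \<xi>)" unfolding integral_mult_right_zero fourier_G ..
    finally show ?thesis by (simp only: mult_ac)
  qed
  have e2: "(LBINT \<xi>. of_real (G u) * fourier ?\<psi> \<xi> * ?K u \<xi>) = of_real (2 * pi) * (of_real (G u) * ?\<psi> (t - u))" for u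
  proof -
    have "(LBINT \<xi>. of_real (G u) * fourier ?\<psi> \<xi> * ?K u \<xi>) = (LBINT \<xi>. of_real (G u) * (?K u \<xi> * fourier ?\<psi> \<xi>))"
      by (intro Bochner_Integration.integral_cong refl) (simp only: mult_ac)
    also have "\<dots> = of_real (G u) * (of_real (2 * pi) * ?\<psi> (t - u))"
      unfolding integral_mult_right_zero fourier_inversion_gaussian[OF b] ..
    finally show ?thesis by (simp only: mult_ac)
  qed
  have i2: "integrable lborel (\<lambda>\<xi>. ?k \<xi> * (of_real (R \<xi>) * fourier ?\<psi> \<xi>))" using F(1) unfolding e1 .
  have I2: "(LBINT \<xi>. ?k \<xi> * (of_real (R \<xi>) * fourier ?\<psi> \<xi>)) = of_real (2 * pi) * G_conv ?\<psi> t"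
    using F(2) unfolding e1 e2 integral_mult_right_zero G_conv_def .
  have i1: "integrable lborel (\<lambda>\<xi>. ?k \<xi> * fourier ?\<psi> \<xi>)"
    by (rule Bochner_Integration.integrable_bound[OF i\<psi>])
      (use borel_measurable_integrable[OF i\<psi>] in \<open>auto simp: norm_mult norm_exp_eq_Re\<close>)
  have "(LBINT \<xi>. ?k \<xi> * (Theta0 n \<gamma> (of_real \<xi>) * fourier (G_conv ?\<psi>) \<xi>)) =
      (LBINT \<xi>. ?k \<xi> * fourier ?\<psi> \<xi> + of_real \<kappa> * (?k \<xi> * (of_real (R \<xi>) * fourier ?\<psi> \<xi>)))"
  proof (rule integral_discrete_difference[where X = "{0}"])
    fix \<xi> :: real assume "\<xi> \<notin> {0}"
    then have "Theta0 n \<gamma> (of_real \<xi>) * of_real (R \<xi>) = 1 + of_real \<kappa> * of_real (R \<xi>)"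
      using symbol[of \<xi>] by (simp add: algebra_simps)
    then have "Theta0 n \<gamma> (of_real \<xi>) * (of_real (R \<xi>) * fourier ?\<psi> \<xi>) = (1 + of_real \<kappa> * of_real (R \<xi>)) * fourier ?\<psi> \<xi>"
      by (simp only: mult.assoc[symmetric])
    then show "?k \<xi> * (Theta0 n \<gamma> (of_real \<xi>) * fourier (G_conv ?\<psi>) \<xi>) = ?k \<xi> * fourier ?\<psi> \<xi> + of_real \<kappa> * (?k \<xi> * (of_real (R \<xi>) * fourier ?\<psi> \<xi>))"
      unfolding fourier_G_conv[OF integrable_gaussian[OF b]] by (simp add: algebra_simps)
  qed auto
  also have "\<dots> = of_real (2 * pi) * (?\<psi> t + of_real \<kappa> * G_conv ?\<psi> t)"
    unfolding Bochner_Integration.integral_add[OF i1 integrable_mult_right[OF i2]] integral_mult_right_zero I2 fourier_inversion_gaussian[OF b]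
    by (simp add: algebra_simps)
  finally show ?thesis unfolding cyl_frac_lap_def by simp
qed

text \<open>Uniqueness by duality. Testing with \<open>G_conv \<psi>\<close> cancels the
  \<kappa>-terms and leaves the pairing of \<open>w\<close> with \<psi> on one side and that of
  \<open>f\<close> with \<open>G_conv \<psi>\<close> on the other. Moving the kernel to
  \<open>f\<close> shows that \<open>w\<close> and the continuous function \<open>v\<close> given by
  the series have the same pairing with every Gaussian.\<close>

theorem green_representation:
  fixes w f :: "real \<Rightarrow> real"
  assumes symbol: "\<And>\<xi>. \<xi> \<noteq> 0 \<Longrightarrow> (Theta0 n \<gamma> (of_real \<xi>) - of_real \<kappa>) * of_real (R \<xi>) = 1"
    and w: "continuous_on UNIV w" "\<And>t. \<bar>w t\<bar> \<le> B"
    and f: "continuous_on UNIV f" "\<And>t. 0 \<le> f t" "\<And>t. f t \<le> M"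
    and eq: "cyl_frac_lap_eq n \<gamma> w (\<lambda>t. \<kappa> * w t + f t)"
  shows "(\<lambda>j. c j * exp_conv (\<sigma> j) f t) sums w t"
proof -
  have [measurable]: "w \<in> borel_measurable borel" "f \<in> borel_measurable borel"
    using w(1) f(1) by (auto intro: borel_measurable_continuous_onI)
  have fabs: "\<bar>f t\<bar> \<le> M" for t using f(2,3)[of t] by simp
  have bnd: "\<bar>c j * exp_conv (\<sigma> j) f t\<bar> \<le> 2 * M * (c j / \<sigma> j)" for j t
    using mult_left_mono[OF exp_conv_bound[where h = f and t = t, OF \<sigma>_pos[of j] _ fabs], of "c j"] c_pos[of j]
    by (simp add: abs_mult mult_ac)
  have sm: "summable (\<lambda>j. c j * exp_conv (\<sigma> j) f t)" for t
    by (rule summable_comparison_test'[OF summable_mult[OF c_sum, of "2 * M"]]) (use bnd in simp)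
  define v where "v t = (\<Sum>j. c j * exp_conv (\<sigma> j) f t)" for t
  have v_cont: "continuous_on UNIV v"
    unfolding v_def [abs_def]
  proof (rule uniform_limit_theorem[OF _ Weierstrass_m_test[OF _ summable_mult[OF c_sum, of "2 * M"]]])
    have "continuous_on UNIV (exp_conv (\<sigma> j) f)" for j
      by (rule DERIV_continuous_on, rule has_field_derivative_at_within, rule exp_conv_properties(1)[OF \<sigma>_pos f])
    then show "eventually (\<lambda>n. continuous_on UNIV (\<lambda>x. \<Sum>i<n. c i * exp_conv (\<sigma> i) f x)) sequentially"
      by (auto intro!: always_eventually continuous_intros)
  qed (use bnd in auto)
  have vb: "\<bar>v t\<bar> \<le> (\<Sum>j. 2 * M * (c j / \<sigma> j))" for t
    unfolding v_def using norm_suminf_le[OF _ summable_mult[OF c_sum, of "2 * M"], where f = "\<lambda>j. c j * exp_conv (\<sigma> j) f t"] bnd by simp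
  \<comment> \<open>The argument x + u, in place of x - u, results from transposing the convolution;
    evenness of the kernel makes both the same.\<close>
  have V: "(LBINT u. of_real (G u) * complex_of_real (f (x + u))) = of_real (v x)" for x
  proof -
    have 1: "(\<lambda>j. of_real (c j) * (LBINT u. of_real (exp (- \<sigma> j * \<bar>u\<bar>)) * complex_of_real (f (x + u)))) sums
      (LBINT u. of_real (G u) * complex_of_real (f (x + u)))"
      by (rule G_integral_bounded(2)[of _ M]) (use fabs in auto)
    have 2: "(LBINT u. of_real (exp (- \<sigma> j * \<bar>u\<bar>)) * complex_of_real (f (x + u))) = of_real (exp_conv (\<sigma> j) f x)" for j
    proof -
      have "(LBINT u. of_real (exp (- \<sigma> j * \<bar>u\<bar>)) * complex_of_real (f (x + u))) = (LBINT u. complex_of_real (exp (- \<sigma> j * \<bar>u\<bar>) * f (x + u)))"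
        by simp
      also have "\<dots> = of_real (LBINT u. exp (- \<sigma> j * \<bar>u\<bar>) * f (x + u))" by (rule integral_complex_of_real)
      also have "(LBINT u. exp (- \<sigma> j * \<bar>u\<bar>) * f (x + u)) = exp_conv (\<sigma> j) f x"
        unfolding exp_conv_alt using lborel_integral_real_affine[of "-1" "\<lambda>u. exp (- \<sigma> j * \<bar>u\<bar>) * f (x + u)" 0] by simp
      finally show ?thesis .
    qed
    have "(\<lambda>j. complex_of_real (c j * exp_conv (\<sigma> j) f x)) sums of_real (v x)"
      unfolding v_def by (intro sums_of_real summable_sums sm)
    then show ?thesis using 1 unfolding 2 by (simp add: sums_unique2)
  qed
  have "w a - v a = 0" for a
  proof (rule zero_if_orthogonal_to_gaussians[where f = "\<lambda>t. w t - v t" and a = a])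
    show "continuous_on UNIV (\<lambda>t. w t - v t)" by (intro continuous_intros w v_cont)
    show "\<bar>w t - v t\<bar> \<le> B + (\<Sum>j. 2 * M * (c j / \<sigma> j))" for t using w(2)[of t] vb[of t] by linarith
    fix b :: real assume b: "b > 0"
    let ?\<psi> = "gaussian a b" let ?\<phi> = "G_conv ?\<psi>"
    have vm [measurable]: "v \<in> borel_measurable borel" using v_cont by (rule borel_measurable_continuous_onI)
    note i\<psi> = integrable_gaussian[OF b, of a]
    have bi: "integrable lborel (\<lambda>t. of_real (k t) * ?\<psi> t)" if [measurable]: "k \<in> borel_measurable borel" and k: "\<And>t. \<bar>k t\<bar> \<le> N" for k :: "real \<Rightarrow> real" and N
      by (rule Bochner_Integration.integrable_bound[OF integrable_mult_right[OF i\<psi>, of "of_real N"]])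
        (use borel_measurable_integrable[OF i\<psi>] order_trans[OF k abs_ge_self] in \<open>auto simp: norm_mult intro!: mult_right_mono AE_I2\<close>)
    have i\<phi>: "integrable lborel (\<lambda>t. of_real (k t) * ?\<phi> t)" if "k \<in> borel_measurable borel" "\<And>t. \<bar>k t\<bar> \<le> N" for k :: "real \<Rightarrow> real" and N
      using G_conv_pairing(1)[OF i\<psi>, of "\<lambda>t. of_real (k t)" N] that by (simp add: mult.commute)
    have cyl: "cyl_frac_lap n \<gamma> ?\<phi> t = ?\<psi> t + of_real \<kappa> * ?\<phi> t" for t
      by (rule cyl_frac_lap_G_conv_gaussian[OF _ b]) (rule symbol)
    have "(LBINT t. of_real (w t) * cyl_frac_lap n \<gamma> ?\<phi> t) = (LBINT t. of_real (\<kappa> * w t + f t) * ?\<phi> t)"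
      using eq schwartz_G_conv[OF schwartz_gaussian[OF b]] unfolding cyl_frac_lap_eq_def by blast
    also have "(LBINT t. of_real (w t) * cyl_frac_lap n \<gamma> ?\<phi> t) = (LBINT t. of_real (w t) * ?\<psi> t + of_real \<kappa> * (of_real (w t) * ?\<phi> t))"
      unfolding cyl by (intro Bochner_Integration.integral_cong refl) (simp add: algebra_simps)
    also have "\<dots> = (LBINT t. of_real (w t) * ?\<psi> t) + of_real \<kappa> * (LBINT t. of_real (w t) * ?\<phi> t)"
      using bi[OF _ w(2)] i\<phi>[OF _ w(2)] by simp
    also have "(LBINT t. of_real (\<kappa> * w t + f t) * ?\<phi> t) = (LBINT t. of_real \<kappa> * (of_real (w t) * ?\<phi> t) + of_real (f t) * ?\<phi> t)"
      by (intro Bochner_Integration.integral_cong refl) (simp add: algebra_simps)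
    also have "\<dots> = of_real \<kappa> * (LBINT t. of_real (w t) * ?\<phi> t) + (LBINT t. of_real (f t) * ?\<phi> t)"
      using i\<phi>[OF _ fabs] i\<phi>[OF _ w(2)] by simp
    finally have "(LBINT t. of_real (w t) * ?\<psi> t) = (LBINT t. ?\<phi> t * of_real (f t))"
      by (simp add: mult.commute)
    also have "\<dots> = (LBINT u. of_real (G u) * (LBINT x. ?\<psi> x * of_real (f (x + u))))"
      by (rule G_conv_pairing(2)[OF i\<psi>, of _ M]) (use fabs in auto)
    also have "\<dots> = (LBINT u. LBINT x. ?\<psi> x * of_real (G u) * of_real (f (x + u)))"
    proof (intro Bochner_Integration.integral_cong refl)
      fix u
      have "(LBINT x. ?\<psi> x * of_real (G u) * of_real (f (x + u))) = (LBINT x. of_real (G u) * (?\<psi> x * of_real (f (x + u))))"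
        by (intro Bochner_Integration.integral_cong refl) (simp only: mult_ac)
      then show "of_real (G u) * (LBINT x. ?\<psi> x * of_real (f (x + u))) = (LBINT x. ?\<psi> x * of_real (G u) * of_real (f (x + u)))"
        by simp
    qed
    also have "\<dots> = (LBINT x. LBINT u. ?\<psi> x * of_real (G u) * of_real (f (x + u)))"
      by (rule Fubini_integral_bounded_factor(2)[OF integrable_pair_product[OF i\<psi> integrable_G], of _ M]) (use fabs in auto)
    also have "\<dots> = (LBINT x. of_real (v x) * ?\<psi> x)"
    proof (intro Bochner_Integration.integral_cong refl)
      fix x
      show "(LBINT u. ?\<psi> x * of_real (G u) * of_real (f (x + u))) = of_real (v x) * ?\<psi> x"
        unfolding mult.assoc integral_mult_right_zero V by (rule mult.commute)
    qed
    finally show "(LBINT t. of_real (w t - v t) * ?\<psi> t) = 0"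
      using bi[OF _ w(2)] bi[OF _ vb] by (simp add: left_diff_distrib)
  qed
  then have "w t = v t" by simp
  then show ?thesis unfolding v_def using summable_sums[OF sm[of t]] by simp
qed

end

section \<open>Evaluation of the three integrals\<close>

theorem proposition6p2:
  fixes n :: nat and \<gamma> \<kappa> :: real and \<sigma> \<tau> c :: "nat \<Rightarrow> real"
    and w :: "real \<Rightarrow> real" and W :: "nat \<Rightarrow> real \<Rightarrow> real"
  assumes "0 < \<gamma>" "\<gamma> < 1" and "n \<ge> 2" and "0 \<le> \<kappa>" "\<kappa> < hardy_const n \<gamma>"
    and "pole_data n \<gamma> \<kappa> \<sigma> \<tau>"
    and "\<And>j. c j = green_coeff n \<gamma> \<kappa> (\<sigma> j) (\<tau> j)"
    and "\<And>j. \<tau> j = 0"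
    and "decaying_solution n \<gamma> \<kappa> w"
    and "\<And>j. W j = component n \<gamma> w (\<sigma> j)"
  shows "(\<forall>t. (\<lambda>j. c j * W j t) sums w t) \<and>
    (\<forall>j t. W j differentiable (at t)) \<and>
    (\<forall>j. integrable lborel (\<lambda>t. (deriv (W j) t)\<^sup>2)) \<and>
    (\<forall>j. integrable lborel (\<lambda>t. (W j t)\<^sup>2)) \<and>
    (integrable lborel (\<lambda>t. w t powr (2 * n / (n - 2 * \<gamma>)))) \<and>
    (summable (\<lambda>j. c j / \<sigma> j * (LINT t|lborel. (deriv (W j) t)\<^sup>2))) \<and>
    (summable (\<lambda>j. \<sigma> j * c j * (LINT t|lborel. (W j t)\<^sup>2))) \<and>
    (1 / (2 * \<gamma>) * (\<Sum>j. c j / \<sigma> j * (LINT t|lborel. (deriv (W j) t)\<^sup>2)) =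
         1 / (2 * (n - \<gamma>)) * (\<Sum>j. \<sigma> j * c j * (LINT t|lborel. (W j t)\<^sup>2))) \<and>
    (1 / (2 * (n - \<gamma>)) * (\<Sum>j. \<sigma> j * c j * (LINT t|lborel. (W j t)\<^sup>2)) =
         1 / n * (LINT t|lborel. w t powr (2 * n / (n - 2 * \<gamma>))))"
proof -
  have gs: "0 < \<sigma> 0" "\<sigma> 0 \<le> \<sigma> j" "0 < c j" "summable (\<lambda>j. c j / \<sigma> j)"
    "\<xi> \<noteq> 0 \<Longrightarrow> (Theta0 n \<gamma> (of_real \<xi>) - of_real \<kappa>) * of_real (\<Sum>j. 2 * c j * \<sigma> j / (\<xi>\<^sup>2 + (\<sigma> j)\<^sup>2)) = 1" for j \<xi>
    by (rule green_function_symbol[OF assms(1-8)]; assumption?)+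
  interpret K: exp_sum_kernel c \<sigma> by unfold_locales (rule gs)+
  define p where "p = crit_exp n \<gamma>"
  have n\<gamma>: "real n - 2 * \<gamma> > 0" "real n > 0" "real n \<ge> 2" using assms(1-3) by auto
  have p1: "p + 1 = 2 * n / (n - 2 * \<gamma>)" using n\<gamma> by (simp add: p_def crit_exp_def field_simps)
  have p: "p > 1" using n\<gamma> assms(1) by (simp add: p_def crit_exp_def)
  have w: "continuous_on UNIV w" "\<And>t. 0 \<le> w t" "(w \<longlongrightarrow> 0) at_top" "(w \<longlongrightarrow> 0) at_bot"
    and eq: "cyl_frac_lap_eq n \<gamma> w (\<lambda>t. \<kappa> * w t + w t powr p)"
    using assms(9) by (simp_all add: decaying_solution_def p_def)
  obtain B where B: "\<And>t. w t \<le> B" using bounded_of_limits[OF w(1,3,4)] by (metis abs_le_D1)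
  have "(\<lambda>j. c j * exp_conv (\<sigma> j) (\<lambda>u. w u powr p) t) sums w t" for t
  proof (rule K.green_representation[where f = "\<lambda>u. w u powr p" and w = w and M = "B powr p" and B = B])
    show "(Theta0 n \<gamma> (of_real \<xi>) - of_real \<kappa>) * of_real (K.R \<xi>) = 1" if "\<xi> \<noteq> 0" for \<xi>
      unfolding K.R_def by (rule gs(5)[OF that])
    show "\<bar>w t\<bar> \<le> B" for t using w(2)[of t] B[of t] by simp
    show "continuous_on UNIV (\<lambda>u. w u powr p)"
      using w(2) p by (intro continuous_on_powr' w continuous_intros) auto
    show "w t powr p \<le> B powr p" for t using w(2) B p by (intro powr_mono2) auto
  qed (use w eq in auto)
  then interpret S: exp_sum_solution c \<sigma> p w
    using p w by unfold_locales
  have W: "W j = S.W j" for j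
  proof -
    have "S.h = (\<lambda>t. w t powr p)" by (simp add: fun_eq_iff S.h_def)
    then show ?thesis unfolding S.W_def by (simp add: assms(10) component_def exp_conv_def p_def fun_eq_iff)
  qed
  have W': "deriv (S.W j) = S.W' j" for j
    using S.W_deriv by (intro ext DERIV_imp_deriv)
  define A B I where "A = (\<Sum>j. c j / \<sigma> j * (LBINT t. (deriv (W j) t)\<^sup>2))"
    and "B = (\<Sum>j. \<sigma> j * c j * (LBINT t. (W j t)\<^sup>2))"
    and "I = (LBINT t. w t powr (2 * n / (n - 2 * \<gamma>)))"
  note po = S.pohozaev[folded W', folded W, unfolded p1, folded A_def B_def I_def]
  have AB: "A = 2 * \<gamma> / n * I" "B = 2 * (n - \<gamma>) / n * I"
  proof -
    \<comment> \<open>For p + 1 = 2 n / (n - 2 \<gamma>) the coefficient 4 / (p + 1) is 2 - 4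
      \<gamma> / n. The two relations thus read A + B = 2 I and A - B = 2 X - 2 I, with solution A =
      X and B = 2 I - X.\<close>
    define X where "X = 2 * \<gamma> / n * I"
    have 1: "4 / (2 * n / (n - 2 * \<gamma>)) * I = 2 * I - 2 * X" and 2: "2 * (n - \<gamma>) / n * I = 2 * I - X"
      using n\<gamma> by (simp_all add: X_def field_simps)
    have "A = X" "B = 2 * I - X" using po(2,3)[unfolded 1] by linarith+
    then show "A = 2 * \<gamma> / n * I" "B = 2 * (n - \<gamma>) / n * I" unfolding 2 by (simp_all add: X_def)
  qed
  have "1 / (2 * \<gamma>) * A = 1 / (2 * (n - \<gamma>)) * B" "1 / (2 * (n - \<gamma>)) * B = 1 / n * I"
    unfolding AB using n\<gamma> assms(1,2) by simp_all
  moreover have "W j differentiable (at t)" for j t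
    unfolding W using S.W_deriv real_differentiable_def by blast
  ultimately show ?thesis
    using S.w_sums S.W_sq_integrable S.W'_sq_integrable po(1) S.summable_W_sq S.summable_W'_sq
    unfolding A_def B_def I_def W W' by blast
qed

end
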